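(* Let $d\ge1$, $0<\alpha<2$, and let $\{X_t\}_{t\in\mathbb{Z}^d}$ be a stationary $S\alpha S$ random field with integral representation $X_t\stackrel{d}{=}\int_Sf_t\,dM$, where $$f_t(s)=c_t(s)\Big(\frac{d\mu\circ\phi_t}{d\mu}(s)\Big)^{1/\alpha} f\circ\phi_t(s),\qquad t\in\mathbb{Z}^d,$$ $f\in L^\alpha(S,\mu)$, $\{\phi_t\}_{t\in\mathbb{Z}^d}$ is a nonsingular $\mathbb{Z}^d$-action on $(S,\mu)$, $\{c_t\}$ is a measurable $\{-1,+1\}$-valued cocycle for $\{\phi_t\}$, and $\mathrm{Support}(f_t,t\in\mathbb{Z}^d)=S$. Let $$b_n=\Big(\int_S\max_{0\le t\le(n-1)\mathbf 1}|f_t(s)|^\alpha\,\mu(ds)\Big)^{1/\alpha},\qquad n\ge1 .$$ 1. If the action $\{\phi_t\}$ is conservative, then $n^{-d/\alpha}b_n\to0$ as $n\to\infty$. 2. If the action $\{\phi_t\}$ is dissipative, and the random field is given in the mixed moving average form $$\{X_t\}_{t\in\mathbb{Z}^d}\stackrel{d}{=}\Big\{\int_{W\times\mathbb{Z}^d}f(v,t+s)\,M(dv,ds)\Big\}_{t\in\mathbb{Z}^d}$$ with kernel $f\in L^\alpha(W\times\mathbb{Z}^d,\nu\otimes l)$, then $$\lim_{n\to\infty}n^{-d/\alpha}b_n=\Big(\int_W g(v)^\alpha\,\nu(dv)\Big)^{1/\alpha}\in(0,\infty),\qquad\text{where } g(v)=\sup_{s\in\mathbb{Z}^d}|f(v,s)|,\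 v\in W .$$
   Context: A random field $\{X_t\}_{t\in\mathbb{Z}^d}$ is $S\alpha S$ (symmetric $\alpha$-stable) if every finite real linear combination $\sum_j c_jX_{t_j}$ has a symmetric $\alpha$-stable distribution; it is stationary if $\{X_t\}\stackrel{d}{=}\{X_{t+s}\}$ for all $s\in\mathbb{Z}^d$. Random fields are assumed non-Gaussian throughout (in particular not identically zero). Integral representation: $\{X_t\}\stackrel{d}{=}\{\int_S f_t\,dM\}$ (equality of finite-dimensional distributions), where $(S,\mathcal S)$ is a standard Borel space, $\mu$ is a $\sigma$-finite measure on it, $f_t\in L^\alpha(S,\mu)$ are real-valued, and $M$ is an $S\alpha S$ random measure with control measure $\mu$, i.e. an independently scattered random measure with $E\exp(i\theta\int f\,dM)=\exp(-|\theta|^\alpha\int|f|^\alpha d\mu)$ for $f\in L^\alpha(\mu)$. $\mathrm{Support}(f_t,t\in\mathbb{Z}^d)=S$ means $\bigcup_t\{f_t\ne0\}=S$ up to a $\mu$-null set. For $u,v\in\mathbb{Z}^d$, $u\le v$ is meant coordinatewise, and $\mathbf 1=(1,\dots,1)$. The sequence $b_n$ depends only on the law of $\{X_t\}$, not on the integral representation. In the mixed moving average form, $(W,\mathcal W)$ is a standard Borel space with $\sigma$-finite measure $\nu$, $l$ is counting measure on $\mathbb{Z}^d$, and the $S\alpha S$ random measure has control measure $\nu\otimes l$. A group action $\{\phi_t\}_{t\in\mathbb{Z}^d}$ on $S$ is a family of measurable maps $\phi_t:S\to S$ with $\phi_0=\mathrm{id}$, $\phi_{u+v}=\phi_u\circ\phi_v$;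 it is nonsingular if $\mu\circ\phi_t\sim\mu$ for all $t$. A $\{-1,+1\}$-valued cocycle is a family of measurable maps $c_t:S\to\{-1,+1\}$ such that for all $u,v$, $c_{u+v}(s)=c_v(s)c_u(\phi_v(s))$ for $\mu$-a.a. $s$. A set $W_*\in\mathcal S$ is wandering if the sets $\phi_t(W_* )$, $t\in\mathbb{Z}^d$, are pairwise disjoint. The action is conservative if there is no wandering set of positive $\mu$-measure, and dissipative if $S=\bigcup_t\phi_t(W_* )$ (mod $\mu$) for some wandering set $W_*$. *)

theory Defs
  imports "HOL-Probability.Probability"
begin

text \<open>
  The index set \<open>\<int>\<^sup>d\<close> is \<open>int ^ 'd\<close> with \<open>d = CARD('d)\<close>; its order is coordinatewise.
\<close>

definition standard_borel :: "'a measure \<Rightarrow> bool" where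
  "standard_borel M \<longleftrightarrow>
     (\<exists>T. topspace T = space M \<and> completely_metrizable_space T \<and> second_countable T \<and>
          sets M = sigma_sets (topspace T) {U. openin T U})"

text \<open>Real-valued members of \<open>L\<^sup>\<alpha>\<close>; for \<open>\<alpha> < 1\<close> this is not a normed space.\<close>

definition in_L :: "real \<Rightarrow> 'a measure \<Rightarrow> ('a \<Rightarrow> real) \<Rightarrow> bool" where
  "in_L \<alpha> \<mu> f \<longleftrightarrow> f \<in> borel_measurable \<mu> \<and> integrable \<mu> (\<lambda>s. \<bar>f s\<bar> powr \<alpha>)"


subsection \<open>Random fields\<close>

text \<open>Scale \<open>\<sigma> = 0\<close> (the point mass at 0) is allowed.\<close>

definition sas_distribution :: "real \<Rightarrow> real measure \<Rightarrow> bool" where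
  "sas_distribution \<alpha> D \<longleftrightarrow>
     (\<exists>\<sigma>\<ge>0. \<forall>\<theta>. char D \<theta> = complex_of_real (exp (- (\<sigma> powr \<alpha> * \<bar>\<theta>\<bar> powr \<alpha>))))"

definition sas_field :: "real \<Rightarrow> 'p measure \<Rightarrow> ('t \<Rightarrow> 'p \<Rightarrow> real) \<Rightarrow> bool" where
  "sas_field \<alpha> P X \<longleftrightarrow>
     (\<forall>t. X t \<in> borel_measurable P) \<and>
     (\<forall>J c. finite J \<longrightarrow> sas_distribution \<alpha> (distr P borel (\<lambda>\<omega>. \<Sum>t\<in>J. c t * X t \<omega>)))"

text \<open>Degenerate (constant) normal laws count as Gaussian, so the zero field is Gaussian.\<close>

definition gaussian_field :: "'p measure \<Rightarrow> ('t \<Rightarrow> 'p \<Rightarrow> real) \<Rightarrow> bool" where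
  "gaussian_field P X \<longleftrightarrow>
     (\<forall>J c. finite J \<longrightarrow>
        (\<exists>m. AE \<omega> in P. (\<Sum>t\<in>J. c t * X t \<omega>) = m) \<or>
        (\<exists>m. \<exists>\<sigma>>0. distributed P lborel (\<lambda>\<omega>. \<Sum>t\<in>J. c t * X t \<omega>) (normal_density m \<sigma>)))"

definition same_fdd ::
    "'p measure \<Rightarrow> ('t \<Rightarrow> 'p \<Rightarrow> real) \<Rightarrow> 'q measure \<Rightarrow> ('t \<Rightarrow> 'q \<Rightarrow> real) \<Rightarrow> bool" where
  "same_fdd P X Q Y \<longleftrightarrow>
     (\<forall>J. finite J \<longrightarrow>
        distr P (Pi\<^sub>M J (\<lambda>_. borel)) (\<lambda>\<omega>. \<lambda>t\<in>J. X t \<omega>) =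
        distr Q (Pi\<^sub>M J (\<lambda>_. borel)) (\<lambda>\<omega>. \<lambda>t\<in>J. Y t \<omega>))"

definition stationary_field :: "'p measure \<Rightarrow> ('t::plus \<Rightarrow> 'p \<Rightarrow> real) \<Rightarrow> bool" where
  "stationary_field P X \<longleftrightarrow> (\<forall>s. same_fdd P X P (\<lambda>t. X (t + s)))"


subsection \<open>Stable random measures and stable integrals\<close>

definition finite_sets :: "'a measure \<Rightarrow> 'a set set" where
  "finite_sets \<mu> = {A \<in> sets \<mu>. emeasure \<mu> A < \<infinity>}"

definition simple_stable_integral ::
    "'a measure \<Rightarrow> ('a set \<Rightarrow> 'q \<Rightarrow> real) \<Rightarrow> ('a \<Rightarrow> real) \<Rightarrow> 'q \<Rightarrow> real" where
  "simple_stable_integral \<mu> M g \<omega> = (\<Sum>y\<in>g ` space \<mu> - {0}. y * M (g -` {y} \<inter> space \<mu>) \<omega>)"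

text \<open>
  \<open>Y\<close> is (a version of) \<open>\<integral> f dM\<close>: the limit in probability of the integrals of simple functions
  that converge to \<open>f\<close> in \<open>L\<^sup>\<alpha>\<close>.
\<close>

definition is_stable_integral ::
    "real \<Rightarrow> 'a measure \<Rightarrow> 'q measure \<Rightarrow> ('a set \<Rightarrow> 'q \<Rightarrow> real) \<Rightarrow> ('a \<Rightarrow> real) \<Rightarrow> ('q \<Rightarrow> real) \<Rightarrow> bool"
  where
  "is_stable_integral \<alpha> \<mu> Q M f Y \<longleftrightarrow>
     Y \<in> borel_measurable Q \<and>
     (\<exists>g. (\<forall>k::nat. simple_function \<mu> (g k) \<and>
                     emeasure \<mu> {s \<in> space \<mu>. g k s \<noteq> 0} < \<infinity>) \<and>
          (\<lambda>k. \<integral>\<^sup>+ s. ennreal (\<bar>g k s - f s\<bar> powr \<alpha>) \<partial>\<mu>) \<longlonglongrightarrow> 0 \<and>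
          (\<forall>\<epsilon>>0. (\<lambda>k. measure Q {\<omega> \<in> space Q. \<bar>simple_stable_integral \<mu> M (g k) \<omega> - Y \<omega>\<bar> > \<epsilon>})
                 \<longlonglongrightarrow> 0))"

text \<open>
  The last clause, applied to indicator functions, contains the law of \<open>M A\<close> for \<open>A\<close> of finite
  measure, namely \<open>S\<alpha>S\<close> with scale \<open>\<mu>(A)\<^bsup>1/\<alpha>\<^esup>\<close>.
\<close>

definition sas_random_measure ::
    "real \<Rightarrow> 'a measure \<Rightarrow> 'q measure \<Rightarrow> ('a set \<Rightarrow> 'q \<Rightarrow> real) \<Rightarrow> bool" where
  "sas_random_measure \<alpha> \<mu> Q M \<longleftrightarrow>
     prob_space Q \<and>
     (\<forall>A\<in>finite_sets \<mu>. M A \<in> borel_measurable Q) \<and>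
     (\<forall>A::nat \<Rightarrow> 'a set. range A \<subseteq> finite_sets \<mu> \<and> disjoint_family A \<longrightarrow>
        prob_space.indep_vars Q (\<lambda>_. borel) (\<lambda>i. M (A i)) UNIV) \<and>
     (\<forall>A::nat \<Rightarrow> 'a set. range A \<subseteq> finite_sets \<mu> \<and> disjoint_family A \<and>
        (\<Union>i. A i) \<in> finite_sets \<mu> \<longrightarrow>
        (AE \<omega> in Q. (\<lambda>i. M (A i) \<omega>) sums M (\<Union>i. A i) \<omega>)) \<and>
     (\<forall>f Y. in_L \<alpha> \<mu> f \<and> is_stable_integral \<alpha> \<mu> Q M f Y \<longrightarrow>
        (\<forall>\<theta>. char (distr Q borel Y) \<theta> =
             complex_of_real (exp (- (\<bar>\<theta>\<bar> powr \<alpha> * (\<integral>s. \<bar>f s\<bar> powr \<alpha> \<partial>\<mu>))))))"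

text \<open>
  \<open>X\<close> (on \<open>P\<close>) has the same finite-dimensional distributions as \<open>(\<integral> F t dM)\<^sub>t\<close>, where \<open>M\<close> is an
  \<open>S\<alpha>S\<close> random measure on \<open>Q\<close> with control measure \<open>\<mu>\<close>.
\<close>

definition integral_representation ::
    "real \<Rightarrow> 'p measure \<Rightarrow> ('t \<Rightarrow> 'p \<Rightarrow> real) \<Rightarrow> 'a measure \<Rightarrow> 'q measure \<Rightarrow>
      ('a set \<Rightarrow> 'q \<Rightarrow> real) \<Rightarrow> ('t \<Rightarrow> 'a \<Rightarrow> real) \<Rightarrow> bool" where
  "integral_representation \<alpha> P X \<mu> Q M F \<longleftrightarrow>
     sas_random_measure \<alpha> \<mu> Q M \<and>
     (\<forall>t. in_L \<alpha> \<mu> (F t)) \<and>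
     (\<exists>Y. (\<forall>t. is_stable_integral \<alpha> \<mu> Q M (F t) (Y t)) \<and> same_fdd P X Q Y)"

definition mixed_moving_average ::
    "real \<Rightarrow> 'p measure \<Rightarrow> (int ^ 'd \<Rightarrow> 'p \<Rightarrow> real) \<Rightarrow> 'w measure \<Rightarrow> 'q measure \<Rightarrow>
      (('w \<times> (int ^ 'd)) set \<Rightarrow> 'q \<Rightarrow> real) \<Rightarrow> ('w \<times> (int ^ 'd) \<Rightarrow> real) \<Rightarrow> bool" where
  "mixed_moving_average \<alpha> P X \<nu> Q M h \<longleftrightarrow>
     in_L \<alpha> (\<nu> \<Otimes>\<^sub>M count_space UNIV) h \<and>
     integral_representation \<alpha> P X (\<nu> \<Otimes>\<^sub>M count_space UNIV) Q M (\<lambda>t (v, s). h (v, t + s))"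


subsection \<open>Nonsingular actions and cocycles\<close>

definition group_action :: "'a measure \<Rightarrow> (int ^ 'd \<Rightarrow> 'a \<Rightarrow> 'a) \<Rightarrow> bool" where
  "group_action \<mu> \<phi> \<longleftrightarrow>
     (\<forall>t. \<phi> t \<in> measurable \<mu> \<mu>) \<and>
     (\<forall>s\<in>space \<mu>. \<phi> 0 s = s) \<and>
     (\<forall>u v. \<forall>s\<in>space \<mu>. \<phi> (u + v) s = \<phi> u (\<phi> v s))"

text \<open>
  The measure \<open>\<mu> \<circ> \<phi>\<^sub>t\<close>, i.e. \<open>A \<mapsto> \<mu>(\<phi>\<^sub>t(A))\<close>. It is the image of \<open>\<mu>\<close> under \<open>\<phi>\<^bsub>-t\<^esub>\<close>, because
  \<open>\<phi>\<^sub>t(A) = \<phi>\<^bsub>-t\<^esub>\<^sup>-\<^sup>1(A)\<close>.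
\<close>

definition comp_measure :: "'a measure \<Rightarrow> (int ^ 'd \<Rightarrow> 'a \<Rightarrow> 'a) \<Rightarrow> int ^ 'd \<Rightarrow> 'a measure" where
  "comp_measure \<mu> \<phi> t = distr \<mu> \<mu> (\<phi> (- t))"

lemma emeasure_comp_measure:
  assumes "group_action \<mu> \<phi>" and A: "A \<in> sets \<mu>"
  shows "\<phi> t ` A \<in> sets \<mu>" and "emeasure (comp_measure \<mu> \<phi> t) A = emeasure \<mu> (\<phi> t ` A)"
proof -
  have meas: "\<phi> u \<in> measurable \<mu> \<mu>" for u
    using assms(1) by (simp add: group_action_def)
  have inv: "\<phi> u (\<phi> (- u) s) = s" "\<phi> (- u) (\<phi> u s) = s" if "s \<in> space \<mu>" for u s
    using assms(1) that unfolding group_action_def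
    by (metis add.right_inverse, metis add.left_inverse)
  have img: "\<phi> t ` A = \<phi> (- t) -` A \<inter> space \<mu>"
  proof (intro equalityI subsetI)
    fix s assume "s \<in> \<phi> t ` A"
    then obtain a where a: "a \<in> A" "s = \<phi> t a" by blast
    have "a \<in> space \<mu>" using a(1) A sets.sets_into_space by blast
    then show "s \<in> \<phi> (- t) -` A \<inter> space \<mu>"
      using a inv(2) measurable_space[OF meas] by simp
  next
    fix s assume "s \<in> \<phi> (- t) -` A \<inter> space \<mu>"
    then show "s \<in> \<phi> t ` A" using inv(1) by (metis IntE image_eqI vimageE)
  qed
  show "\<phi> t ` A \<in> sets \<mu>" unfolding img by (rule measurable_sets[OF meas A])
  show "emeasure (comp_measure \<mu> \<phi> t) A = emeasure \<mu> (\<phi> t ` A)"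
    unfolding comp_measure_def img by (rule emeasure_distr[OF meas A])
qed

definition nonsingular_action :: "'a measure \<Rightarrow> (int ^ 'd \<Rightarrow> 'a \<Rightarrow> 'a) \<Rightarrow> bool" where
  "nonsingular_action \<mu> \<phi> \<longleftrightarrow>
     group_action \<mu> \<phi> \<and>
     (\<forall>t. absolutely_continuous \<mu> (comp_measure \<mu> \<phi> t) \<and>
          absolutely_continuous (comp_measure \<mu> \<phi> t) \<mu>)"

definition sign_cocycle ::
    "'a measure \<Rightarrow> (int ^ 'd \<Rightarrow> 'a \<Rightarrow> 'a) \<Rightarrow> (int ^ 'd \<Rightarrow> 'a \<Rightarrow> real) \<Rightarrow> bool" where
  "sign_cocycle \<mu> \<phi> c \<longleftrightarrow>
     (\<forall>t. c t \<in> borel_measurable \<mu> \<and> (\<forall>s\<in>space \<mu>. c t s \<in> {-1, 1})) \<and>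
     (\<forall>u v. AE s in \<mu>. c (u + v) s = c v s * c u (\<phi> v s))"

definition wandering :: "'a measure \<Rightarrow> (int ^ 'd \<Rightarrow> 'a \<Rightarrow> 'a) \<Rightarrow> 'a set \<Rightarrow> bool" where
  "wandering \<mu> \<phi> W \<longleftrightarrow> W \<in> sets \<mu> \<and> disjoint_family (\<lambda>t. \<phi> t ` W)"

definition conservative :: "'a measure \<Rightarrow> (int ^ 'd \<Rightarrow> 'a \<Rightarrow> 'a) \<Rightarrow> bool" where
  "conservative \<mu> \<phi> \<longleftrightarrow> (\<nexists>W. wandering \<mu> \<phi> W \<and> emeasure \<mu> W > 0)"

definition dissipative :: "'a measure \<Rightarrow> (int ^ 'd \<Rightarrow> 'a \<Rightarrow> 'a) \<Rightarrow> bool" where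
  "dissipative \<mu> \<phi> \<longleftrightarrow> (\<exists>W. wandering \<mu> \<phi> W \<and> (AE s in \<mu>. s \<in> (\<Union>t. \<phi> t ` W)))"

definition action_kernel ::
    "real \<Rightarrow> 'a measure \<Rightarrow> (int ^ 'd \<Rightarrow> 'a \<Rightarrow> 'a) \<Rightarrow> (int ^ 'd \<Rightarrow> 'a \<Rightarrow> real) \<Rightarrow> ('a \<Rightarrow> real) \<Rightarrow>
      int ^ 'd \<Rightarrow> 'a \<Rightarrow> real" where
  "action_kernel \<alpha> \<mu> \<phi> c f t s =
     c t s * enn2real (RN_deriv \<mu> (comp_measure \<mu> \<phi> t) s) powr (1 / \<alpha>) * f (\<phi> t s)"

definition full_support :: "'a measure \<Rightarrow> ('t \<Rightarrow> 'a \<Rightarrow> real) \<Rightarrow> bool" where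
  "full_support \<mu> F \<longleftrightarrow> (AE s in \<mu>. \<exists>t. F t s \<noteq> 0)"

text \<open>The sequence \<open>b\<^sub>n\<close>; only \<open>n \<ge> 1\<close> is meaningful, as the index set is empty for \<open>n = 0\<close>.\<close>

definition max_scale :: "real \<Rightarrow> 'a measure \<Rightarrow> (int ^ 'd \<Rightarrow> 'a \<Rightarrow> real) \<Rightarrow> nat \<Rightarrow> real" where
  "max_scale \<alpha> \<mu> F n =
     (\<integral>s. Max ((\<lambda>t. \<bar>F t s\<bar> powr \<alpha>) ` {t. 0 \<le> t \<and> t \<le> (\<chi> i. int n - 1)}) \<partial>\<mu>) powr (1 / \<alpha>)"

end

theory Submission
  imports Defs "HOL-Computational_Algebra.Polynomial"
begin

text \<open>
  Conservative case. Charge the maximum over a window to the first window position at which it is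
  attained, where first refers to a translation-invariant linear order of \<open>\<int>\<^sup>d\<close>. After the change of
  variables \<open>s \<mapsto> \<phi>\<^sub>t(s)\<close> every position well inside the window contributes at most the integral of
  \<open>\<bar>f\<bar>\<^sup>\<alpha>\<close> over the points whose value beats all its translates in a large cube. The points that beat
  all their translates form a wandering set, so this contribution tends to 0.

  Dissipative case. The law of the field determines \<open>\<integral>\<bar>\<Sum>c\<^sub>t f\<^sub>t\<bar>\<^sup>\<alpha> d\<mu>\<close> for all coefficients. Averaging over
  Gaussian coefficients yields \<open>\<integral>(\<Sum>\<lambda>\<^sub>t f\<^sub>t\<^sup>2)\<^bsup>\<alpha>/2\<^esup> d\<mu>\<close> for all \<open>\<lambda>\<^sub>t \<ge> 0\<close>. As \<open>u\<^bsup>\<alpha>/2\<^esup>\<close> is a mixture of the functions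
  \<open>1 - exp (- r u)\<close>, this determines the integrals of exponential polynomials in the \<open>f\<^sub>t\<^sup>2\<close>, and a
  suitable sequence of these isolates \<open>max f\<^sub>t\<^sup>2\<close>. Hence \<open>b\<^sub>n\<close> may be computed from the moving average
  representation, where \<open>n\<^bsup>-d\<^esup> \<Sum>\<^sub>s max\<^sub>t \<bar>f(v, t + s)\<bar>\<^sup>\<alpha>\<close> tends to \<open>g(v)\<^sup>\<alpha>\<close> and is dominated by
  \<open>\<Sum>\<^sub>s \<bar>f(v, s)\<bar>\<^sup>\<alpha>\<close>.
\<close>

subsection \<open>Windows and cubes in the lattice\<close>

text \<open>The two representations live on unrelated spaces, and equality in law yields only the
  scale of each finite linear combination. A maximum is not such a scale, and the powers
  \<open>\<bar>\<Sum>t\<in>J. c t * F t s\<bar> powr \<alpha>\<close> are not closed under products,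
  so they do not generate an approximation of it directly. Exponentials are closed under products;
  this is the reason for the two changes of family. The mixing measure is infinite near 0: the
  mixture formula converges because \<open>\<alpha> / 2\<close> is below 1, and every limit taken
  under it needs a bound linear in \<open>r\<close>. Even the scale of a combination takes work,
  since the random measure is additive only almost surely and only on sets of finite measure. In the
  conservative case ties are the obstacle. For a finite measure-preserving action and constant
  \<open>f\<close> every point equals all its translates, so weak maximisers need not form a
  wandering set; a group order breaks ties consistently along each orbit. The limit in the
  dissipative case is positive because a vanishing \<open>g\<close> would make the field almost
  surely zero, which counts as Gaussian.\<close>

definition lexkey :: "int ^ 'd \<Rightarrow> int poly" where
  "lexkey v = (\<Sum>i\<in>UNIV. monom (v $ i) (to_nat i))"

text \<open>Additivity and injectivity embed the lattice as a group into \<open>int poly\<close>,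
  which is linearly ordered by the sign of the leading coefficient. Pulling this order back gives a
  translation-invariant one: it is lexicographic, with the coordinate of largest
  \<open>to_nat\<close> index compared first.\<close>

lemma lexkey_add: "lexkey (u + v) = lexkey u + lexkey v"
  by (simp add: lexkey_def add_monom [symmetric] sum.distrib)

lemma lexkey_diff: "lexkey (u - v) = lexkey u - lexkey v"
  using lexkey_add[of "u - v" v] by simp

lemma lexkey_inj: "lexkey u = lexkey v \<longleftrightarrow> u = v"
proof
  assume eq: "lexkey u = lexkey v"
  have "coeff (lexkey w) (to_nat i) = w $ i" for w :: "int ^ 'd" and i
    by (simp add: lexkey_def coeff_sum)
  then show "u = v" using eq by (metis vec_eq_iff)
qed simp

lemma box_eq_image:
  fixes a b :: "int ^ 'd"
  shows "{t. a \<le> t \<and> t \<le> b} = vec_lambda ` (\<Pi>\<^sub>E i\<in>UNIV. {a $ i..b $ i})"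
proof (intro equalityI subsetI)
  fix t assume "t \<in> {t. a \<le> t \<and> t \<le> b}"
  then show "t \<in> vec_lambda ` (\<Pi>\<^sub>E i\<in>UNIV. {a $ i..b $ i})"
    by (intro image_eqI[of _ _ "vec_nth t"]) (auto simp: less_eq_vec_def)
qed (auto simp: less_eq_vec_def PiE_iff)

lemma finite_box: "finite {t :: int ^ 'd. a \<le> t \<and> t \<le> b}"
  unfolding box_eq_image by (intro finite_imageI finite_PiE) auto

lemma card_box:
  fixes a b :: "int ^ 'd"
  shows "card {t. a \<le> t \<and> t \<le> b} = (\<Prod>i\<in>UNIV. nat (b $ i - a $ i + 1))"
proof -
  have "inj_on vec_lambda (\<Pi>\<^sub>E i\<in>UNIV. {a $ i..b $ i})"
    by (simp add: inj_on_def vec_lambda_inject)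
  then show ?thesis
    unfolding box_eq_image by (simp add: card_image card_PiE)
qed

definition window :: "nat \<Rightarrow> (int ^ 'd) set" where
  "window n = {t. 0 \<le> t \<and> t \<le> (\<chi> i. int n - 1)}"

definition cube :: "nat \<Rightarrow> (int ^ 'd) set" where
  "cube K = {t. (\<chi> i. - int K) \<le> t \<and> t \<le> (\<chi> i. int K)}"

lemma cube_iff: "t \<in> cube K \<longleftrightarrow> (\<forall>i. \<bar>t $ i\<bar> \<le> int K)"
  by (auto simp: cube_def less_eq_vec_def abs_le_iff minus_le_iff)

lemma window_iff: "t \<in> window n \<longleftrightarrow> (\<forall>i. 0 \<le> t $ i \<and> t $ i < int n)"
  by (auto simp: window_def less_eq_vec_def)

lemma finite_window: "finite (window n)"
  by (simp add: window_def finite_box)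

lemma card_window: "card (window n :: (int ^ 'd) set) = n ^ CARD('d)"
  by (simp add: window_def card_box)

lemma window_nonempty: "n \<ge> 1 \<Longrightarrow> window n \<noteq> {}"
  by (auto simp: window_def less_eq_vec_def intro!: exI[of _ 0])

lemma cube_mono: "K \<le> L \<Longrightarrow> cube K \<subseteq> cube L"
  by (meson cube_iff of_nat_le_iff order_trans subsetI)

lemma UN_cube: "\<exists>K. (t :: int ^ 'd) \<in> cube K"
proof -
  have "\<bar>t $ i\<bar> \<le> int (nat (\<Sum>i\<in>UNIV. \<bar>t $ i\<bar>))" for i
    using member_le_sum[of i UNIV "\<lambda>i. \<bar>t $ i\<bar>"] by simp
  then have "t \<in> cube (nat (\<Sum>i\<in>UNIV. \<bar>t $ i\<bar>))"
    by (simp add: cube_iff)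
  then show ?thesis ..
qed

text \<open>Trimming \<open>K\<close> layers off every face leaves a box of side
  \<open>n - 2 * K\<close>, and every position in it keeps its cube inside the window. The bad
  positions lie in the complement, a boundary layer of negligible share once \<open>n\<close> is
  large compared with \<open>K\<close>.\<close>

lemma card_inner_window:
  assumes "2 * K \<le> n"
  shows "card {t \<in> window n. \<not> (\<forall>s\<in>cube K. s + t \<in> (window n :: (int ^ 'd) set))}
         \<le> n ^ CARD('d) - (n - 2 * K) ^ CARD('d)"
proof -
  let ?I = "{t :: int ^ 'd. (\<chi> i. int K) \<le> t \<and> t \<le> (\<chi> i. int n - 1 - int K)}"
  have c: "card ?I = (n - 2 * K) ^ CARD('d)"
  proof -
    have "nat (int n - 1 - int K - int K + 1) = n - 2 * K" using assms by linarith
    then show ?thesis by (simp add: card_box)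
  qed
  have sub: "?I \<subseteq> window n"
  proof
    fix t assume "t \<in> ?I"
    then have "int K \<le> t $ i \<and> t $ i \<le> int n - 1 - int K" for i
      by (simp add: less_eq_vec_def)
    then show "t \<in> window n" unfolding window_iff by (smt (verit) of_nat_0_le_iff)
  qed
  have "s + t \<in> window n" if "s \<in> cube K" "t \<in> ?I" for s t :: "int ^ 'd"
  proof -
    have "0 \<le> s $ i + t $ i \<and> s $ i + t $ i < int n" for i
    proof -
      have "int K \<le> t $ i" "t $ i \<le> int n - 1 - int K" "\<bar>s $ i\<bar> \<le> int K"
        using that by (simp_all add: less_eq_vec_def cube_iff)
      then show ?thesis by linarith
    qed
    then show ?thesis by (simp add: window_iff)
  qed
  then have "{t \<in> window n. \<not> (\<forall>s\<in>cube K. s + t \<in> (window n :: (int ^ 'd) set))} \<subseteq> window n - ?I"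
    by blast
  then have "card {t \<in> window n. \<not> (\<forall>s\<in>cube K. s + t \<in> (window n :: (int ^ 'd) set))}
      \<le> card (window n - ?I)"
    by (intro card_mono) (auto simp: finite_window)
  also have "\<dots> = n ^ CARD('d) - (n - 2 * K) ^ CARD('d)"
    using sub c by (simp add: card_Diff_subset finite_box card_window)
  finally show ?thesis .
qed


subsection \<open>Nonsingular actions\<close>

locale nonsingular = sigma_finite_measure \<mu> for \<mu> :: "'a measure" +
  fixes \<phi> :: "int ^ 'd \<Rightarrow> 'a \<Rightarrow> 'a"
  assumes nonsingular: "nonsingular_action \<mu> \<phi>"
begin

lemma action: "group_action \<mu> \<phi>"
  using nonsingular by (simp add: nonsingular_action_def)

lemma measurable_action [measurable]: "\<phi> t \<in> measurable \<mu> \<mu>"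
  using action by (simp add: group_action_def)

lemma action_space: "x \<in> space \<mu> \<Longrightarrow> \<phi> t x \<in> space \<mu>"
  by (rule measurable_space[OF measurable_action])

lemma action_add: "x \<in> space \<mu> \<Longrightarrow> \<phi> (u + v) x = \<phi> u (\<phi> v x)"
  and action_zero: "x \<in> space \<mu> \<Longrightarrow> \<phi> 0 x = x"
  using action by (auto simp: group_action_def)

definition jac :: "int ^ 'd \<Rightarrow> 'a \<Rightarrow> ennreal" where
  "jac t = RN_deriv \<mu> (comp_measure \<mu> \<phi> t)"

lemma measurable_jac [measurable]: "jac t \<in> borel_measurable \<mu>"
  by (simp add: jac_def)

lemma density_jac: "density \<mu> (jac t) = distr \<mu> \<mu> (\<phi> (- t))"
  using density_RN_deriv[of "comp_measure \<mu> \<phi> t"] nonsingular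
  by (simp add: jac_def nonsingular_action_def comp_measure_def)

lemma nn_integral_jac:
  assumes [measurable]: "G \<in> borel_measurable \<mu>"
  shows "(\<integral>\<^sup>+x. jac t x * G (\<phi> t x) \<partial>\<mu>) = (\<integral>\<^sup>+x. G x \<partial>\<mu>)"
proof -
  have "(\<integral>\<^sup>+x. jac t x * G (\<phi> t x) \<partial>\<mu>) = (\<integral>\<^sup>+x. G (\<phi> t x) \<partial>density \<mu> (jac t))"
    by (subst nn_integral_density) auto
  also have "\<dots> = (\<integral>\<^sup>+x. G (\<phi> t (\<phi> (- t) x)) \<partial>\<mu>)"
    unfolding density_jac by (subst nn_integral_distr) auto
  also have "\<dots> = (\<integral>\<^sup>+x. G x \<partial>\<mu>)"
    by (intro nn_integral_cong) (metis action_add action_zero add.right_inverse)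
  finally show ?thesis .
qed

text \<open>Chain rule for Radon-Nikodym derivatives. Both densities give every set the same mass,
  by a change of variables along \<open>v\<close> and then along \<open>u\<close>; uniqueness of
  densities finishes.\<close>

lemma jac_cocycle: "AE x in \<mu>. jac (u + v) x = jac v x * jac u (\<phi> v x)"
proof (rule density_unique)
  show "density \<mu> (jac (u + v)) = density \<mu> (\<lambda>x. jac v x * jac u (\<phi> v x))"
  proof (rule measure_eqI)
    fix A assume "A \<in> sets (density \<mu> (jac (u + v)))"
    then have A [measurable]: "A \<in> sets \<mu>" by simp
    have inv: "\<phi> (- v) (\<phi> v x) = x" if "x \<in> space \<mu>" for v x
      using that by (metis action_add action_zero add.left_inverse)
    have ex: "indicator A (\<phi> (- v) x) = (indicator A (\<phi> (- (u + v)) (\<phi> u x)) :: ennreal)"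
      if "x \<in> space \<mu>" for x
      using that by (simp add: action_add[symmetric])
    have "emeasure (density \<mu> (\<lambda>x. jac v x * jac u (\<phi> v x))) A
        = (\<integral>\<^sup>+x. jac v x * (jac u (\<phi> v x) * indicator A (\<phi> (- v) (\<phi> v x))) \<partial>\<mu>)"
      by (subst emeasure_density) (auto intro!: nn_integral_cong simp: inv mult.assoc)
    also have "\<dots> = (\<integral>\<^sup>+x. jac u x * indicator A (\<phi> (- v) x) \<partial>\<mu>)"
      by (rule nn_integral_jac) measurable
    also have "\<dots> = (\<integral>\<^sup>+x. jac u x * indicator A (\<phi> (- (u + v)) (\<phi> u x)) \<partial>\<mu>)"
      using ex by (intro nn_integral_cong) (simp only:)
    also have "\<dots> = (\<integral>\<^sup>+x. indicator A (\<phi> (- (u + v)) x) \<partial>\<mu>)"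
      by (rule nn_integral_jac) measurable
    also have "\<dots> = emeasure (density \<mu> (jac (u + v))) A"
      unfolding density_jac
      by (subst emeasure_distr)
        (auto simp: nn_integral_indicator[symmetric] indicator_def vimage_def intro!: nn_integral_cong
              simp del: nn_integral_indicator)
    finally show "emeasure (density \<mu> (jac (u + v))) A
      = emeasure (density \<mu> (\<lambda>x. jac v x * jac u (\<phi> v x))) A" ..
  qed simp
qed auto

lemma jac_zero: "AE x in \<mu>. jac 0 x = 1"
proof (rule density_unique)
  have "distr \<mu> \<mu> (\<phi> 0) = distr \<mu> \<mu> (\<lambda>x. x)"
    by (intro distr_cong) (auto simp: action_zero)
  then show "density \<mu> (jac 0) = density \<mu> (\<lambda>x. 1)"
    unfolding density_jac by (simp add: distr_id density_1)
qed auto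

definition rjac :: "int ^ 'd \<Rightarrow> 'a \<Rightarrow> real" where
  "rjac t x = enn2real (jac t x)"

lemma measurable_rjac [measurable]: "rjac t \<in> borel_measurable \<mu>"
  unfolding rjac_def by measurable

text \<open>One conull set on which all pointwise identities hold at once and in real numbers; the
  lattice is countable, so the exceptional sets of all pairs \<open>u\<close>, \<open>v\<close> can
  be collected.\<close>

definition regular_point :: "'a \<Rightarrow> bool" where
  "regular_point x \<longleftrightarrow> (\<forall>t. 0 < rjac t x \<and> jac t x = ennreal (rjac t x)) \<and>
     (\<forall>u v. rjac (u + v) x = rjac v x * rjac u (\<phi> v x))"

lemma AE_regular_point: "AE x in \<mu>. regular_point x"
proof -
  have "AE x in \<mu>. \<forall>u. \<forall>v. jac (u + v) x = jac v x * jac u (\<phi> v x)"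
    unfolding AE_all_countable using jac_cocycle by blast
  with jac_zero show ?thesis
  proof eventually_elim
    case (elim x)
    have "jac t x \<noteq> 0 \<and> jac t x \<noteq> \<infinity>" for t
    proof -
      \<comment> \<open>The cocycle identity at \<open>- t + t = 0\<close>; a product equal to 1 in
        \<open>ennreal\<close> has no factor 0 or \<infinity>.\<close>
      have "jac t x * jac (- t) (\<phi> t x) = 1"
        using elim(1) elim(2)[rule_format, of "- t" t] by simp
      then show ?thesis
        by (auto simp: ennreal_top_mult split: if_splits)
    qed
    then have "0 < rjac t x \<and> jac t x = ennreal (rjac t x)" for t
      by (auto simp: rjac_def enn2real_positive_iff less_top zero_less_iff_neq_zero)
    then show ?case
      using elim(2) by (simp add: regular_point_def rjac_def enn2real_mult)
  qed
qed

end

subsection \<open>Conservative actions\<close>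

context nonsingular begin

text \<open>For \<open>U = \<bar>f\<bar> powr \<alpha>\<close> this is
  \<open>\<bar>F t\<bar> powr \<alpha>\<close>: the sign of the cocycle disappears and the exponent
  \<open>1 / \<alpha>\<close> of the derivative cancels.\<close>

definition transport :: "('a \<Rightarrow> real) \<Rightarrow> int ^ 'd \<Rightarrow> 'a \<Rightarrow> real" where
  "transport U t x = rjac t x * U (\<phi> t x)"

text \<open>The weak inequality admits ties with later translates, the strict one excludes ties with
  earlier ones: exactly what holds at the first maximiser of a window that contains the cube around
  it.\<close>

definition peak :: "('a \<Rightarrow> real) \<Rightarrow> nat \<Rightarrow> 'a set" where
  "peak U K = {y \<in> space \<mu>. \<forall>s\<in>cube K. transport U s y \<le> U y \<and>
     (lexkey s < 0 \<longrightarrow> transport U s y < U y)}"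

lemma measurable_transport [measurable]:
  assumes [measurable]: "U \<in> borel_measurable \<mu>"
  shows "transport U t \<in> borel_measurable \<mu>"
  unfolding transport_def by measurable

lemma sets_peak [measurable]:
  assumes [measurable]: "U \<in> borel_measurable \<mu>"
  shows "peak U K \<in> sets \<mu>"
  unfolding peak_def by measurable

lemma nn_integral_transport:
  assumes [measurable]: "U \<in> borel_measurable \<mu>"
  shows "(\<integral>\<^sup>+x. ennreal (transport U t x) \<partial>\<mu>) = (\<integral>\<^sup>+x. ennreal (U x) \<partial>\<mu>)"
proof -
  have "(\<integral>\<^sup>+x. ennreal (transport U t x) \<partial>\<mu>) = (\<integral>\<^sup>+x. jac t x * ennreal (U (\<phi> t x)) \<partial>\<mu>)"
    using AE_regular_point
    by (intro nn_integral_cong_AE, eventually_elim)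
      (auto simp: transport_def regular_point_def less_imp_le ennreal_mult')
  also have "\<dots> = (\<integral>\<^sup>+x. ennreal (U x) \<partial>\<mu>)"
    by (rule nn_integral_jac) measurable
  finally show ?thesis .
qed

text \<open>All translates seen from \<open>\<phi> t x\<close> differ from those seen from
  \<open>x\<close> by the one positive factor \<open>rjac t x\<close>, so comparisons between
  positions may be made at either point.\<close>

lemma transport_add:
  assumes "regular_point x" "x \<in> space \<mu>"
  shows "transport U (s + t) x = rjac t x * transport U s (\<phi> t x)"
  using assms by (simp add: transport_def regular_point_def action_add mult.assoc)

text \<open>
  Each point is charged to the first (in the order given by \<^const>\<open>lexkey\<close>) position at which the
  maximum over the window is attained. For a position whose surrounding cube lies in the window, this
  forces \<open>\<phi> t x\<close> to be a peak.
\<close>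

lemma nn_integral_Max_transport_le:
  assumes [measurable]: "U \<in> borel_measurable \<mu>" and U: "\<And>x. 0 \<le> U x" and n: "n \<ge> 1"
  assumes K: "2 * K \<le> n"
  shows "(\<integral>\<^sup>+x. ennreal (Max ((\<lambda>t. transport U t x) ` window n)) \<partial>\<mu>)
    \<le> of_nat (n ^ CARD('d)) * (\<integral>\<^sup>+x. ennreal (U x * indicator (peak U K) x) \<partial>\<mu>)
      + of_nat (n ^ CARD('d) - (n - 2 * K) ^ CARD('d)) * (\<integral>\<^sup>+x. ennreal (U x) \<partial>\<mu>)"
proof -
  define J where "J = (window n :: (int ^ 'd) set)"
  define J0 where "J0 = {t \<in> J. \<forall>s\<in>cube K. s + t \<in> J}"
  define V where "V x = U x * indicator (peak U K) x" for x
  have [measurable]: "V \<in> borel_measurable \<mu>" unfolding V_def by measurable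
  have fin: "finite J" and fin0: "finite J0" and ne: "J \<noteq> {}"
    using finite_window[of n] n window_nonempty by (auto simp: J_def J0_def)
  have V0: "0 \<le> V x" for x using U by (simp add: V_def)
  have tr0: "0 \<le> transport W t x" if "\<And>x. 0 \<le> W x" for W t x
    using that by (simp add: transport_def rjac_def)
  \<comment> \<open>Both sums have nonnegative terms, so it suffices that the term of the charged
    position alone matches the maximum.\<close>
  have ptw: "ennreal (Max ((\<lambda>t. transport U t x) ` J))
      \<le> (\<Sum>t\<in>J0. ennreal (transport V t x)) + (\<Sum>t\<in>J - J0. ennreal (transport U t x))"
    if x: "regular_point x" "x \<in> space \<mu>" for x
  proof -
    let ?m = "Max ((\<lambda>t. transport U t x) ` J)"
    define A where "A = {t \<in> J. transport U t x = ?m}"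
    have "?m \<in> (\<lambda>t. transport U t x) ` J" using fin ne by (intro Max_in) auto
    then have A: "finite A" "A \<noteq> {}" using fin by (auto simp: A_def)
    have "Min (lexkey ` A) \<in> lexkey ` A" using A by (intro Min_in) auto
    then obtain t where t: "t \<in> A" "lexkey t = Min (lexkey ` A)" by auto
    have tmin: "lexkey t \<le> lexkey s" if "s \<in> A" for s
      using A that by (simp add: t(2))
    have le: "transport U s x \<le> ?m" if "s \<in> J" for s
      using fin that by simp
    have tJ: "t \<in> J" and tm: "transport U t x = ?m" using t by (auto simp: A_def)
    show ?thesis
    proof (cases "t \<in> J0")
      case True
      have pos: "0 < rjac t x" using x by (simp add: regular_point_def)
      have "\<phi> t x \<in> peak U K"
        unfolding peak_def
      proof (intro CollectI conjI ballI impI)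
        show "\<phi> t x \<in> space \<mu>" using x by (simp add: action_space)
        fix s :: "int ^ 'd" assume s: "s \<in> cube K"
        then have sJ: "s + t \<in> J" using True by (simp add: J0_def)
        have "rjac t x * transport U s (\<phi> t x) \<le> rjac t x * U (\<phi> t x)"
          using le[OF sJ] x tm by (simp add: transport_add) (simp add: transport_def)
        then show "transport U s (\<phi> t x) \<le> U (\<phi> t x)" using pos by simp
        \<comment> \<open>Translation invariance of the order: a negative \<open>s\<close> moves to
          a position before the charged one, which cannot be a maximiser.\<close>
        assume "lexkey s < 0"
        then have "lexkey (s + t) < lexkey t" by (simp add: lexkey_add)
        then have "s + t \<notin> A" using tmin by (meson not_le)
        then have "transport U (s + t) x < ?m" using le[OF sJ] sJ by (simp add: A_def)
        then have "rjac t x * transport U s (\<phi> t x) < rjac t x * U (\<phi> t x)"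
          using x tm by (simp add: transport_add) (simp add: transport_def)
        then show "transport U s (\<phi> t x) < U (\<phi> t x)" using pos by simp
      qed
      then have "ennreal ?m = ennreal (transport V t x)"
        using tm by (simp add: transport_def V_def)
      also have "\<dots> \<le> (\<Sum>t\<in>J0. ennreal (transport V t x))"
        using True fin0 by (intro member_le_sum) auto
      finally show ?thesis by (rule order_trans) simp
    next
      case False
      have "ennreal ?m = ennreal (transport U t x)" using tm by simp
      also have "\<dots> \<le> (\<Sum>t\<in>J - J0. ennreal (transport U t x))"
        using False tJ fin by (intro member_le_sum) auto
      finally show ?thesis by (rule order_trans) simp
    qed
  qed
  have card0: "card J0 \<le> n ^ CARD('d)"
    using card_mono[of J J0] fin by (auto simp: J0_def J_def card_window)
  have card1: "card (J - J0) \<le> n ^ CARD('d) - (n - 2 * K) ^ CARD('d)"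
  proof -
    have "J - J0 = {t \<in> J. \<not> (\<forall>s\<in>cube K. s + t \<in> J)}" by (auto simp: J0_def)
    then show ?thesis using card_inner_window[OF K, where 'd='d] by (simp add: J_def)
  qed
  have "(\<integral>\<^sup>+x. ennreal (Max ((\<lambda>t. transport U t x) ` J)) \<partial>\<mu>)
      \<le> (\<integral>\<^sup>+x. (\<Sum>t\<in>J0. ennreal (transport V t x)) + (\<Sum>t\<in>J - J0. ennreal (transport U t x)) \<partial>\<mu>)"
    using AE_regular_point AE_space by (intro nn_integral_mono_AE, eventually_elim) (rule ptw)
  also have "\<dots> = (\<Sum>t\<in>J0. \<integral>\<^sup>+x. ennreal (transport V t x) \<partial>\<mu>) + (\<Sum>t\<in>J - J0. \<integral>\<^sup>+x. ennreal (transport U t x) \<partial>\<mu>)"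
    by (simp add: nn_integral_add nn_integral_sum)
  \<comment> \<open>By \<open>nn_integral_transport\<close> the integrals do not depend on the
    position, so only the numbers of positions remain.\<close>
  also have "\<dots> = of_nat (card J0) * (\<integral>\<^sup>+x. ennreal (V x) \<partial>\<mu>) + of_nat (card (J - J0)) * (\<integral>\<^sup>+x. ennreal (U x) \<partial>\<mu>)"
    by (simp add: nn_integral_transport)
  also have "\<dots> \<le> of_nat (n ^ CARD('d)) * (\<integral>\<^sup>+x. ennreal (V x) \<partial>\<mu>)
      + of_nat (n ^ CARD('d) - (n - 2 * K) ^ CARD('d)) * (\<integral>\<^sup>+x. ennreal (U x) \<partial>\<mu>)"
    by (intro add_mono mult_right_mono) (use card0 card1 in \<open>simp_all only: of_nat_le_iff zero_le\<close>)
  finally show ?thesis by (simp add: J_def V_def)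
qed

text \<open>If \<open>x\<close> and \<open>\<phi> t x\<close> both beat all their translates, each
  is, after rescaling, at least as large as the other. For \<open>t \<noteq> 0\<close> one of
  \<open>t\<close> and \<open>- t\<close> precedes 0, so one comparison is strict, a contradiction.
  The orbit of such a point never returns to the set, which is therefore wandering and, by
  conservativity, null.\<close>

lemma AE_not_peak:
  assumes [measurable]: "U \<in> borel_measurable \<mu>" and U: "\<And>x. 0 \<le> U x"
  assumes cons: "conservative \<mu> \<phi>"
  shows "AE x in \<mu>. \<not> (0 < U x \<and> (\<forall>K. x \<in> peak U K))"
proof -
  obtain N where N: "\<And>x. x \<in> space \<mu> - N \<Longrightarrow> regular_point x" "N \<in> null_sets \<mu>"
    using AE_E3[OF AE_regular_point] by blast
  \<comment> \<open>\<open>N\<close> is removed because wandering asks for disjoint images without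
    exceptional points.\<close>
  define E where "E = {x \<in> space \<mu>. 0 < U x \<and> (\<forall>K. x \<in> peak U K)} - N"
  have N_sets [measurable]: "N \<in> sets \<mu>" using N(2) by blast
  have E_sets [measurable]: "E \<in> sets \<mu>" unfolding E_def by measurable
  have hit: "t = 0" if "x \<in> E" "\<phi> t x \<in> E" for t x
  proof (rule ccontr)
    assume "t \<noteq> 0"
    have x: "x \<in> space \<mu>" "regular_point x" and pk: "\<And>K. x \<in> peak U K" "\<And>K. \<phi> t x \<in> peak U K"
      using that N(1) by (auto simp: E_def)
    have pos: "0 < rjac t x" using x by (simp add: regular_point_def)
    obtain K L where K: "t \<in> cube K" and L: "(- t) \<in> cube L" using UN_cube by metis
    have "transport U (- t + t) x = U x"
    proof -
      \<comment> \<open>The cocycle identity at \<open>0 + 0\<close> makes \<open>rjac 0 x\<close>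
        equal to its own square; being positive, it is 1.\<close>
      have "rjac 0 x = rjac 0 x * rjac 0 x"
        using x(2) action_zero[OF x(1)] unfolding regular_point_def by (metis add_0)
      moreover have "0 < rjac 0 x" using x(2) by (simp add: regular_point_def)
      ultimately have "rjac 0 x = 1" by simp
      then show ?thesis using x(1) by (simp add: transport_def action_zero)
    qed
    then have ret: "U x = rjac t x * transport U (- t) (\<phi> t x)"
      using transport_add[OF x(2) x(1), of U "- t" t] by simp
    have tr: "transport U t x = rjac t x * U (\<phi> t x)" by (simp add: transport_def)
    have 1: "transport U t x \<le> U x" "lexkey t < 0 \<Longrightarrow> transport U t x < U x"
      using pk(1)[of K] K by (auto simp: peak_def)
    have 2: "transport U (- t) (\<phi> t x) \<le> U (\<phi> t x)"
        "lexkey (- t) < 0 \<Longrightarrow> transport U (- t) (\<phi> t x) < U (\<phi> t x)"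
      using pk(2)[of L] L by (auto simp: peak_def)
    have "lexkey t \<noteq> lexkey (0 :: int ^ 'd)" using \<open>t \<noteq> 0\<close> by (simp add: lexkey_inj)
    moreover have "lexkey (0 :: int ^ 'd) = 0" "lexkey (- t) = - lexkey t"
      using lexkey_add[of "0 :: int ^ 'd" 0] lexkey_diff[of "0 :: int ^ 'd" t] by simp_all
    ultimately consider "lexkey t < 0" | "lexkey (- t) < 0" by fastforce
    then show False
    proof cases
      case 1
      then have "transport U t x < U x" by fact
      moreover have "U x \<le> transport U t x" using ret tr pos 2(1) by simp
      ultimately show False by simp
    next
      case 2
      then have "transport U (- t) (\<phi> t x) < U (\<phi> t x)" by fact
      then have "U x < transport U t x" using ret tr pos by simp
      then show False using 1(1) by simp
    qed
  qed
  have "wandering \<mu> \<phi> E"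
    unfolding wandering_def disjoint_family_on_def
  proof (intro conjI ballI impI E_sets)
    fix s t :: "int ^ 'd" assume "s \<noteq> t"
    show "\<phi> s ` E \<inter> \<phi> t ` E = {}"
    proof (rule ccontr)
      assume "\<phi> s ` E \<inter> \<phi> t ` E \<noteq> {}"
      then obtain x y where xy: "x \<in> E" "y \<in> E" "\<phi> s x = \<phi> t y" by auto
      then have sp: "x \<in> space \<mu>" "y \<in> space \<mu>" by (auto simp: E_def)
      have "\<phi> (- t + s) x = \<phi> (- t + t) y"
        using xy(3) sp by (simp only: action_add)
      then have "\<phi> (s - t) x = y" using sp by (simp add: action_zero)
      then show False using hit[OF xy(1), of "s - t"] xy(2) \<open>s \<noteq> t\<close> by simp
    qed
  qed
  then have "emeasure \<mu> E = 0"
    using cons by (auto simp: conservative_def zero_less_iff_neq_zero)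
  then have "E \<union> N \<in> null_sets \<mu>" using N(2) by (intro null_sets.Un) auto
  then show ?thesis by (rule AE_I') (auto simp: E_def)
qed

text \<open>Two scales: \<open>K\<close> is fixed to make the peak integral \<open>e K\<close>
  small, and then \<open>n\<close> grows until the boundary positions have a negligible share. The
  peak sets shrink as \<open>K\<close> grows, and almost every point with \<open>0 < U x\<close>
  eventually leaves them, so \<open>e K\<close> tends to 0 by dominated convergence.\<close>

theorem conservative_Max_transport:
  assumes U: "integrable \<mu> U" "\<And>x. 0 \<le> U x" and cons: "conservative \<mu> \<phi>"
  shows "(\<lambda>n. (\<integral>x. Max ((\<lambda>t. transport U t x) ` window n) \<partial>\<mu>) / real n ^ CARD('d)) \<longlonglongrightarrow> 0"
proof -
  have [measurable]: "U \<in> borel_measurable \<mu>" using U(1) by blast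
  define e where "e K = (\<integral>x. U x * indicator (peak U K) x \<partial>\<mu>)" for K
  define I where "I = (\<integral>x. U x \<partial>\<mu>)"
  have iU: "integrable \<mu> (\<lambda>x. U x * indicator (peak U K) x)" for K
    by (rule Bochner_Integration.integrable_bound[OF U(1)])
      (use U(2) in \<open>auto simp: indicator_def\<close>)
  have I0: "0 \<le> I" and e0: "0 \<le> e K" for K
    using U(2) by (auto simp: I_def e_def intro!: integral_nonneg_AE)
  have notpeak: "AE x in \<mu>. \<not> (0 < U x \<and> (\<forall>K. x \<in> peak U K))"
    by (rule AE_not_peak[OF _ U(2) cons]) measurable
  have "e \<longlonglongrightarrow> (\<integral>x. 0 \<partial>\<mu>)"
    unfolding e_def
  proof (rule integral_dominated_convergence[where w = U])
    show "AE x in \<mu>. (\<lambda>K. U x * indicator (peak U K) x) \<longlonglongrightarrow> 0"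
      using notpeak
    proof eventually_elim
      case (elim x)
      show ?case
      proof (cases "U x = 0")
        case False
        then have "0 < U x" using U(2)[of x] by simp
        then obtain K where K: "x \<notin> peak U K" using elim by blast
        have "x \<notin> peak U L" if "K \<le> L" for L
        proof -
          have "(cube K :: (int ^ 'd) set) \<subseteq> cube L" using that by (rule cube_mono)
          then show ?thesis using K by (auto simp: peak_def)
        qed
        then have "eventually (\<lambda>L. U x * indicator (peak U L) x = 0) sequentially"
          unfolding eventually_sequentially by (intro exI[of _ K]) simp
        then show ?thesis by (rule tendsto_eventually)
      qed simp
    qed
  qed (use U in \<open>auto simp: indicator_def\<close>)
  then have e_lim: "e \<longlonglongrightarrow> 0" by simp
  define b where "b n = (\<integral>x. Max ((\<lambda>t. transport U t x) ` window n) \<partial>\<mu>) / real n ^ CARD('d)" for n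
  \<comment> \<open>The factor of \<open>I\<close> is the share of window positions outside the box
    trimmed by \<open>K\<close> layers.\<close>
  have b_le: "b n \<le> e K + (1 - (1 - 2 * real K / real n) ^ CARD('d)) * I"
    if n: "n \<ge> 1" "2 * K \<le> n" for n K
  proof -
    have sub: "(n - 2 * K) ^ CARD('d) \<le> n ^ CARD('d)" by (intro power_mono) auto
    have "(\<integral>\<^sup>+x. ennreal (Max ((\<lambda>t. transport U t x) ` window n)) \<partial>\<mu>)
      \<le> of_nat (n ^ CARD('d)) * ennreal (e K) + of_nat (n ^ CARD('d) - (n - 2 * K) ^ CARD('d)) * ennreal I"
      using nn_integral_Max_transport_le[of U n K, OF _ U(2) n] iU U
      by (simp add: nn_integral_eq_integral e_def I_def)
    also have "\<dots> = ennreal (real (n ^ CARD('d)) * e K + real (n ^ CARD('d) - (n - 2 * K) ^ CARD('d)) * I)"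
      using I0 e0[of K]
      by (simp only: ennreal_of_nat_eq_real_of_nat ennreal_mult''[symmetric] ennreal_plus[symmetric]
          of_nat_0_le_iff mult_nonneg_nonneg)
    finally have le: "(\<integral>\<^sup>+x. ennreal (Max ((\<lambda>t. transport U t x) ` window n)) \<partial>\<mu>)
      \<le> ennreal (real (n ^ CARD('d)) * e K + real (n ^ CARD('d) - (n - 2 * K) ^ CARD('d)) * I)" .
    have "(\<integral>x. Max ((\<lambda>t. transport U t x) ` window n) \<partial>\<mu>)
      \<le> real (n ^ CARD('d)) * e K + real (n ^ CARD('d) - (n - 2 * K) ^ CARD('d)) * I"
      using le I0 e0 by (intro integral_real_bounded) auto
    then have "b n \<le> (real n ^ CARD('d) * e K + (real n ^ CARD('d) - real (n - 2 * K) ^ CARD('d)) * I) / real n ^ CARD('d)"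
      unfolding b_def using sub n by (intro divide_right_mono) (simp_all add: of_nat_diff)
    also have "\<dots> = e K + (1 - (1 - 2 * real K / real n) ^ CARD('d)) * I"
    proof -
      have "1 - 2 * real K / real n = real (n - 2 * K) / real n"
        using n by (simp add: of_nat_diff diff_divide_distrib)
      then have eq: "(1 - 2 * real K / real n) ^ CARD('d) = real (n - 2 * K) ^ CARD('d) / real n ^ CARD('d)"
        by (simp only: power_divide)
      show ?thesis
        unfolding eq using n by (simp add: add_divide_distrib diff_divide_distrib left_diff_distrib)
    qed
    finally show ?thesis .
  qed
  have b_nonneg: "0 \<le> b n" if n: "n \<ge> 1" for n
  proof -
    have "0 \<le> Max ((\<lambda>t. transport U t x) ` window n)" for x
    proof -
      obtain t where "t \<in> (window n :: (int ^ 'd) set)" using window_nonempty[OF n] by blast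
      moreover have "0 \<le> transport U t x" using U(2) by (simp add: transport_def rjac_def)
      ultimately show ?thesis by (meson Max_ge finite_imageI finite_window imageI order_trans)
    qed
    then show ?thesis by (simp add: b_def)
  qed
  have "b \<longlonglongrightarrow> 0"
  proof (rule LIMSEQ_I)
    fix r :: real assume r: "0 < r"
    obtain K where K: "e K < r / 2"
      using order_tendstoD(2)[OF e_lim, of "r / 2"] r by (auto simp: eventually_sequentially)
    have "(\<lambda>n. (1 - (1 - 2 * real K / real n) ^ CARD('d)) * I) \<longlonglongrightarrow> (1 - (1 - 0) ^ CARD('d)) * I"
      by (intro tendsto_intros lim_const_over_n)
    then have "eventually (\<lambda>n. (1 - (1 - 2 * real K / real n) ^ CARD('d)) * I < r / 2) sequentially"
      using r by (intro order_tendstoD(2)) auto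
    then have "eventually (\<lambda>n. norm (b n - 0) < r) sequentially"
      using eventually_ge_at_top[of "max 1 (2 * K)"]
    proof eventually_elim
      case (elim n)
      then show ?case using b_le[of n K] b_nonneg[of n] K by auto
    qed
    then show "\<exists>no. \<forall>n\<ge>no. norm (b n - 0) < r" by (simp add: eventually_sequentially)
  qed
  then show ?thesis by (simp add: b_def[abs_def])
qed

end

subsection \<open>Powers as mixtures of exponentials\<close>

text \<open>Up to a constant, the Levy measure of a positive \<open>p\<close>-stable law when
  \<open>0 < p < 1\<close>. It is homogeneous under dilations, which turns integrals of functions of
  \<open>r * u\<close> into multiples of \<open>u powr p\<close>.\<close>

definition radial :: "real \<Rightarrow> real measure" where
  "radial p = density lborel (\<lambda>r. ennreal (indicator {0<..} r * r powr (- 1 - p)))"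

lemma sets_radial [measurable_cong]: "sets (radial p) = sets borel"
  by (simp add: radial_def)

lemma space_radial [simp]: "space (radial p) = UNIV"
  by (simp add: radial_def)

lemma AE_radial: "AE r in radial p. 0 < r"
  unfolding radial_def by (subst AE_density) (auto split: split_indicator)

lemma sigma_finite_radial: "sigma_finite_measure (radial p)"
  unfolding radial_def by (subst sigma_finite_measure.sigma_finite_iff_density_finite[OF sigma_finite_lborel]) auto

lemma nn_integral_radial:
  assumes [measurable]: "G \<in> borel_measurable borel"
  shows "(\<integral>\<^sup>+r. G r \<partial>radial p) = (\<integral>\<^sup>+r. ennreal (indicator {0<..} r * r powr (- 1 - p)) * G r \<partial>lborel)"
  unfolding radial_def by (subst nn_integral_density) auto

lemma nn_integral_radial_scale:
  assumes [measurable]: "G \<in> borel_measurable borel" and c: "0 < c"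
  shows "(\<integral>\<^sup>+r. G (r * c) \<partial>radial p) = ennreal (c powr p) * (\<integral>\<^sup>+r. G r \<partial>radial p)"
proof -
  let ?k = "\<lambda>r :: real. indicator {0<..} r * r powr (- 1 - p)"
  have k: "?k (c * r) = c powr (- 1 - p) * ?k r" for r
    using c by (auto simp: indicator_def zero_less_mult_iff powr_mult)
  have "(\<integral>\<^sup>+r. G r \<partial>radial p) = ennreal c * (\<integral>\<^sup>+r. ennreal (?k (c * r)) * G (c * r) \<partial>lborel)"
    unfolding nn_integral_radial[OF assms(1)]
    by (subst nn_integral_real_affine[where c = c and t = 0]) (use c in auto)
  also have "\<dots> = ennreal c * (\<integral>\<^sup>+r. ennreal (c powr (- 1 - p)) * (ennreal (?k r) * G (c * r)) \<partial>lborel)"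
    unfolding k by (subst ennreal_mult) (auto simp: mult.assoc)
  also have "\<dots> = ennreal c * (ennreal (c powr (- 1 - p)) * (\<integral>\<^sup>+r. G (r * c) \<partial>radial p))"
    by (subst nn_integral_cmult) (auto simp: nn_integral_radial mult.commute)
  also have "\<dots> = ennreal (c powr (- p)) * (\<integral>\<^sup>+r. G (r * c) \<partial>radial p)"
  proof -
    have "c * c powr (- 1 - p) = c powr (- p)"
      using c powr_add[of c 1 "- 1 - p"] by simp
    then show ?thesis using c by (simp add: mult.assoc[symmetric] ennreal_mult'[symmetric])
  qed
  finally have "ennreal (c powr p) * (\<integral>\<^sup>+r. G r \<partial>radial p)
      = ennreal (c powr p * c powr (- p)) * (\<integral>\<^sup>+r. G (r * c) \<partial>radial p)"
    by (simp add: ennreal_mult mult.assoc)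
  then show ?thesis using c by (simp add: powr_add[symmetric])
qed

text \<open>Near 0 the integrand is at most of order \<open>r powr (- p)\<close>, integrable for
  \<open>p < 1\<close>; near infinity it is at most \<open>r powr (- 1 - p)\<close>, integrable for
  \<open>0 < p\<close>. At \<open>p = \<alpha> / 2\<close> this is the range
  \<open>0 < \<alpha> < 2\<close>.\<close>

lemma nn_integral_radial_min_finite:
  assumes p: "0 < p" "p < 1" and c: "0 \<le> c"
  shows "(\<integral>\<^sup>+r. ennreal (min 1 (c * r)) \<partial>radial p) < \<infinity>"
proof -
  let ?f = "\<lambda>r :: real. (if r \<in> {0..1} then r powr (- p) else 0)"
  let ?g = "\<lambda>r :: real. (if r \<in> {1..} then r powr (- 1 - p) else 0)"
  have f: "(\<integral>\<^sup>+r. ennreal (?f r) \<partial>lborel) = ennreal (1 powr (- p + 1) / (- p + 1))"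
  proof (rule nn_integral_has_integral_lborel)
    show "(?f has_integral (1 powr (- p + 1) / (- p + 1))) UNIV"
      unfolding has_integral_restrict_UNIV using p by (intro has_integral_powr_from_0) auto
  qed auto
  have g: "(\<integral>\<^sup>+r. ennreal (?g r) \<partial>lborel) = ennreal (- (1 powr (- 1 - p + 1)) / (- 1 - p + 1))"
  proof (rule nn_integral_has_integral_lborel)
    show "(?g has_integral (- (1 powr (- 1 - p + 1)) / (- 1 - p + 1))) UNIV"
      unfolding has_integral_restrict_UNIV using p by (intro has_integral_powr_to_inf) auto
  qed auto
  have "(\<integral>\<^sup>+r. ennreal (min 1 (c * r)) \<partial>radial p)
      = (\<integral>\<^sup>+r. ennreal (indicator {0<..} r * r powr (- 1 - p)) * ennreal (min 1 (c * r)) \<partial>lborel)"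
    by (rule nn_integral_radial) measurable
  also have "\<dots> \<le> (\<integral>\<^sup>+r. ennreal c * ennreal (?f r) + ennreal (?g r) \<partial>lborel)"
  proof (intro nn_integral_mono)
    fix r :: real
    have "indicator {0<..} r * r powr (- 1 - p) * min 1 (c * r) \<le> c * ?f r + ?g r"
    proof (cases "0 < r \<and> r \<le> 1")
      case True
      have "r powr (- 1 - p) * min 1 (c * r) \<le> r powr (- 1 - p) * (c * r)"
        by (intro mult_left_mono) auto
      also have "\<dots> = c * r powr (- p)"
        using True powr_add[of r 1 "- 1 - p"] by simp
      finally show ?thesis using True by (auto intro: add_increasing2)
    next
      case False
      have "r powr (- 1 - p) * min 1 (c * r) \<le> r powr (- 1 - p) * 1"
        by (intro mult_left_mono) auto
      then show ?thesis using False c by (auto simp: indicator_def)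
    qed
    then have "ennreal (indicator {0<..} r * r powr (- 1 - p) * min 1 (c * r)) \<le> ennreal (c * ?f r + ?g r)"
      by (rule ennreal_leI)
    then show "ennreal (indicator {0<..} r * r powr (- 1 - p)) * ennreal (min 1 (c * r))
        \<le> ennreal c * ennreal (?f r) + ennreal (?g r)"
      using c by (simp add: ennreal_mult' ennreal_mult'' del: min_def)
  qed
  also have "\<dots> < \<infinity>"
    using f g by (subst nn_integral_add) (auto simp: nn_integral_cmult ennreal_mult_less_top simp del: if_split)
  finally show ?thesis .
qed

lemma nn_integral_radial_exp_scale:
  assumes "0 < p" and u: "0 \<le> u"
  shows "(\<integral>\<^sup>+r. ennreal (1 - exp (- (r * u))) \<partial>radial p)
    = ennreal (u powr p) * (\<integral>\<^sup>+r. ennreal (1 - exp (- r)) \<partial>radial p)"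
proof (cases "u = 0")
  case False
  then show ?thesis
    using nn_integral_radial_scale[of "\<lambda>r. ennreal (1 - exp (- r))" u p] u by simp
qed simp

lemma nn_integral_radial_exp_finite:
  assumes p: "0 < p" "p < 1"
  shows "(\<integral>\<^sup>+r. ennreal (1 - exp (- r)) \<partial>radial p) < \<infinity>"
proof -
  have "(\<integral>\<^sup>+r. ennreal (1 - exp (- r)) \<partial>radial p) \<le> (\<integral>\<^sup>+r. ennreal (min 1 (1 * r)) \<partial>radial p)"
    using exp_ge_add_one_self[of "- r" for r :: real]
    by (intro nn_integral_mono ennreal_leI) (auto simp: min_def algebra_simps intro: add_increasing2)
  also have "\<dots> < \<infinity>" by (rule nn_integral_radial_min_finite[OF p]) simp
  finally show ?thesis .
qed

text \<open>
  The exponent grows like \<open>exp n\<close> because \<open>(1 - exp (- n r)) ^ m\<close> jumps from 0 to 1 near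
  \<open>r = ln m / n\<close>; \<open>ramp n\<close> is thus a polynomial in \<open>exp (- n r)\<close> with its jump near \<open>r = 1\<close>.
\<close>

definition sharp :: "nat \<Rightarrow> nat" where
  "sharp n = nat \<lceil>exp (real n)\<rceil> + 1"

definition ramp :: "nat \<Rightarrow> real \<Rightarrow> real" where
  "ramp n r = (1 - exp (- (real n * r))) ^ sharp n"

lemma measurable_ramp [measurable]: "ramp n \<in> borel_measurable borel"
  unfolding ramp_def by measurable

lemma sharp_bounds: "exp (real n) \<le> real (sharp n) - 1" "real (sharp n) \<le> exp (real n) + 2" "0 < sharp n"
proof -
  have "0 \<le> \<lceil>exp (real n)\<rceil>" by (smt (verit) exp_gt_zero ceiling_less_zero not_less le_of_int_ceiling)
  then have "real (sharp n) = of_int \<lceil>exp (real n)\<rceil> + 1" by (simp add: sharp_def)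
  then show "exp (real n) \<le> real (sharp n) - 1" "real (sharp n) \<le> exp (real n) + 2"
    using le_of_int_ceiling[of "exp (real n)"] of_int_ceiling_le_add_one[of "exp (real n)"] by linarith+
qed (simp add: sharp_def)

lemma ramp_bounds: "0 \<le> r \<Longrightarrow> 0 \<le> ramp n r" "0 \<le> r \<Longrightarrow> ramp n r \<le> 1"
  by (auto simp: ramp_def intro!: power_le_one)

lemma ramp_zero [simp]: "ramp n 0 = 0"
  using sharp_bounds(3)[of n] by (simp add: ramp_def)

lemma ramp_mono: "0 \<le> r \<Longrightarrow> r \<le> s \<Longrightarrow> ramp n r \<le> ramp n s"
  unfolding ramp_def by (intro power_mono) (auto simp: mult_left_mono)

lemma one_minus_power_le: "0 \<le> y \<Longrightarrow> y \<le> 1 \<Longrightarrow> (1 - y :: real) ^ m \<le> exp (- (real m * y))"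
proof -
  assume y: "0 \<le> y" "y \<le> 1"
  have "(1 - y) ^ m \<le> exp (- y) ^ m"
    using y exp_ge_add_one_self[of "- y"] by (intro power_mono) auto
  then show ?thesis by (simp add: exp_of_nat_mult[symmetric])
qed

text \<open>A bound linear in \<open>r\<close> and uniform in \<open>n\<close> is needed for
  domination near 0. For \<open>r < 1 / 2\<close> one factor is at most \<open>n r\<close>, and the
  other \<open>sharp n - 1\<close> factors together are at most \<open>2 / n\<close>, because
  \<open>(sharp n - 1) exp (- n r)\<close> is at least \<open>exp (n / 2)\<close>. The
  \<open>+ 1\<close> in \<open>sharp\<close> pays for the factor split off.\<close>

lemma ramp_le:
  assumes r: "0 < r"
  shows "ramp n r \<le> 2 * r"
proof (cases "n = 0 \<or> 1 / 2 \<le> r")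
  case True
  then show ?thesis
  proof
    assume "n = 0"
    then show ?thesis using r sharp_bounds(3)[of 0] by (simp add: ramp_def zero_power)
  next
    assume "1 / 2 \<le> r"
    then show ?thesis using ramp_bounds(2)[of r n] by simp
  qed
next
  case False
  let ?y = "exp (- (real n * r))"
  have y: "0 \<le> ?y" "?y \<le> 1" using r by auto
  have n: "0 < n" "r < 1 / 2" using False by auto
  have "real n / 2 \<le> exp (real n / 2)" using exp_ge_add_one_self[of "real n / 2"] by linarith
  also have "\<dots> \<le> exp (real n) * ?y"
    using n by (simp add: exp_add[symmetric] field_simps)
  also have "\<dots> \<le> real (sharp n - 1) * ?y"
    using sharp_bounds[of n] by (intro mult_right_mono) (auto simp: of_nat_diff)
  finally have m: "real n / 2 \<le> real (sharp n - 1) * ?y" .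
  then have pos: "0 < real (sharp n - 1) * ?y" using n by linarith
  have "(1 - ?y) ^ (sharp n - 1) \<le> exp (- (real (sharp n - 1) * ?y))"
    by (rule one_minus_power_le[OF y])
  also have "\<dots> \<le> 1 / (real (sharp n - 1) * ?y)"
  proof -
    have "real (sharp n - 1) * ?y \<le> exp (real (sharp n - 1) * ?y)"
      using exp_ge_add_one_self[of "real (sharp n - 1) * ?y"] by linarith
    then show ?thesis
      unfolding exp_minus[of "real (sharp n - 1) * ?y"] inverse_eq_divide
      by (rule frac_le[OF zero_le_one order_refl pos])
  qed
  also have "\<dots> \<le> 1 / (real n / 2)"
    by (rule frac_le[OF zero_le_one order_refl _ m]) (use n in simp)
  finally have 1: "(1 - ?y) ^ (sharp n - 1) \<le> 2 / real n" by simp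
  have 2: "1 - ?y \<le> real n * r"
    using exp_ge_add_one_self[of "- (real n * r)"] by linarith
  have "sharp n = Suc (sharp n - 1)" using sharp_bounds(3)[of n] by simp
  then have "ramp n r = (1 - ?y) * (1 - ?y) ^ (sharp n - 1)"
    unfolding ramp_def by (metis power_Suc)
  also have "\<dots> \<le> (real n * r) * (2 / real n)"
    using 1 2 y r by (intro mult_mono) auto
  finally show ?thesis using n by simp
qed

lemma exp_neg_tendsto:
  assumes "0 < c"
  shows "(\<lambda>n. exp (- (real n * c))) \<longlonglongrightarrow> 0"
proof -
  have "filterlim (\<lambda>n. real n * c) at_top sequentially"
    using assms by (intro filterlim_at_top_mult_tendsto_pos[OF tendsto_const _ filterlim_real_sequentially]) auto
  then have "filterlim (\<lambda>n. - (real n * c)) at_bot sequentially"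
    by (simp add: filterlim_uminus_at_top)
  then show ?thesis by (rule filterlim_compose[OF exp_at_bot])
qed

text \<open>Put \<open>y = exp (- n r)\<close> and \<open>m = sharp n\<close>, so that
  \<open>m y\<close> behaves like \<open>exp (n (1 - r))\<close>. Then \<open>(1 - y) ^ m\<close> is
  at most \<open>exp (- m y)\<close>, which settles \<open>r < 1\<close>, and by Bernoulli at least
  \<open>1 - m y\<close>, which settles \<open>r > 1\<close>.\<close>

lemma ramp_tendsto:
  assumes r: "0 < r" "r \<noteq> 1"
  shows "(\<lambda>n. ramp n r) \<longlonglongrightarrow> indicator {1<..} r"
proof (cases "r < 1")
  case True
  have "ramp n r \<le> exp (- exp (real n * (1 - r)))" for n
  proof -
    have "exp (real n * (1 - r)) = exp (real n) * exp (- (real n * r))"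
      by (simp add: exp_add[symmetric] algebra_simps)
    also have "\<dots> \<le> real (sharp n) * exp (- (real n * r))"
      using sharp_bounds[of n] by (intro mult_right_mono) auto
    finally show ?thesis
      unfolding ramp_def using r
      by (intro order_trans[OF one_minus_power_le]) auto
  qed
  moreover have "(\<lambda>n. exp (- exp (real n * (1 - r)))) \<longlonglongrightarrow> 0"
  proof -
    have "filterlim (\<lambda>n. real n * (1 - r)) at_top sequentially"
      using True by (intro filterlim_at_top_mult_tendsto_pos[OF tendsto_const _ filterlim_real_sequentially]) auto
    then have "filterlim (\<lambda>n. exp (real n * (1 - r))) at_top sequentially"
      by (rule filterlim_compose[OF exp_at_top])
    then have "filterlim (\<lambda>n. - exp (real n * (1 - r))) at_bot sequentially"
      by (simp add: filterlim_uminus_at_top)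
    then show ?thesis by (rule filterlim_compose[OF exp_at_bot])
  qed
  ultimately have "(\<lambda>n. ramp n r) \<longlonglongrightarrow> 0"
    using ramp_bounds(1)[of r] r
    by (intro Lim_null_comparison[of "\<lambda>n. ramp n r"]) auto
  then show ?thesis using True by simp
next
  case False
  have lo: "1 - (exp (real n) + 2) * exp (- (real n * r)) \<le> ramp n r" for n
  proof -
    have "1 - (exp (real n) + 2) * exp (- (real n * r)) \<le> 1 + real (sharp n) * (- exp (- (real n * r)))"
      using sharp_bounds[of n] by simp
    also have "\<dots> \<le> (1 + (- exp (- (real n * r)))) ^ sharp n"
      using r by (intro Bernoulli_inequality) auto
    finally show ?thesis by (simp add: ramp_def)
  qed
  have lim: "(\<lambda>n. 1 - (exp (real n) + 2) * exp (- (real n * r))) \<longlonglongrightarrow> 1"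
  proof -
    have "exp (real n) * exp (- (real n * r)) = exp (- (real n * (r - 1)))" for n
      by (simp add: exp_add[symmetric] algebra_simps)
    then have eq: "1 - (exp (real n) + 2) * exp (- (real n * r))
        = 1 - (exp (- (real n * (r - 1))) + 2 * exp (- (real n * r)))" for n
      by (simp add: ring_distribs)
    have "(\<lambda>n. 1 - (exp (- (real n * (r - 1))) + 2 * exp (- (real n * r)))) \<longlonglongrightarrow> 1 - (0 + 2 * 0)"
      using False r by (intro tendsto_intros exp_neg_tendsto) auto
    then show ?thesis unfolding eq by simp
  qed
  have hi: "ramp n r \<le> 1" for n using ramp_bounds(2)[of r n] r by simp
  have "(\<lambda>n. ramp n r) \<longlonglongrightarrow> 1"
    by (rule tendsto_sandwich[OF always_eventually[OF allI[OF lo]] always_eventually[OF allI[OF hi]]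
          lim tendsto_const])
  then show ?thesis using False r by simp
qed

text \<open>The exact value is \<open>1 / p\<close>. What matters is that it can be cancelled: the
  integral of the maximum will appear multiplied by it.\<close>

lemma emeasure_radial_tail:
  assumes p: "0 < p" "p < 1"
  shows "0 < emeasure (radial p) {1<..}" "emeasure (radial p) {1<..} < \<infinity>"
proof -
  have "emeasure (radial p) {1<..} = (\<integral>\<^sup>+r. indicator {1<..} r \<partial>radial p)" by (simp add: sets_radial)
  also have "\<dots> \<le> (\<integral>\<^sup>+r. ennreal (min 1 (1 * r)) \<partial>radial p)"
    by (intro nn_integral_mono) (auto split: split_indicator)
  also have "\<dots> < \<infinity>" by (rule nn_integral_radial_min_finite[OF p]) simp
  finally show "emeasure (radial p) {1<..} < \<infinity>" .
  show "0 < emeasure (radial p) {1<..}"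
  proof (rule ccontr)
    assume "\<not> ?thesis"
    then have "{1<..} \<in> null_sets (radial p)" by (auto simp: sets_radial intro!: null_setsI)
    then have "AE r in lborel. r \<in> {1<..} \<longrightarrow> indicator {0<..} r * r powr (- 1 - p) = (0 :: real)"
      unfolding radial_def by (subst (asm) null_sets_density_iff) (auto simp: mult_less_0_iff elim!: eventually_mono)
    then have "AE r in lborel. r \<notin> {1<..<2 :: real}" by eventually_elim auto
    then have "{1<..<2 :: real} \<in> null_sets lborel"
      by (subst AE_iff_null_sets) auto
    then have "emeasure lborel {1<..<2 :: real} = 0" by blast
    then show False by simp
  qed
qed

text \<open>The constant \<open>k\<close> is lost in the limit, since truncation at 1 sends
  \<open>k\<close> times the indicator back to the indicator. Bounds that differ by the factor
  \<open>card J\<close> thus share one limit.\<close>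

lemma nn_integral_ramp_tendsto:
  assumes p: "0 < p" "p < 1" and k: "1 \<le> k"
  shows "(\<lambda>n. \<integral>\<^sup>+r. ennreal (min 1 (k * ramp n r)) \<partial>radial p) \<longlonglongrightarrow> emeasure (radial p) {1<..}"
proof -
  have "AE r in radial p. r \<noteq> 1"
    unfolding radial_def by (subst AE_density) (auto intro: AE_mp[OF AE_lborel_singleton[of 1]])
  with AE_radial[of p] have pt: "AE r in radial p. 0 < r \<and> r \<noteq> 1" by eventually_elim simp
  have "(\<lambda>n. \<integral>\<^sup>+r. ennreal (min 1 (k * ramp n r)) \<partial>radial p)
      \<longlonglongrightarrow> (\<integral>\<^sup>+r. ennreal (indicator {1<..} r) \<partial>radial p)"
  proof (rule nn_integral_dominated_convergence[where w = "\<lambda>r. ennreal (min 1 (2 * k * r))"])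
    show "AE r in radial p. ennreal (min 1 (k * ramp n r)) \<le> ennreal (min 1 (2 * k * r))" for n
      using pt
    proof eventually_elim
      case (elim r)
      then have "k * ramp n r \<le> k * (2 * r)" using ramp_le[of r n] k by (intro mult_left_mono) auto
      then show ?case by (intro ennreal_leI min.mono) (simp_all add: mult_ac)
    qed
    show "(\<integral>\<^sup>+r. ennreal (min 1 (2 * k * r)) \<partial>radial p) < \<infinity>"
      using nn_integral_radial_min_finite[OF p, of "2 * k"] k by simp
    show "AE r in radial p. (\<lambda>n. ennreal (min 1 (k * ramp n r))) \<longlonglongrightarrow> ennreal (indicator {1<..} r)"
      using pt
    proof eventually_elim
      case (elim r)
      have "(\<lambda>n. min 1 (k * ramp n r)) \<longlonglongrightarrow> min 1 (k * indicator {1<..} r)"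
        using elim by (intro tendsto_intros ramp_tendsto) auto
      moreover have "min 1 (k * indicator {1<..} r) = indicator {1<..} r"
        using k by (auto simp: indicator_def)
      ultimately show ?case by simp
    qed
  qed measurable
  then show ?thesis by (simp add: sets_radial ennreal_indicator)
qed

section \<open>Exponential polynomials and the integral of a maximum\<close>

inductive exp_poly :: "'t set \<Rightarrow> (('t \<Rightarrow> real) \<Rightarrow> real) \<Rightarrow> bool" for J where
  exp: "(\<And>j. 0 \<le> l j) \<Longrightarrow> exp_poly J (\<lambda>x. exp (- (\<Sum>j\<in>J. l j * x j)))"
| add: "exp_poly J G \<Longrightarrow> exp_poly J H \<Longrightarrow> exp_poly J (\<lambda>x. G x + H x)"
| scale: "exp_poly J G \<Longrightarrow> exp_poly J (\<lambda>x. c * G x)"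

lemma exp_poly_mult_exp:
  assumes "exp_poly J G" "\<And>j. 0 \<le> k j"
  shows "exp_poly J (\<lambda>x. exp (- (\<Sum>j\<in>J. k j * x j)) * G x)"
  using assms(1)
proof induction
  case (exp l)
  have "exp_poly J (\<lambda>x. exp (- (\<Sum>j\<in>J. (k j + l j) * x j)))"
    using assms(2) exp by (intro exp_poly.exp) simp
  then show ?case by (simp add: exp_add[symmetric] ring_distribs sum.distrib)
next
  case (add G H)
  then show ?case using exp_poly.add[OF add.IH] by (simp add: ring_distribs)
next
  case (scale G c)
  then show ?case using exp_poly.scale[OF scale.IH, of c] by (simp add: mult.left_commute)
qed

text \<open>Closure under products is the gain over the powers
  \<open>(\<Sum>j\<in>J. l j * x j) powr p\<close>: it puts a product of ramps, a smooth stand-in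
  for the event that some coordinates exceed 1, into the span of exponentials.\<close>

lemma exp_poly_mult:
  assumes "exp_poly J G" "exp_poly J H"
  shows "exp_poly J (\<lambda>x. G x * H x)"
  using assms(1)
proof induction
  case (exp l)
  then show ?case by (rule exp_poly_mult_exp[OF assms(2)])
next
  case (add G1 G2)
  then show ?case using exp_poly.add[OF add.IH] by (simp add: ring_distribs)
next
  case (scale G c)
  then show ?case using exp_poly.scale[OF scale.IH, of c] by (simp add: mult.assoc)
qed

lemma exp_poly_one: "exp_poly J (\<lambda>x. 1)"
  using exp_poly.exp[of "\<lambda>_. 0" J] by simp

lemma exp_poly_one_minus: "exp_poly J G \<Longrightarrow> exp_poly J (\<lambda>x. 1 - G x)"
  using exp_poly.add[OF exp_poly_one exp_poly.scale[of J G "- 1"]] by simp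

lemma exp_poly_power: "exp_poly J G \<Longrightarrow> exp_poly J (\<lambda>x. G x ^ m)"
  by (induction m) (auto intro: exp_poly_one exp_poly_mult)

lemma exp_poly_prod: "finite I \<Longrightarrow> (\<And>i. i \<in> I \<Longrightarrow> exp_poly J (G i)) \<Longrightarrow> exp_poly J (\<lambda>x. \<Prod>i\<in>I. G i x)"
  by (induction I rule: finite_induct) (auto intro: exp_poly_one exp_poly_mult)

lemma exp_poly_coordinate:
  assumes "finite J" "j \<in> J" "0 \<le> c"
  shows "exp_poly J (\<lambda>x. exp (- (c * x j)))"
proof -
  have "(\<Sum>i\<in>J. (if i = j then c else 0) * x i) = c * x j" for x :: "_ \<Rightarrow> real"
    using assms by (simp add: if_distrib[of "\<lambda>a. a * _"] sum.delta cong: if_cong)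
  moreover have "exp_poly J (\<lambda>x. exp (- (\<Sum>i\<in>J. (if i = j then c else 0) * x i)))"
    using assms(3) by (intro exp_poly.exp) simp
  ultimately show ?thesis by simp
qed

text \<open>\<open>radial p\<close> is a measure on all reals, while the signs of the integrands are
  known only on the half-line that carries it.\<close>

lemma AE_pair_snd_pos: "AE x in M \<Otimes>\<^sub>M radial p. 0 < snd x"
proof -
  interpret R: sigma_finite_measure "radial p" by (rule sigma_finite_radial)
  have "AE x in M \<Otimes>\<^sub>M radial p. x \<in> space M \<times> {0<..}"
  proof (rule AE_I')
    show "space M \<times> {..0} \<in> null_sets (M \<Otimes>\<^sub>M radial p)"
    proof (rule null_setsI)
      have "emeasure (radial p) {..0} = 0"
        using AE_radial[of p] by (subst (asm) AE_iff_measurable[of "{..0}"]) (auto simp: sets_radial)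
      then show "emeasure (M \<Otimes>\<^sub>M radial p) (space M \<times> {..0}) = 0"
        by (subst R.emeasure_pair_measure_Times) (auto simp: sets_radial)
    qed (auto simp: sets_radial)
  qed (auto simp: space_pair_measure)
  then show ?thesis by eventually_elim auto
qed

lemma radial_exp_integral:
  assumes p: "0 < p" "p < 1" and [measurable]: "w \<in> borel_measurable M" and w: "\<And>s. 0 \<le> w s"
    and fin: "(\<integral>\<^sup>+s. ennreal (w s powr p) \<partial>M) < \<infinity>"
  shows "integrable (M \<Otimes>\<^sub>M radial p) (\<lambda>(s, r). 1 - exp (- (r * w s)))"
    and "(\<integral>(s, r). 1 - exp (- (r * w s)) \<partial>(M \<Otimes>\<^sub>M radial p))
      = enn2real ((\<integral>\<^sup>+s. ennreal (w s powr p) \<partial>M) * (\<integral>\<^sup>+r. ennreal (1 - exp (- r)) \<partial>radial p))"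
proof -
  interpret R: sigma_finite_measure "radial p" by (rule sigma_finite_radial)
  let ?g = "\<lambda>(s, r). 1 - exp (- (r * w s))"
  have [measurable]: "?g \<in> borel_measurable (M \<Otimes>\<^sub>M radial p)" by measurable
  have "(\<integral>\<^sup>+x. ennreal (?g x) \<partial>(M \<Otimes>\<^sub>M radial p))
      = (\<integral>\<^sup>+s. \<integral>\<^sup>+r. ennreal (1 - exp (- (r * w s))) \<partial>radial p \<partial>M)"
    by (subst R.nn_integral_fst[symmetric]) simp_all
  also have "\<dots> = (\<integral>\<^sup>+s. ennreal (w s powr p) \<partial>M) * (\<integral>\<^sup>+r. ennreal (1 - exp (- r)) \<partial>radial p)"
    using w by (simp add: nn_integral_radial_exp_scale[OF p(1)] nn_integral_multc)
  finally have eq: "(\<integral>\<^sup>+x. ennreal (?g x) \<partial>(M \<Otimes>\<^sub>M radial p)) = \<dots>" .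
  have ae: "AE x in M \<Otimes>\<^sub>M radial p. 0 \<le> ?g x"
    using AE_pair_snd_pos by eventually_elim (use w in auto)
  show "integrable (M \<Otimes>\<^sub>M radial p) ?g"
    using fin nn_integral_radial_exp_finite[OF p] eq
    by (intro integrableI_nonneg ae) (auto simp: ennreal_mult_less_top)
  show "(\<integral>x. ?g x \<partial>(M \<Otimes>\<^sub>M radial p))
      = enn2real ((\<integral>\<^sup>+s. ennreal (w s powr p) \<partial>M) * (\<integral>\<^sup>+r. ennreal (1 - exp (- r)) \<partial>radial p))"
    using eq by (subst integral_eq_nn_integral[OF _ ae]) auto
qed

text \<open>
  By the identity \<open>u powr p = const * \<integral> (1 - exp (- (r * u))) r powr (- 1 - p) dr\<close>, the integrals
  of the powers \<open>(\<Sum>j\<in>J. l j * u j) powr p\<close> determine those of all exponential polynomials.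
\<close>

lemma exp_poly_integral_determined:
  fixes u :: "'t \<Rightarrow> 'a \<Rightarrow> real" and v :: "'t \<Rightarrow> 'b \<Rightarrow> real"
  assumes p: "0 < p" "p < 1" and J: "finite J"
    and mu [measurable]: "\<And>j. u j \<in> borel_measurable \<mu>" and u: "\<And>j s. 0 \<le> u j s"
    and mv [measurable]: "\<And>j. v j \<in> borel_measurable \<nu>" and v: "\<And>j s. 0 \<le> v j s"
    and eq: "\<And>l. (\<And>j. 0 \<le> l j) \<Longrightarrow>
      (\<integral>\<^sup>+s. ennreal ((\<Sum>j\<in>J. l j * u j s) powr p) \<partial>\<mu>) = (\<integral>\<^sup>+s. ennreal ((\<Sum>j\<in>J. l j * v j s) powr p) \<partial>\<nu>)"
    and fin: "\<And>l. (\<And>j. 0 \<le> l j) \<Longrightarrow> (\<integral>\<^sup>+s. ennreal ((\<Sum>j\<in>J. l j * u j s) powr p) \<partial>\<mu>) < \<infinity>"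
    and G: "exp_poly J G"
  shows "integrable (\<mu> \<Otimes>\<^sub>M radial p) (\<lambda>(s, r). G (\<lambda>_. 0) - G (\<lambda>j. r * u j s)) \<and>
    integrable (\<nu> \<Otimes>\<^sub>M radial p) (\<lambda>(s, r). G (\<lambda>_. 0) - G (\<lambda>j. r * v j s)) \<and>
    (\<integral>(s, r). G (\<lambda>_. 0) - G (\<lambda>j. r * u j s) \<partial>(\<mu> \<Otimes>\<^sub>M radial p)) =
    (\<integral>(s, r). G (\<lambda>_. 0) - G (\<lambda>j. r * v j s) \<partial>(\<nu> \<Otimes>\<^sub>M radial p))"
  using G
proof induction
  \<comment> \<open>\<open>G\<close> itself need not be integrable: a constant already is not, since
    the mixing measure is infinite. The difference from the value at 0 is integrable and linear in
    \<open>G\<close>, so a single exponential is the only analytic case; there the difference is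
    \<open>1 - exp (- (r * (\<Sum>j\<in>J. l j * u j s)))\<close>.\<close>
  case (exp l)
  have shape: "(\<lambda>(s, r). exp (- (\<Sum>j\<in>J. l j * 0)) - exp (- (\<Sum>j\<in>J. l j * (r * w j s))))
    = (\<lambda>(s, r). 1 - exp (- (r * (\<Sum>j\<in>J. l j * w j s))))" for w :: "'t \<Rightarrow> 'c \<Rightarrow> real"
    by (simp add: sum_distrib_left mult.left_commute)
  have "0 \<le> (\<Sum>j\<in>J. l j * u j s)" "0 \<le> (\<Sum>j\<in>J. l j * v j t)" for s t
    using exp u v by (auto intro!: sum_nonneg)
  moreover have "(\<integral>\<^sup>+s. ennreal ((\<Sum>j\<in>J. l j * v j s) powr p) \<partial>\<nu>) < \<infinity>"
    using eq[of l] fin[of l] exp by simp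
  ultimately show ?case
    using radial_exp_integral[OF p, of "\<lambda>s. \<Sum>j\<in>J. l j * u j s" \<mu>]
      radial_exp_integral[OF p, of "\<lambda>s. \<Sum>j\<in>J. l j * v j s" \<nu>] eq[of l] fin[of l] exp
    unfolding shape by simp
next
  case (add G H)
  have *: "(\<lambda>(s, r). G (\<lambda>_. 0) + H (\<lambda>_. 0) - (G (\<lambda>j. r * w j s) + H (\<lambda>j. r * w j s)))
    = (\<lambda>x. (case x of (s, r) \<Rightarrow> G (\<lambda>_. 0) - G (\<lambda>j. r * w j s)) + (case x of (s, r) \<Rightarrow> H (\<lambda>_. 0) - H (\<lambda>j. r * w j s)))"
    for w :: "'t \<Rightarrow> 'c \<Rightarrow> real"
    by (auto simp: fun_eq_iff)
  show ?case
    using add.IH unfolding * by (simp add: Bochner_Integration.integral_add)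
next
  case (scale G c)
  have *: "(\<lambda>(s, r). c * G (\<lambda>_. 0) - c * G (\<lambda>j. r * w j s))
    = (\<lambda>x. c * (case x of (s, r) \<Rightarrow> G (\<lambda>_. 0) - G (\<lambda>j. r * w j s)))"
    for w :: "'t \<Rightarrow> 'c \<Rightarrow> real"
    by (auto simp: fun_eq_iff ring_distribs)
  show ?case
    using scale.IH unfolding * by (simp add: split_beta')
qed

text \<open>One minus the product approximates the indicator of the event that some coordinate
  exceeds 1. The lower bound keeps only the factor of the largest coordinate; the upper one is a
  union bound, by the Weierstrass product inequality, with every coordinate raised to the
  maximum.\<close>

lemma one_minus_prod_ramp_bounds:
  fixes x :: "'t \<Rightarrow> real"
  assumes J: "finite J" "J \<noteq> {}" and x: "\<And>j. 0 \<le> x j"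
  shows "min 1 (1 * ramp n (Max (x ` J))) \<le> 1 - (\<Prod>j\<in>J. 1 - ramp n (x j))"
    and "1 - (\<Prod>j\<in>J. 1 - ramp n (x j)) \<le> min 1 (real (card J) * ramp n (Max (x ` J)))"
proof -
  have r: "0 \<le> ramp n (x j)" "ramp n (x j) \<le> 1" for j using x ramp_bounds by auto
  have "Max (x ` J) \<in> x ` J" using J by (intro Max_in) auto
  then obtain i where i: "i \<in> J" "Max (x ` J) = x i" by auto
  have "(\<Prod>j\<in>J. 1 - ramp n (x j)) = (1 - ramp n (x i)) * (\<Prod>j\<in>J - {i}. 1 - ramp n (x j))"
    using J i by (simp add: prod.remove)
  also have "\<dots> \<le> (1 - ramp n (x i)) * 1"
    using r by (intro mult_left_mono prod_le_1) auto
  finally show "min 1 (1 * ramp n (Max (x ` J))) \<le> 1 - (\<Prod>j\<in>J. 1 - ramp n (x j))"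
    using r i by simp
  have "1 - (\<Sum>j\<in>J. ramp n (x j)) \<le> (\<Prod>j\<in>J. 1 - ramp n (x j))"
    using J r by (intro Weierstrass_prod_ineq) auto
  moreover have "(\<Sum>j\<in>J. ramp n (x j)) \<le> (\<Sum>j\<in>J. ramp n (Max (x ` J)))"
    using J x by (intro sum_mono ramp_mono Max_ge) auto
  moreover have "0 \<le> (\<Prod>j\<in>J. 1 - ramp n (x j))" using r by (intro prod_nonneg) auto
  ultimately show "1 - (\<Prod>j\<in>J. 1 - ramp n (x j)) \<le> min 1 (real (card J) * ramp n (Max (x ` J)))"
    by simp
qed

lemma exp_poly_ramp:
  assumes "finite J"
  shows "exp_poly J (\<lambda>x. \<Prod>j\<in>J. 1 - ramp n (x j))"
  unfolding ramp_def using assms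
  by (intro exp_poly_prod exp_poly_one_minus exp_poly_power exp_poly_coordinate) auto

text \<open>The bounds of \<open>one_minus_prod_ramp_bounds\<close> involve only the maximum
  \<open>V\<close>. Integrating them over \<open>r\<close> first gives \<open>V s powr p\<close>
  times a quantity free of \<open>s\<close>, and by \<open>nn_integral_ramp_tendsto\<close> the
  quantities of both bounds have the same limit.\<close>

lemma prod_ramp_integral_tendsto:
  fixes u :: "'t \<Rightarrow> 'a \<Rightarrow> real"
  assumes p: "0 < p" "p < 1" and J: "finite J" "J \<noteq> {}"
    and mu [measurable]: "\<And>j. u j \<in> borel_measurable \<mu>" and u: "\<And>j s. 0 \<le> u j s"
    and fin: "(\<integral>\<^sup>+s. ennreal (Max ((\<lambda>j. u j s) ` J) powr p) \<partial>\<mu>) < \<infinity>"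
    and int: "\<And>n. integrable (\<mu> \<Otimes>\<^sub>M radial p) (\<lambda>(s, r). 1 - (\<Prod>j\<in>J. 1 - ramp n (r * u j s)))"
  shows "(\<lambda>n. ennreal (\<integral>(s, r). 1 - (\<Prod>j\<in>J. 1 - ramp n (r * u j s)) \<partial>(\<mu> \<Otimes>\<^sub>M radial p)))
    \<longlonglongrightarrow> (\<integral>\<^sup>+s. ennreal (Max ((\<lambda>j. u j s) ` J) powr p) \<partial>\<mu>) * emeasure (radial p) {1<..}"
proof -
  interpret R: sigma_finite_measure "radial p" by (rule sigma_finite_radial)
  define V where "V s = Max ((\<lambda>j. u j s) ` J)" for s
  have [measurable]: "V \<in> borel_measurable \<mu>"
    unfolding V_def using J by (intro borel_measurable_Max) auto
  have V0: "0 \<le> V s" for s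
    using J u unfolding V_def by (meson Max_ge finite_imageI imageI order_trans ex_in_conv)
  define b where "b = (\<integral>\<^sup>+s. ennreal (V s powr p) \<partial>\<mu>)"
  define A where "A k n = (\<integral>\<^sup>+r. ennreal (min 1 (k * ramp n r)) \<partial>radial p)" for k n
  define g where "g n s r = 1 - (\<Prod>j\<in>J. 1 - ramp n (r * u j s))" for n s r
  have scale: "(\<integral>\<^sup>+r. ennreal (min 1 (k * ramp n (r * V s))) \<partial>radial p) = ennreal (V s powr p) * A k n"
    for k n s
  \<comment> \<open>The scaling rule needs a positive factor; at 0 both sides vanish, by
    \<open>ramp n 0 = 0\<close> and \<open>0 powr p = 0\<close>.\<close>
  proof (cases "V s = 0")
    case False
    then show ?thesis
      using nn_integral_radial_scale[of "\<lambda>r. ennreal (min 1 (k * ramp n r))" "V s" p] V0[of s]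
      by (simp add: A_def)
  qed simp
  have bounds: "min 1 (1 * ramp n (r * V s)) \<le> g n s r \<and> g n s r \<le> min 1 (real (card J) * ramp n (r * V s))"
    if "0 < r" for n s r
  proof -
    have "Max ((\<lambda>j. r * u j s) ` J) = r * V s"
      using J that mono_Max_commute[of "\<lambda>x. r * x" "(\<lambda>j. u j s) ` J"]
      by (simp add: V_def image_image mono_def)
    then show ?thesis
      using one_minus_prod_ramp_bounds[OF J, of "\<lambda>j. r * u j s" n] u that by (simp add: g_def)
  qed
  have D: "ennreal (\<integral>(s, r). g n s r \<partial>(\<mu> \<Otimes>\<^sub>M radial p)) = (\<integral>\<^sup>+s. \<integral>\<^sup>+r. ennreal (g n s r) \<partial>radial p \<partial>\<mu>)" for n
  proof -
    have ae: "AE x in \<mu> \<Otimes>\<^sub>M radial p. 0 \<le> (case x of (s, r) \<Rightarrow> g n s r)"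
    proof -
      have "AE x in \<mu> \<Otimes>\<^sub>M radial p. 0 < snd x"
        by (rule AE_pair_snd_pos)
      then show ?thesis
      proof eventually_elim
        case (elim x)
        then show ?case
          using bounds[of "snd x" n "fst x"] ramp_bounds(1)[of "snd x * V (fst x)" n] V0[of "fst x"]
          by (auto simp: split_beta')
      qed
    qed
    have int': "integrable (\<mu> \<Otimes>\<^sub>M radial p) (\<lambda>(s, r). g n s r)" using int[of n] by (simp add: g_def)
    have m: "(\<lambda>(s, r). ennreal (g n s r)) \<in> borel_measurable (\<mu> \<Otimes>\<^sub>M radial p)"
      unfolding g_def by measurable
    have "ennreal (\<integral>(s, r). g n s r \<partial>(\<mu> \<Otimes>\<^sub>M radial p)) = (\<integral>\<^sup>+x. (case x of (s, r) \<Rightarrow> ennreal (g n s r)) \<partial>(\<mu> \<Otimes>\<^sub>M radial p))"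
      using nn_integral_eq_integral[OF int' ae] by (simp add: split_beta')
    then show ?thesis using R.nn_integral_fst[OF m] by simp
  qed
  have lo: "b * A 1 n \<le> ennreal (\<integral>(s, r). g n s r \<partial>(\<mu> \<Otimes>\<^sub>M radial p))" for n
  proof -
    have "b * A 1 n = (\<integral>\<^sup>+s. \<integral>\<^sup>+r. ennreal (min 1 (1 * ramp n (r * V s))) \<partial>radial p \<partial>\<mu>)"
      unfolding b_def scale by (simp add: nn_integral_multc)
    also have "\<dots> \<le> (\<integral>\<^sup>+s. \<integral>\<^sup>+r. ennreal (g n s r) \<partial>radial p \<partial>\<mu>)"
    proof (rule nn_integral_mono, rule nn_integral_mono_AE)
      fix s show "AE r in radial p. ennreal (min 1 (1 * ramp n (r * V s))) \<le> ennreal (g n s r)"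
        using AE_radial[of p] by eventually_elim (use bounds in \<open>blast intro: ennreal_leI\<close>)
    qed
    finally show ?thesis by (simp only: D)
  qed
  have hi: "ennreal (\<integral>(s, r). g n s r \<partial>(\<mu> \<Otimes>\<^sub>M radial p)) \<le> b * A (real (card J)) n" for n
  proof -
    have "(\<integral>\<^sup>+s. \<integral>\<^sup>+r. ennreal (g n s r) \<partial>radial p \<partial>\<mu>)
        \<le> (\<integral>\<^sup>+s. \<integral>\<^sup>+r. ennreal (min 1 (real (card J) * ramp n (r * V s))) \<partial>radial p \<partial>\<mu>)"
    proof (rule nn_integral_mono, rule nn_integral_mono_AE)
      fix s show "AE r in radial p. ennreal (g n s r) \<le> ennreal (min 1 (real (card J) * ramp n (r * V s)))"
        using AE_radial[of p] by eventually_elim (use bounds in \<open>blast intro: ennreal_leI\<close>)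
    qed
    also have "\<dots> = b * A (real (card J)) n"
      unfolding b_def scale by (simp add: nn_integral_multc)
    finally show ?thesis by (simp only: D)
  qed
  have lim: "(\<lambda>n. b * A k n) \<longlonglongrightarrow> b * emeasure (radial p) {1<..}" if "1 \<le> k" for k
    unfolding A_def using fin that
    by (intro ennreal_tendsto_cmult nn_integral_ramp_tendsto[OF p]) (auto simp: b_def V_def)
  have k: "1 \<le> real (card J)" using J by (simp add: Suc_le_eq card_gt_0_iff)
  have "(\<lambda>n. ennreal (\<integral>(s, r). g n s r \<partial>(\<mu> \<Otimes>\<^sub>M radial p))) \<longlonglongrightarrow> b * emeasure (radial p) {1<..}"
    by (rule tendsto_sandwich[OF always_eventually[OF allI[OF lo]] always_eventually[OF allI[OF hi]]
          lim[OF order_refl] lim[OF k]])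
  then show ?thesis by (simp add: g_def b_def V_def)
qed

text \<open>The exponential polynomial is the product of the factors
  \<open>1 - ramp n (x j)\<close>, whose value at 0 is 1. Its determined integrals converge to the
  integral of the maximum times the mass of \<open>{1<..}\<close>, a positive finite factor that
  cancels.\<close>

theorem Max_integral_determined:
  fixes u :: "'t \<Rightarrow> 'a \<Rightarrow> real" and v :: "'t \<Rightarrow> 'b \<Rightarrow> real"
  assumes p: "0 < p" "p < 1" and J: "finite J" "J \<noteq> {}"
    and mu [measurable]: "\<And>j. u j \<in> borel_measurable \<mu>" and u: "\<And>j s. 0 \<le> u j s"
    and mv [measurable]: "\<And>j. v j \<in> borel_measurable \<nu>" and v: "\<And>j s. 0 \<le> v j s"
    and eq: "\<And>l. (\<And>j. 0 \<le> l j) \<Longrightarrow>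
      (\<integral>\<^sup>+s. ennreal ((\<Sum>j\<in>J. l j * u j s) powr p) \<partial>\<mu>) = (\<integral>\<^sup>+s. ennreal ((\<Sum>j\<in>J. l j * v j s) powr p) \<partial>\<nu>)"
    and fin: "\<And>l. (\<And>j. 0 \<le> l j) \<Longrightarrow> (\<integral>\<^sup>+s. ennreal ((\<Sum>j\<in>J. l j * u j s) powr p) \<partial>\<mu>) < \<infinity>"
  shows "(\<integral>\<^sup>+s. ennreal (Max ((\<lambda>j. u j s) ` J) powr p) \<partial>\<mu>)
    = (\<integral>\<^sup>+s. ennreal (Max ((\<lambda>j. v j s) ` J) powr p) \<partial>\<nu>)"
proof -
  let ?e = "emeasure (radial p) {1<..}"
  \<comment> \<open>The maximum is below the sum with unit weights; the factor 1 keeps the form of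
    \<open>fin\<close> at \<open>l = 1\<close>.\<close>
  have fin_Max: "(\<integral>\<^sup>+s. ennreal (Max ((\<lambda>j. w j s) ` J) powr p) \<partial>M) < \<infinity>"
    if "\<And>j s. 0 \<le> w j s" "(\<integral>\<^sup>+s. ennreal ((\<Sum>j\<in>J. 1 * w j s) powr p) \<partial>M) < \<infinity>"
    for M :: "'c measure" and w :: "'t \<Rightarrow> 'c \<Rightarrow> real"
  proof -
    have "0 \<le> Max ((\<lambda>j. w j s) ` J) \<and> Max ((\<lambda>j. w j s) ` J) \<le> (\<Sum>j\<in>J. 1 * w j s)" for s
    proof -
      have "Max ((\<lambda>j. w j s) ` J) \<in> (\<lambda>j. w j s) ` J" using J by (intro Max_in) auto
      then obtain i where "i \<in> J" "Max ((\<lambda>j. w j s) ` J) = w i s" by auto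
      then show ?thesis using that(1) J member_le_sum[of i J "\<lambda>j. w j s"] by simp
    qed
    then have "(\<integral>\<^sup>+s. ennreal (Max ((\<lambda>j. w j s) ` J) powr p) \<partial>M) \<le> (\<integral>\<^sup>+s. ennreal ((\<Sum>j\<in>J. 1 * w j s) powr p) \<partial>M)"
      using p by (intro nn_integral_mono ennreal_leI powr_mono2) auto
    then show ?thesis using that(2) by simp
  qed
  have one: "exp_poly J (\<lambda>x. \<Prod>j\<in>J. 1 - ramp n (x j))" for n by (rule exp_poly_ramp[OF J(1)])
  have det: "integrable (\<mu> \<Otimes>\<^sub>M radial p) (\<lambda>(s, r). 1 - (\<Prod>j\<in>J. 1 - ramp n (r * u j s))) \<and>
    integrable (\<nu> \<Otimes>\<^sub>M radial p) (\<lambda>(s, r). 1 - (\<Prod>j\<in>J. 1 - ramp n (r * v j s))) \<and>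
    (\<integral>(s, r). 1 - (\<Prod>j\<in>J. 1 - ramp n (r * u j s)) \<partial>(\<mu> \<Otimes>\<^sub>M radial p)) =
    (\<integral>(s, r). 1 - (\<Prod>j\<in>J. 1 - ramp n (r * v j s)) \<partial>(\<nu> \<Otimes>\<^sub>M radial p))" for n
    using exp_poly_integral_determined[OF p J(1) mu u mv v eq fin one[of n]] by simp
  have "(\<lambda>n. ennreal (\<integral>(s, r). 1 - (\<Prod>j\<in>J. 1 - ramp n (r * u j s)) \<partial>(\<mu> \<Otimes>\<^sub>M radial p)))
    \<longlonglongrightarrow> (\<integral>\<^sup>+s. ennreal (Max ((\<lambda>j. u j s) ` J) powr p) \<partial>\<mu>) * ?e"
    using det u fin[of "\<lambda>_. 1"] by (intro prod_ramp_integral_tendsto p J mu fin_Max) auto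
  moreover have "(\<lambda>n. ennreal (\<integral>(s, r). 1 - (\<Prod>j\<in>J. 1 - ramp n (r * v j s)) \<partial>(\<nu> \<Otimes>\<^sub>M radial p)))
    \<longlonglongrightarrow> (\<integral>\<^sup>+s. ennreal (Max ((\<lambda>j. v j s) ` J) powr p) \<partial>\<nu>) * ?e"
    using det v eq[of "\<lambda>_. 1"] fin[of "\<lambda>_. 1"] by (intro prod_ramp_integral_tendsto p J mv fin_Max) auto
  ultimately have "(\<integral>\<^sup>+s. ennreal (Max ((\<lambda>j. u j s) ` J) powr p) \<partial>\<mu>) * ?e
    = (\<integral>\<^sup>+s. ennreal (Max ((\<lambda>j. v j s) ` J) powr p) \<partial>\<nu>) * ?e"
    using det by (auto intro: LIMSEQ_unique)
  then show ?thesis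
    using emeasure_radial_tail[OF p] by (auto simp: mult.commute[of _ ?e] ennreal_mult_cancel_left)
qed

subsection \<open>Gaussian averaging\<close>

definition gauss_product :: "'t set \<Rightarrow> ('t \<Rightarrow> real) measure" where
  "gauss_product J = PiM J (\<lambda>_. std_normal_distribution)"

lemma sets_gauss_product [measurable_cong]: "sets (gauss_product J) = sets (PiM J (\<lambda>_. borel))"
  unfolding gauss_product_def by (intro sets_PiM_cong) auto

lemma prob_space_gauss_product: "prob_space (gauss_product J)"
  unfolding gauss_product_def by (intro prob_space_PiM prob_space_normal_density) simp

text \<open>A linear combination of independent standard normals is normal with variance
  \<open>\<Sum>j\<in>J. (x j)\<^sup>2\<close>, so its absolute moment of order \<open>a\<close> is
  that of one standard normal times the \<open>a\<close>-th power of the standard deviation.\<close>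

lemma nn_integral_gauss_product_powr:
  assumes J: "finite J" and a: "0 < a"
  shows "(\<integral>\<^sup>+z. ennreal (\<bar>\<Sum>j\<in>J. x j * z j\<bar> powr a) \<partial>gauss_product J)
    = ennreal ((\<Sum>j\<in>J. (x j)\<^sup>2) powr (a / 2)) * (\<integral>\<^sup>+y. ennreal (\<bar>y\<bar> powr a) \<partial>std_normal_distribution)"
proof -
  interpret G: prob_space "gauss_product J" by (rule prob_space_gauss_product)
  \<comment> \<open>Zero coefficients are dropped because a normal density needs a positive
    deviation; if none is left, both sides are 0.\<close>
  define I where "I = {j \<in> J. x j \<noteq> 0}"
  have sums: "(\<Sum>j\<in>J. x j * z j) = (\<Sum>j\<in>I. x j * z j)" "(\<Sum>j\<in>J. (x j)\<^sup>2) = (\<Sum>j\<in>I. (x j)\<^sup>2)" for z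
    using J by (auto simp: I_def intro!: sum.mono_neutral_right)
  have I: "finite I" "I \<subseteq> J" using J by (auto simp: I_def)
  show ?thesis
  proof (cases "I = {}")
    case True
    then show ?thesis using a by (simp add: sums)
  next
    case False
    define \<sigma> where "\<sigma> = sqrt (\<Sum>j\<in>I. (x j)\<^sup>2)"
    have pos: "0 < (\<Sum>j\<in>I. (x j)\<^sup>2)" using I False by (intro sum_pos) (auto simp: I_def)
    then have \<sigma>: "0 < \<sigma>" by (simp add: \<sigma>_def)
    have comp: "distr (gauss_product J) borel (\<lambda>z. z j) = std_normal_distribution" if "j \<in> J" for j
    proof -
      have "distr (gauss_product J) borel (\<lambda>z. z j) = distr (gauss_product J) std_normal_distribution (\<lambda>z. z j)"
        by (intro distr_cong) auto
      also have "\<dots> = std_normal_distribution"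
        unfolding gauss_product_def using that
        by (intro distr_PiM_component prob_space_normal_density) auto
      finally show ?thesis .
    qed
    have std: "distributed (gauss_product J) lborel (\<lambda>z. z j) std_normal_density" if "j \<in> J" for j
      unfolding distributed_def
    proof (intro conjI)
      have "distr (gauss_product J) lborel (\<lambda>z. z j) = distr (gauss_product J) borel (\<lambda>z. z j)"
        by (intro distr_cong) auto
      then show "distr (gauss_product J) lborel (\<lambda>z. z j) = std_normal_distribution"
        using comp[OF that] by simp
      show "(\<lambda>z. z j) \<in> measurable (gauss_product J) lborel"
        using measurable_component_singleton[OF that, of "\<lambda>_. borel"] by (simp add: measurable_cong_sets[OF sets_gauss_product refl])
    qed auto
    have ind: "G.indep_vars (\<lambda>_. borel) (\<lambda>j z. z j) J"
    proof (subst G.indep_vars_iff_distr_eq_PiM')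
      show "J \<noteq> {}" using False I by auto
      show "distr (gauss_product J) (PiM J (\<lambda>_. borel)) (\<lambda>z. \<lambda>j\<in>J. z j)
        = PiM J (\<lambda>j. distr (gauss_product J) borel (\<lambda>z. z j))"
      proof -
        have "distr (gauss_product J) (PiM J (\<lambda>_. borel)) (\<lambda>z. \<lambda>j\<in>J. z j)
            = distr (gauss_product J) (gauss_product J) (\<lambda>z. z)"
        proof (rule distr_cong)
          show "sets (PiM J (\<lambda>_. borel)) = sets (gauss_product J)" by (rule sets_gauss_product[symmetric])
        qed (auto simp: gauss_product_def space_PiM PiE_restrict)
        also have "\<dots> = gauss_product J" by (simp add: distr_id)
        also have "\<dots> = PiM J (\<lambda>j. distr (gauss_product J) borel (\<lambda>z. z j))"
          unfolding gauss_product_def[of J] by (intro PiM_cong) (simp_all add: comp[unfolded gauss_product_def])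
        finally show ?thesis .
      qed
    qed auto
    then have indI: "G.indep_vars (\<lambda>_. borel) (\<lambda>j z. z j) I"
      using I(2) by (rule G.indep_vars_subset)
    have "G.indep_vars (\<lambda>_. borel) (\<lambda>j z. x j * z j) I"
      using G.indep_vars_compose2[OF indI, of "\<lambda>j y. x j * y" "\<lambda>_. borel"] by simp
    moreover have "distributed (gauss_product J) lborel (\<lambda>z. x j * z j) (normal_density 0 \<bar>x j\<bar>)" if "j \<in> I" for j
      using G.normal_density_affine[OF std[of j], of "x j" 0] that by (auto simp: I_def)
    ultimately have "distributed (gauss_product J) lborel (\<lambda>z. \<Sum>j\<in>I. x j * z j) (normal_density (\<Sum>j\<in>I. 0) (sqrt (\<Sum>j\<in>I. \<bar>x j\<bar>\<^sup>2)))"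
      using I False by (intro G.sum_indep_normal) (auto simp: I_def)
    then have "distributed (gauss_product J) lborel (\<lambda>z. \<Sum>j\<in>I. x j * z j) (normal_density 0 \<sigma>)"
      by (simp add: \<sigma>_def)
    then have D: "distributed (gauss_product J) lborel (\<lambda>z. (\<Sum>j\<in>I. x j * z j) / \<sigma>) std_normal_density"
      using G.normal_standard_normal_convert[OF \<sigma>, of "\<lambda>z. \<Sum>j\<in>I. x j * z j" 0] by simp
    have "(\<integral>\<^sup>+z. ennreal (\<bar>\<Sum>j\<in>I. x j * z j\<bar> powr a) \<partial>gauss_product J)
        = (\<integral>\<^sup>+z. ennreal (\<sigma> powr a) * ennreal (\<bar>(\<Sum>j\<in>I. x j * z j) / \<sigma>\<bar> powr a) \<partial>gauss_product J)"
      using \<sigma> by (intro nn_integral_cong) (simp add: ennreal_mult[symmetric] powr_mult[symmetric])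
    also have "\<dots> = ennreal (\<sigma> powr a) * (\<integral>\<^sup>+z. ennreal (\<bar>(\<Sum>j\<in>I. x j * z j) / \<sigma>\<bar> powr a) \<partial>gauss_product J)"
    proof (rule nn_integral_cmult)
      have "(\<lambda>z. (\<Sum>j\<in>I. x j * z j) / \<sigma>) \<in> borel_measurable (gauss_product J)"
        using distributed_measurable[OF D] by simp
      then show "(\<lambda>z. ennreal (\<bar>(\<Sum>j\<in>I. x j * z j) / \<sigma>\<bar> powr a)) \<in> borel_measurable (gauss_product J)"
        by measurable
    qed
    also have "(\<integral>\<^sup>+z. ennreal (\<bar>(\<Sum>j\<in>I. x j * z j) / \<sigma>\<bar> powr a) \<partial>gauss_product J)
        = (\<integral>\<^sup>+y. ennreal (\<bar>y\<bar> powr a) \<partial>std_normal_distribution)"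
      using distributed_nn_integral[OF D, of "\<lambda>y. ennreal (\<bar>y\<bar> powr a)"]
      by (simp add: nn_integral_density)
    also have "\<sigma> powr a = (\<Sum>j\<in>I. (x j)\<^sup>2) powr (a / 2)"
      using pos by (simp add: \<sigma>_def powr_half_sqrt[symmetric] powr_powr)
    finally show ?thesis by (simp add: sums)
  qed
qed

lemma std_normal_abs_moment:
  assumes a: "0 < a" "a < 2"
  shows "0 < (\<integral>\<^sup>+y. ennreal (\<bar>y\<bar> powr a) \<partial>std_normal_distribution)"
    and "(\<integral>\<^sup>+y. ennreal (\<bar>y\<bar> powr a) \<partial>std_normal_distribution) < \<infinity>"
proof -
  interpret N: prob_space std_normal_distribution by (intro prob_space_normal_density) simp
  have le: "\<bar>y\<bar> powr a \<le> 1 + y\<^sup>2" for y :: real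
  proof (cases "\<bar>y\<bar> \<le> 1")
    case True
    then have "\<bar>y\<bar> powr a \<le> 1" using a by (intro powr_le1) auto
    then show ?thesis by (simp add: add_increasing2)
  next
    case False
    then have "\<bar>y\<bar> powr a \<le> \<bar>y\<bar> powr 2" using a by (intro powr_mono) auto
    then show ?thesis using False by (simp add: powr_numeral)
  qed
  have "(\<integral>\<^sup>+y. ennreal (\<bar>y\<bar> powr a) \<partial>std_normal_distribution) \<le> (\<integral>\<^sup>+y. ennreal (1 + y\<^sup>2) \<partial>std_normal_distribution)"
    by (intro nn_integral_mono ennreal_leI le)
  also have "\<dots> < \<infinity>"
  proof -
    have "integrable std_normal_distribution (\<lambda>y. 1 + y\<^sup>2)"
      using integrable_std_normal_distribution_moment[of 2]
      by (intro Bochner_Integration.integrable_add N.integrable_const) auto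
    then show ?thesis
      by (subst nn_integral_eq_integral) (auto intro!: add_nonneg_nonneg)
  qed
  finally show "(\<integral>\<^sup>+y. ennreal (\<bar>y\<bar> powr a) \<partial>std_normal_distribution) < \<infinity>" .
  show "0 < (\<integral>\<^sup>+y. ennreal (\<bar>y\<bar> powr a) \<partial>std_normal_distribution)"
  proof (rule ccontr)
    assume "\<not> ?thesis"
    then have "AE y in std_normal_distribution. ennreal (\<bar>y\<bar> powr a) = 0"
      by (subst nn_integral_0_iff_AE[symmetric]) auto
    then have "AE y in lborel. y = (0 :: real)"
      by (subst (asm) AE_density) (auto simp: normal_density_pos ennreal_eq_0_iff elim!: eventually_mono)
    then have "AE y in lborel. y \<notin> {1<..<2 :: real}" by eventually_elim auto
    then have "{1<..<2 :: real} \<in> null_sets lborel" by (subst AE_iff_null_sets) auto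
    then have "emeasure lborel {1<..<2 :: real} = 0" by blast
    then show False by simp
  qed
qed

text \<open>Exchanging the integrals leaves, for fixed \<open>s\<close>, a Gaussian combination with
  coefficients \<open>sqrt (l j) * f j s\<close>; the square roots make their squares
  \<open>l j * (f j s)\<^sup>2\<close>.\<close>

lemma gauss_average:
  fixes f :: "'t \<Rightarrow> 'a \<Rightarrow> real"
  assumes "sigma_finite_measure \<mu>" and J: "finite J" and a: "0 < a"
    and mf [measurable]: "\<And>j. f j \<in> borel_measurable \<mu>" and l: "\<And>j. 0 \<le> l j"
  shows "(\<integral>\<^sup>+z. \<integral>\<^sup>+s. ennreal (\<bar>\<Sum>j\<in>J. (sqrt (l j) * z j) * f j s\<bar> powr a) \<partial>\<mu> \<partial>gauss_product J)
    = (\<integral>\<^sup>+s. ennreal ((\<Sum>j\<in>J. l j * (f j s)\<^sup>2) powr (a / 2)) \<partial>\<mu>)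
      * (\<integral>\<^sup>+y. ennreal (\<bar>y\<bar> powr a) \<partial>std_normal_distribution)"
proof -
  interpret G: prob_space "gauss_product J" by (rule prob_space_gauss_product)
  interpret M: sigma_finite_measure \<mu> by fact
  interpret pair_sigma_finite "gauss_product J" \<mu> ..
  have [measurable]: "(\<lambda>x. \<Sum>j\<in>J. (sqrt (l j) * fst x j) * f j (snd x)) \<in> borel_measurable (gauss_product J \<Otimes>\<^sub>M \<mu>)"
    by (intro borel_measurable_sum borel_measurable_times borel_measurable_const)
      (auto intro: measurable_compose[OF measurable_fst measurable_component_singleton]
        measurable_compose[OF measurable_snd])
  have "(\<integral>\<^sup>+z. \<integral>\<^sup>+s. ennreal (\<bar>\<Sum>j\<in>J. (sqrt (l j) * z j) * f j s\<bar> powr a) \<partial>\<mu> \<partial>gauss_product J)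
      = (\<integral>\<^sup>+s. \<integral>\<^sup>+z. ennreal (\<bar>\<Sum>j\<in>J. (sqrt (l j) * z j) * f j s\<bar> powr a) \<partial>gauss_product J \<partial>\<mu>)"
    by (rule Fubini'[symmetric]) (simp add: split_beta')
  also have "\<dots> = (\<integral>\<^sup>+s. \<integral>\<^sup>+z. ennreal (\<bar>\<Sum>j\<in>J. (sqrt (l j) * f j s) * z j\<bar> powr a) \<partial>gauss_product J \<partial>\<mu>)"
    by (simp add: mult_ac)
  also have "\<dots> = (\<integral>\<^sup>+s. ennreal ((\<Sum>j\<in>J. l j * (f j s)\<^sup>2) powr (a / 2)) \<partial>\<mu>)
      * (\<integral>\<^sup>+y. ennreal (\<bar>y\<bar> powr a) \<partial>std_normal_distribution)"
    using l by (simp add: nn_integral_gauss_product_powr[OF J a] power_mult_distrib nn_integral_multc)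
  finally show ?thesis .
qed

subsection \<open>Linearity of the stable integral\<close>

text \<open>Replaces the triangle inequality, which fails for the \<open>\<alpha>\<close>-norm when
  \<open>\<alpha> < 1\<close>; the constant comes from
  \<open>\<bar>x + y\<bar> \<le> 2 * max \<bar>x\<bar> \<bar>y\<bar>\<close>.\<close>

lemma abs_add_powr_le:
  fixes x y a :: real
  assumes "0 < a"
  shows "\<bar>x + y\<bar> powr a \<le> 2 powr a * (\<bar>x\<bar> powr a + \<bar>y\<bar> powr a)"
proof -
  have "\<bar>x + y\<bar> powr a \<le> (2 * max \<bar>x\<bar> \<bar>y\<bar>) powr a"
    using assms by (intro powr_mono2) auto
  also have "\<dots> = 2 powr a * max \<bar>x\<bar> \<bar>y\<bar> powr a" by (simp add: powr_mult)
  also have "\<dots> \<le> 2 powr a * (\<bar>x\<bar> powr a + \<bar>y\<bar> powr a)"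
    by (intro mult_left_mono) (auto simp: max_def)
  finally show ?thesis .
qed

lemma in_L_add:
  assumes "0 < \<alpha>" "in_L \<alpha> \<mu> f" "in_L \<alpha> \<mu> g"
  shows "in_L \<alpha> \<mu> (\<lambda>s. f s + g s)"
proof -
  have [measurable]: "f \<in> borel_measurable \<mu>" "g \<in> borel_measurable \<mu>"
    using assms by (auto simp: in_L_def)
  have "integrable \<mu> (\<lambda>s. \<bar>f s + g s\<bar> powr \<alpha>)"
  proof (rule Bochner_Integration.integrable_bound)
    show "integrable \<mu> (\<lambda>s. 2 powr \<alpha> * (\<bar>f s\<bar> powr \<alpha> + \<bar>g s\<bar> powr \<alpha>))"
      using assms by (auto simp: in_L_def)
    show "AE s in \<mu>. norm (\<bar>f s + g s\<bar> powr \<alpha>) \<le> norm (2 powr \<alpha> * (\<bar>f s\<bar> powr \<alpha> + \<bar>g s\<bar> powr \<alpha>))"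
      using abs_add_powr_le[OF assms(1)] by simp
  qed measurable
  then show ?thesis by (simp add: in_L_def)
qed

lemma in_L_scale: "in_L \<alpha> \<mu> f \<Longrightarrow> in_L \<alpha> \<mu> (\<lambda>s. c * f s)"
  by (auto simp: in_L_def abs_mult powr_mult)

lemma in_L_zero: "in_L \<alpha> \<mu> (\<lambda>s. 0)"
  by (simp add: in_L_def)

lemma in_L_sum:
  assumes "0 < \<alpha>" "finite J" "\<And>t. in_L \<alpha> \<mu> (F t)"
  shows "in_L \<alpha> \<mu> (\<lambda>s. \<Sum>t\<in>J. c t * F t s)"
  using assms(2) by (induction J rule: finite_induct) (auto intro!: in_L_zero in_L_add in_L_scale assms)

locale sas_measure =
  fixes \<alpha> :: real and \<mu> :: "'a measure" and Q :: "'q measure" and M :: "'a set \<Rightarrow> 'q \<Rightarrow> real"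
  assumes alpha_pos: "0 < \<alpha>" and random_measure: "sas_random_measure \<alpha> \<mu> Q M"
begin

sublocale prob_space Q
  using random_measure by (simp add: sas_random_measure_def)

lemma measurable_M: "A \<in> finite_sets \<mu> \<Longrightarrow> M A \<in> borel_measurable Q"
  using random_measure by (simp add: sas_random_measure_def)

lemma M_sums:
  assumes "range A \<subseteq> finite_sets \<mu>" "disjoint_family A" "(\<Union>i. A i) \<in> finite_sets \<mu>"
  shows "AE \<omega> in Q. (\<lambda>i. M (A i) \<omega>) sums M (\<Union>i. A i) \<omega>"
  using random_measure assms unfolding sas_random_measure_def by blast

text \<open>A constant series converges only if its terms vanish. Additivity of \<open>M\<close> is
  postulated for sequences of sets, so finite families have to be padded with the empty set; this
  makes the padding harmless.\<close>

lemma M_empty: "AE \<omega> in Q. M {} \<omega> = 0"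
proof -
  have "AE \<omega> in Q. (\<lambda>i :: nat. M {} \<omega>) sums M (\<Union>i :: nat. {}) \<omega>"
    by (rule M_sums) (auto simp: finite_sets_def disjoint_family_on_def)
  then show ?thesis
    by eventually_elim (auto dest: sums_summable simp: summable_const_iff)
qed

lemma finite_sets_UN: "finite I \<Longrightarrow> (\<And>i. i \<in> I \<Longrightarrow> A i \<in> finite_sets \<mu>) \<Longrightarrow> (\<Union>i\<in>I. A i) \<in> finite_sets \<mu>"
proof (induction I rule: finite_induct)
  case (insert i I)
  then have "A i \<in> finite_sets \<mu>" "(\<Union>i\<in>I. A i) \<in> finite_sets \<mu>" by auto
  then have "emeasure \<mu> (A i \<union> (\<Union>i\<in>I. A i)) < \<infinity>"
    using emeasure_subadditive[of "A i" \<mu> "\<Union>i\<in>I. A i"]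
    by (auto simp: finite_sets_def intro: le_less_trans)
  then show ?case
    using \<open>A i \<in> finite_sets \<mu>\<close> \<open>(\<Union>i\<in>I. A i) \<in> finite_sets \<mu>\<close> by (auto simp: finite_sets_def)
qed (simp add: finite_sets_def)

lemma M_finite_Union:
  assumes I: "finite I" and A: "\<And>i. i \<in> I \<Longrightarrow> A i \<in> finite_sets \<mu>" and disj: "disjoint_family_on A I"
  shows "AE \<omega> in Q. M (\<Union>i\<in>I. A i) \<omega> = (\<Sum>i\<in>I. M (A i) \<omega>)"
proof -
  obtain h where h: "bij_betw h {0..<card I} I" using ex_bij_betw_nat_finite[OF I] by blast
  define B where "B k = (if k < card I then A (h k) else {})" for k
  have hI: "h k \<in> I" if "k < card I" for k using h that by (auto simp: bij_betw_def)
  have hinj: "h k = h l \<Longrightarrow> k = l" if "k < card I" "l < card I" for k l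
    using h that by (auto simp: bij_betw_def inj_on_def)
  have img: "h ` {0..<card I} = I" using h by (auto simp: bij_betw_def)
  have UB: "(\<Union>k. B k) = (\<Union>i\<in>I. A i)"
  proof -
    have "(\<Union>k. B k) = (\<Union>i\<in>h ` {0..<card I}. A i)" by (auto simp: B_def split: if_splits)
    then show ?thesis by (simp only: img)
  qed
  have "AE \<omega> in Q. (\<lambda>k. M (B k) \<omega>) sums M (\<Union>k. B k) \<omega>"
  proof (rule M_sums)
    show "range B \<subseteq> finite_sets \<mu>"
      using A hI by (auto simp: B_def finite_sets_def)
    show "disjoint_family B"
      unfolding disjoint_family_on_def
    proof (intro ballI impI)
      fix k l :: nat assume "k \<noteq> l"
      show "B k \<inter> B l = {}"
      proof (cases "k < card I \<and> l < card I")
        case True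
        then have "h k \<noteq> h l" using hinj \<open>k \<noteq> l\<close> by blast
        then have "A (h k) \<inter> A (h l) = {}"
          using True disj hI by (auto simp: disjoint_family_on_def)
        then show ?thesis by (simp add: B_def)
      qed (auto simp: B_def)
    qed
    show "(\<Union>k. B k) \<in> finite_sets \<mu>" unfolding UB using I A by (rule finite_sets_UN)
  qed
  with M_empty show ?thesis
  proof eventually_elim
    case (elim \<omega>)
    have "(\<lambda>k. M (B k) \<omega>) sums (\<Sum>k\<in>{0..<card I}. M (B k) \<omega>)"
      by (rule sums_finite) (use elim(1) in \<open>auto simp: B_def\<close>)
    then have "M (\<Union>k. B k) \<omega> = (\<Sum>k\<in>{0..<card I}. M (B k) \<omega>)"
      using elim(2) sums_unique2 by blast
    also have "\<dots> = (\<Sum>k\<in>{0..<card I}. M (A (h k)) \<omega>)" by (simp add: B_def)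
    also have "\<dots> = (\<Sum>i\<in>I. M (A i) \<omega>)" by (rule sum.reindex_bij_betw[OF h])
    finally show ?case by (simp add: UB)
  qed
qed

text \<open>\<open>simple_stable_integral\<close> sums over the values of its integrand, so
  different integrands come with different partitions. Writing them all as functions of one map
  \<open>k\<close> lets them be evaluated on the common partition into level sets of
  \<open>k\<close>.\<close>

lemma simple_stable_integral_partition:
  assumes fin: "finite (k ` space \<mu>)" and cells: "\<And>q. k -` {q} \<inter> space \<mu> \<in> sets \<mu>"
    and supp: "\<And>q. c q \<noteq> 0 \<Longrightarrow> emeasure \<mu> (k -` {q} \<inter> space \<mu>) < \<infinity>"
  shows "AE \<omega> in Q. simple_stable_integral \<mu> M (\<lambda>s. c (k s)) \<omega>
    = (\<Sum>q\<in>k ` space \<mu>. c q * M (k -` {q} \<inter> space \<mu>) \<omega>)"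
proof -
  \<comment> \<open>Cells with \<open>c q = 0\<close> may have infinite measure, where nothing is
    known about \<open>M\<close>; they are left out here and return at the end with coefficient
    0.\<close>
  define R where "R = {q \<in> k ` space \<mu>. c q \<noteq> 0}"
  have R: "finite R" using fin by (simp add: R_def)
  have rng: "(\<lambda>s. c (k s)) ` space \<mu> - {0} = c ` R" by (auto simp: R_def)
  have "AE \<omega> in Q. \<forall>y\<in>c ` R. M ((\<lambda>s. c (k s)) -` {y} \<inter> space \<mu>) \<omega>
      = (\<Sum>q\<in>{q \<in> R. c q = y}. M (k -` {q} \<inter> space \<mu>) \<omega>)"
  proof (rule AE_finite_allI)
    fix y assume y: "y \<in> c ` R"
    have "(\<lambda>s. c (k s)) -` {y} \<inter> space \<mu> = (\<Union>q\<in>{q \<in> R. c q = y}. k -` {q} \<inter> space \<mu>)"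
      using y by (auto simp: R_def)
    moreover have "AE \<omega> in Q. M (\<Union>q\<in>{q \<in> R. c q = y}. k -` {q} \<inter> space \<mu>) \<omega>
        = (\<Sum>q\<in>{q \<in> R. c q = y}. M (k -` {q} \<inter> space \<mu>) \<omega>)"
    proof (rule M_finite_Union)
      show "finite {q \<in> R. c q = y}" using R by simp
    qed (use cells supp in \<open>auto simp: finite_sets_def R_def disjoint_family_on_def\<close>)
    ultimately show "AE \<omega> in Q. M ((\<lambda>s. c (k s)) -` {y} \<inter> space \<mu>) \<omega>
      = (\<Sum>q\<in>{q \<in> R. c q = y}. M (k -` {q} \<inter> space \<mu>) \<omega>)" by simp
  qed (use R in simp)
  then show ?thesis
  proof eventually_elim
    case (elim \<omega>)
    have "simple_stable_integral \<mu> M (\<lambda>s. c (k s)) \<omega>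
        = (\<Sum>y\<in>c ` R. y * M ((\<lambda>s. c (k s)) -` {y} \<inter> space \<mu>) \<omega>)"
      unfolding simple_stable_integral_def rng ..
    also have "\<dots> = (\<Sum>y\<in>c ` R. \<Sum>q\<in>{q \<in> R. c q = y}. c q * M (k -` {q} \<inter> space \<mu>) \<omega>)"
      using elim by (intro sum.cong) (auto simp: sum_distrib_left)
    also have "\<dots> = (\<Sum>q\<in>R. c q * M (k -` {q} \<inter> space \<mu>) \<omega>)"
      by (rule sum.image_gen[OF R, symmetric])
    also have "\<dots> = (\<Sum>q\<in>k ` space \<mu>. c q * M (k -` {q} \<inter> space \<mu>) \<omega>)"
      using fin by (intro sum.mono_neutral_left) (auto simp: R_def)
    finally show ?case .
  qed
qed

definition step_function :: "('a \<Rightarrow> real) \<Rightarrow> bool" where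
  "step_function g \<longleftrightarrow> simple_function \<mu> g \<and> emeasure \<mu> {s \<in> space \<mu>. g s \<noteq> 0} < \<infinity>"

lemma step_function_measurable: "step_function g \<Longrightarrow> g \<in> borel_measurable \<mu>"
  by (simp add: step_function_def borel_measurable_simple_function)

lemma step_function_cell:
  assumes "step_function g" "y \<noteq> 0"
  shows "g -` {y} \<inter> space \<mu> \<in> finite_sets \<mu>"
proof -
  have sf: "simple_function \<mu> g" using assms by (simp add: step_function_def)
  have [measurable]: "g \<in> borel_measurable \<mu>" using sf by (rule borel_measurable_simple_function)
  have "emeasure \<mu> (g -` {y} \<inter> space \<mu>) \<le> emeasure \<mu> {s \<in> space \<mu>. g s \<noteq> 0}"
    using assms by (intro emeasure_mono) auto
  then show ?thesis
    using assms simple_functionD(2)[OF sf] by (auto simp: finite_sets_def step_function_def intro: le_less_trans)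
qed

lemma measurable_simple_stable_integral:
  assumes "step_function g"
  shows "simple_stable_integral \<mu> M g \<in> borel_measurable Q"
  unfolding simple_stable_integral_def
  by (intro borel_measurable_sum borel_measurable_times borel_measurable_const measurable_M
      step_function_cell[OF assms]) auto

lemma step_function_add:
  assumes "step_function g" "step_function h"
  shows "step_function (\<lambda>s. g s + h s)"
proof -
  have sf: "simple_function \<mu> g" "simple_function \<mu> h" using assms by (auto simp: step_function_def)
  have [measurable]: "g \<in> borel_measurable \<mu>" "h \<in> borel_measurable \<mu>"
    using sf by (auto intro: borel_measurable_simple_function)
  have "emeasure \<mu> {s \<in> space \<mu>. g s + h s \<noteq> 0}
      \<le> emeasure \<mu> ({s \<in> space \<mu>. g s \<noteq> 0} \<union> {s \<in> space \<mu>. h s \<noteq> 0})"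
    by (intro emeasure_mono) auto
  also have "\<dots> \<le> emeasure \<mu> {s \<in> space \<mu>. g s \<noteq> 0} + emeasure \<mu> {s \<in> space \<mu>. h s \<noteq> 0}"
    by (intro emeasure_subadditive) auto
  also have "\<dots> < \<infinity>" using assms by (auto simp: step_function_def)
  finally show ?thesis using sf by (simp add: step_function_def simple_function_add)
qed

lemma step_function_scale: "step_function g \<Longrightarrow> step_function (\<lambda>s. a * g s)"
  by (cases "a = 0") (auto simp: step_function_def simple_function_mult)

lemma simple_stable_integral_add:
  assumes "step_function g" "step_function h"
  shows "AE \<omega> in Q. simple_stable_integral \<mu> M (\<lambda>s. g s + h s) \<omega>
    = simple_stable_integral \<mu> M g \<omega> + simple_stable_integral \<mu> M h \<omega>"
proof -
  \<comment> \<open>Joint level sets: \<open>g\<close>, \<open>h\<close> and their sum become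
    \<open>fst\<close>, \<open>snd\<close> and the sum of both, applied to \<open>k\<close>. Only
    the cell over \<open>(0, 0)\<close> may have infinite measure, and there all three
    vanish.\<close>
  define k where "k s = (g s, h s)" for s
  have sf: "simple_function \<mu> g" "simple_function \<mu> h" using assms by (auto simp: step_function_def)
  have fin: "finite (k ` space \<mu>)"
    by (rule finite_subset[of _ "g ` space \<mu> \<times> h ` space \<mu>"])
      (use sf in \<open>auto simp: k_def simple_function_def\<close>)
  have cell_eq: "k -` {q} \<inter> space \<mu> = (g -` {fst q} \<inter> space \<mu>) \<inter> (h -` {snd q} \<inter> space \<mu>)" for q
    by (auto simp: k_def)
  have cells: "k -` {q} \<inter> space \<mu> \<in> sets \<mu>" for q
    unfolding cell_eq using sf by (intro sets.Int simple_functionD(2))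
  have supp: "emeasure \<mu> (k -` {q} \<inter> space \<mu>) < \<infinity>" if "fst q \<noteq> 0 \<or> snd q \<noteq> 0" for q
  proof -
    have "\<exists>B\<in>finite_sets \<mu>. k -` {q} \<inter> space \<mu> \<subseteq> B"
      using that step_function_cell[OF assms(1), of "fst q"] step_function_cell[OF assms(2), of "snd q"]
      unfolding cell_eq by blast
    then obtain B where "B \<in> finite_sets \<mu>" "k -` {q} \<inter> space \<mu> \<subseteq> B" by blast
    then show ?thesis
      using emeasure_mono[of "k -` {q} \<inter> space \<mu>" B \<mu>] by (auto simp: finite_sets_def intro: le_less_trans)
  qed
  have "AE \<omega> in Q. simple_stable_integral \<mu> M (\<lambda>s. fst (k s)) \<omega> = (\<Sum>q\<in>k ` space \<mu>. fst q * M (k -` {q} \<inter> space \<mu>) \<omega>)"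
    by (rule simple_stable_integral_partition[OF fin cells]) (rule supp, simp)
  moreover have "AE \<omega> in Q. simple_stable_integral \<mu> M (\<lambda>s. snd (k s)) \<omega> = (\<Sum>q\<in>k ` space \<mu>. snd q * M (k -` {q} \<inter> space \<mu>) \<omega>)"
    by (rule simple_stable_integral_partition[OF fin cells]) (rule supp, simp)
  moreover have "AE \<omega> in Q. simple_stable_integral \<mu> M (\<lambda>s. (\<lambda>q. fst q + snd q) (k s)) \<omega>
      = (\<Sum>q\<in>k ` space \<mu>. (\<lambda>q. fst q + snd q) q * M (k -` {q} \<inter> space \<mu>) \<omega>)"
    by (rule simple_stable_integral_partition[OF fin cells]) (rule supp, auto)
  ultimately show ?thesis
    by eventually_elim (simp add: k_def ring_distribs sum.distrib)
qed

lemma simple_stable_integral_scale: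
  assumes "step_function g"
  shows "AE \<omega> in Q. simple_stable_integral \<mu> M (\<lambda>s. a * g s) \<omega> = a * simple_stable_integral \<mu> M g \<omega>"
proof -
  have sf: "simple_function \<mu> g" using assms by (auto simp: step_function_def)
  have fin: "finite (g ` space \<mu>)" and cells: "g -` {q} \<inter> space \<mu> \<in> sets \<mu>" for q
    using simple_functionD[OF sf] by auto
  have supp: "emeasure \<mu> (g -` {q} \<inter> space \<mu>) < \<infinity>" if "q \<noteq> 0" for q
    using step_function_cell[OF assms that] by (simp add: finite_sets_def)
  have "AE \<omega> in Q. simple_stable_integral \<mu> M (\<lambda>s. a * g s) \<omega> = (\<Sum>q\<in>g ` space \<mu>. (a * q) * M (g -` {q} \<inter> space \<mu>) \<omega>)"
    by (rule simple_stable_integral_partition[OF fin cells]) (rule supp, auto)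
  moreover have "AE \<omega> in Q. simple_stable_integral \<mu> M (\<lambda>s. g s) \<omega> = (\<Sum>q\<in>g ` space \<mu>. q * M (g -` {q} \<inter> space \<mu>) \<omega>)"
    by (rule simple_stable_integral_partition[OF fin cells]) (rule supp, auto)
  ultimately show ?thesis
    by eventually_elim (simp add: sum_distrib_left mult.assoc)
qed

lemma is_stable_integral_iff:
  "is_stable_integral \<alpha> \<mu> Q M f Y \<longleftrightarrow> Y \<in> borel_measurable Q \<and>
    (\<exists>g. (\<forall>k::nat. step_function (g k)) \<and>
      (\<lambda>k. \<integral>\<^sup>+ s. ennreal (\<bar>g k s - f s\<bar> powr \<alpha>) \<partial>\<mu>) \<longlonglongrightarrow> 0 \<and>
      (\<forall>\<epsilon>>0. (\<lambda>k. prob {\<omega> \<in> space Q. \<bar>simple_stable_integral \<mu> M (g k) \<omega> - Y \<omega>\<bar> > \<epsilon>}) \<longlonglongrightarrow> 0))"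
  unfolding is_stable_integral_def step_function_def ..

lemma is_stable_integral_add:
  assumes f: "in_L \<alpha> \<mu> f" "is_stable_integral \<alpha> \<mu> Q M f Y"
    and f': "in_L \<alpha> \<mu> f'" "is_stable_integral \<alpha> \<mu> Q M f' Y'"
  shows "is_stable_integral \<alpha> \<mu> Q M (\<lambda>s. f s + f' s) (\<lambda>\<omega>. Y \<omega> + Y' \<omega>)"
proof -
  have [measurable]: "f \<in> borel_measurable \<mu>" "f' \<in> borel_measurable \<mu>"
    "Y \<in> borel_measurable Q" "Y' \<in> borel_measurable Q"
    using f f' by (auto simp: in_L_def is_stable_integral_def)
  obtain g where g: "\<And>k. step_function (g k)"
      "(\<lambda>k. \<integral>\<^sup>+ s. ennreal (\<bar>g k s - f s\<bar> powr \<alpha>) \<partial>\<mu>) \<longlonglongrightarrow> 0"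
      "\<And>\<epsilon>. \<epsilon> > 0 \<Longrightarrow> (\<lambda>k. prob {\<omega> \<in> space Q. \<bar>simple_stable_integral \<mu> M (g k) \<omega> - Y \<omega>\<bar> > \<epsilon>}) \<longlonglongrightarrow> 0"
    using f(2) unfolding is_stable_integral_iff by blast
  obtain h where h: "\<And>k. step_function (h k)"
      "(\<lambda>k. \<integral>\<^sup>+ s. ennreal (\<bar>h k s - f' s\<bar> powr \<alpha>) \<partial>\<mu>) \<longlonglongrightarrow> 0"
      "\<And>\<epsilon>. \<epsilon> > 0 \<Longrightarrow> (\<lambda>k. prob {\<omega> \<in> space Q. \<bar>simple_stable_integral \<mu> M (h k) \<omega> - Y' \<omega>\<bar> > \<epsilon>}) \<longlonglongrightarrow> 0"
    using f'(2) unfolding is_stable_integral_iff by blast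
  have [measurable]: "g k \<in> borel_measurable \<mu>" "h k \<in> borel_measurable \<mu>"
    "simple_stable_integral \<mu> M (g k) \<in> borel_measurable Q"
    "simple_stable_integral \<mu> M (h k) \<in> borel_measurable Q"
    "simple_stable_integral \<mu> M (\<lambda>s. g k s + h k s) \<in> borel_measurable Q" for k
    by (simp_all add: step_function_measurable measurable_simple_stable_integral step_function_add g(1) h(1))
  have L: "(\<lambda>k. \<integral>\<^sup>+ s. ennreal (\<bar>(g k s + h k s) - (f s + f' s)\<bar> powr \<alpha>) \<partial>\<mu>) \<longlonglongrightarrow> 0"
  proof (rule tendsto_sandwich[OF _ _ tendsto_const])
    show "\<forall>\<^sub>F k in sequentially. (\<integral>\<^sup>+ s. ennreal (\<bar>(g k s + h k s) - (f s + f' s)\<bar> powr \<alpha>) \<partial>\<mu>)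
      \<le> ennreal (2 powr \<alpha>) * ((\<integral>\<^sup>+ s. ennreal (\<bar>g k s - f s\<bar> powr \<alpha>) \<partial>\<mu>) + (\<integral>\<^sup>+ s. ennreal (\<bar>h k s - f' s\<bar> powr \<alpha>) \<partial>\<mu>))"
    proof (intro always_eventually allI)
      fix k
      have "(\<integral>\<^sup>+ s. ennreal (\<bar>(g k s + h k s) - (f s + f' s)\<bar> powr \<alpha>) \<partial>\<mu>)
        \<le> (\<integral>\<^sup>+ s. ennreal (2 powr \<alpha>) * (ennreal (\<bar>g k s - f s\<bar> powr \<alpha>) + ennreal (\<bar>h k s - f' s\<bar> powr \<alpha>)) \<partial>\<mu>)"
      proof (rule nn_integral_mono)
        fix s
        have "\<bar>(g k s + h k s) - (f s + f' s)\<bar> powr \<alpha> \<le> 2 powr \<alpha> * (\<bar>g k s - f s\<bar> powr \<alpha> + \<bar>h k s - f' s\<bar> powr \<alpha>)"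
          using abs_add_powr_le[OF alpha_pos, of "g k s - f s" "h k s - f' s"] by (simp add: algebra_simps)
        then show "ennreal (\<bar>(g k s + h k s) - (f s + f' s)\<bar> powr \<alpha>)
          \<le> ennreal (2 powr \<alpha>) * (ennreal (\<bar>g k s - f s\<bar> powr \<alpha>) + ennreal (\<bar>h k s - f' s\<bar> powr \<alpha>))"
          by (simp only: ennreal_plus[symmetric] ennreal_mult[symmetric] powr_ge_zero add_nonneg_nonneg ennreal_leI)
      qed
      then show "(\<integral>\<^sup>+ s. ennreal (\<bar>(g k s + h k s) - (f s + f' s)\<bar> powr \<alpha>) \<partial>\<mu>)
        \<le> ennreal (2 powr \<alpha>) * ((\<integral>\<^sup>+ s. ennreal (\<bar>g k s - f s\<bar> powr \<alpha>) \<partial>\<mu>) + (\<integral>\<^sup>+ s. ennreal (\<bar>h k s - f' s\<bar> powr \<alpha>) \<partial>\<mu>))"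
        by (simp add: nn_integral_cmult nn_integral_add)
    qed
    have "(\<lambda>k. ennreal (2 powr \<alpha>) * ((\<integral>\<^sup>+ s. ennreal (\<bar>g k s - f s\<bar> powr \<alpha>) \<partial>\<mu>) + (\<integral>\<^sup>+ s. ennreal (\<bar>h k s - f' s\<bar> powr \<alpha>) \<partial>\<mu>)))
        \<longlonglongrightarrow> ennreal (2 powr \<alpha>) * (0 + 0)"
      by (intro ennreal_tendsto_cmult tendsto_add g h) simp
    then show "(\<lambda>k. ennreal (2 powr \<alpha>) * ((\<integral>\<^sup>+ s. ennreal (\<bar>g k s - f s\<bar> powr \<alpha>) \<partial>\<mu>) + (\<integral>\<^sup>+ s. ennreal (\<bar>h k s - f' s\<bar> powr \<alpha>) \<partial>\<mu>)))
        \<longlonglongrightarrow> 0" by simp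
  qed simp
  have P: "(\<lambda>k. prob {\<omega> \<in> space Q. \<bar>simple_stable_integral \<mu> M (\<lambda>s. g k s + h k s) \<omega> - (Y \<omega> + Y' \<omega>)\<bar> > \<epsilon>}) \<longlonglongrightarrow> 0"
    if "0 < \<epsilon>" for \<epsilon>
  proof (rule tendsto_sandwich[OF _ _ tendsto_const])
    let ?A = "\<lambda>k. {\<omega> \<in> space Q. \<bar>simple_stable_integral \<mu> M (g k) \<omega> - Y \<omega>\<bar> > \<epsilon> / 2}"
    let ?B = "\<lambda>k. {\<omega> \<in> space Q. \<bar>simple_stable_integral \<mu> M (h k) \<omega> - Y' \<omega>\<bar> > \<epsilon> / 2}"
    show "\<forall>\<^sub>F k in sequentially. prob {\<omega> \<in> space Q. \<bar>simple_stable_integral \<mu> M (\<lambda>s. g k s + h k s) \<omega> - (Y \<omega> + Y' \<omega>)\<bar> > \<epsilon>}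
      \<le> prob (?A k) + prob (?B k)"
    proof (intro always_eventually allI)
      fix k
      have "prob {\<omega> \<in> space Q. \<bar>simple_stable_integral \<mu> M (\<lambda>s. g k s + h k s) \<omega> - (Y \<omega> + Y' \<omega>)\<bar> > \<epsilon>}
        \<le> prob (?A k \<union> ?B k)"
      proof (rule finite_measure_mono_AE)
        show "AE \<omega> in Q. \<omega> \<in> {\<omega> \<in> space Q. \<bar>simple_stable_integral \<mu> M (\<lambda>s. g k s + h k s) \<omega> - (Y \<omega> + Y' \<omega>)\<bar> > \<epsilon>}
          \<longrightarrow> \<omega> \<in> ?A k \<union> ?B k"
          using simple_stable_integral_add[OF g(1)[of k] h(1)[of k]]
        proof eventually_elim
          case (elim \<omega>)
          have "\<bar>simple_stable_integral \<mu> M (g k) \<omega> - Y \<omega>\<bar> > \<epsilon> / 2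
              \<or> \<bar>simple_stable_integral \<mu> M (h k) \<omega> - Y' \<omega>\<bar> > \<epsilon> / 2"
            if "\<bar>simple_stable_integral \<mu> M (g k) \<omega> + simple_stable_integral \<mu> M (h k) \<omega> - (Y \<omega> + Y' \<omega>)\<bar> > \<epsilon>"
            using that by linarith
          then show ?case using elim by auto
        qed
      qed measurable
      also have "\<dots> \<le> prob (?A k) + prob (?B k)" by (rule measure_Un_le) measurable
      finally show "prob {\<omega> \<in> space Q. \<bar>simple_stable_integral \<mu> M (\<lambda>s. g k s + h k s) \<omega> - (Y \<omega> + Y' \<omega>)\<bar> > \<epsilon>}
        \<le> prob (?A k) + prob (?B k)" .
    qed
    have "(\<lambda>k. prob (?A k) + prob (?B k)) \<longlonglongrightarrow> 0 + 0"
      using that by (intro tendsto_add g h) auto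
    then show "(\<lambda>k. prob (?A k) + prob (?B k)) \<longlonglongrightarrow> 0" by simp
  qed simp
  show ?thesis
    unfolding is_stable_integral_iff
    using L P g(1) h(1) by (intro conjI exI[of _ "\<lambda>k s. g k s + h k s"]) (auto intro: step_function_add)
qed

lemma is_stable_integral_scale:
  assumes f: "in_L \<alpha> \<mu> f" "is_stable_integral \<alpha> \<mu> Q M f Y"
  shows "is_stable_integral \<alpha> \<mu> Q M (\<lambda>s. a * f s) (\<lambda>\<omega>. a * Y \<omega>)"
proof -
  have [measurable]: "f \<in> borel_measurable \<mu>" "Y \<in> borel_measurable Q"
    using f by (auto simp: in_L_def is_stable_integral_def)
  obtain g where g: "\<And>k. step_function (g k)"
      "(\<lambda>k. \<integral>\<^sup>+ s. ennreal (\<bar>g k s - f s\<bar> powr \<alpha>) \<partial>\<mu>) \<longlonglongrightarrow> 0"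
      "\<And>\<epsilon>. \<epsilon> > 0 \<Longrightarrow> (\<lambda>k. prob {\<omega> \<in> space Q. \<bar>simple_stable_integral \<mu> M (g k) \<omega> - Y \<omega>\<bar> > \<epsilon>}) \<longlonglongrightarrow> 0"
    using f(2) unfolding is_stable_integral_iff by blast
  have [measurable]: "g k \<in> borel_measurable \<mu>"
    "simple_stable_integral \<mu> M (g k) \<in> borel_measurable Q"
    "simple_stable_integral \<mu> M (\<lambda>s. a * g k s) \<in> borel_measurable Q" for k
    by (simp_all add: step_function_measurable measurable_simple_stable_integral step_function_scale g(1))
  have "(\<integral>\<^sup>+ s. ennreal (\<bar>a * g k s - a * f s\<bar> powr \<alpha>) \<partial>\<mu>)
      = ennreal (\<bar>a\<bar> powr \<alpha>) * (\<integral>\<^sup>+ s. ennreal (\<bar>g k s - f s\<bar> powr \<alpha>) \<partial>\<mu>)" for k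
    by (subst nn_integral_cmult[symmetric])
      (auto simp: ennreal_mult[symmetric] powr_mult[symmetric] abs_mult[symmetric] right_diff_distrib)
  moreover have "(\<lambda>k. ennreal (\<bar>a\<bar> powr \<alpha>) * (\<integral>\<^sup>+ s. ennreal (\<bar>g k s - f s\<bar> powr \<alpha>) \<partial>\<mu>)) \<longlonglongrightarrow> ennreal (\<bar>a\<bar> powr \<alpha>) * 0"
    by (intro ennreal_tendsto_cmult g) simp
  ultimately have L: "(\<lambda>k. \<integral>\<^sup>+ s. ennreal (\<bar>a * g k s - a * f s\<bar> powr \<alpha>) \<partial>\<mu>) \<longlonglongrightarrow> 0" by simp
  have P: "(\<lambda>k. prob {\<omega> \<in> space Q. \<bar>simple_stable_integral \<mu> M (\<lambda>s. a * g k s) \<omega> - a * Y \<omega>\<bar> > \<epsilon>}) \<longlonglongrightarrow> 0"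
    if "0 < \<epsilon>" for \<epsilon>
  proof (rule tendsto_sandwich[OF _ _ tendsto_const])
    \<comment> \<open>\<open>\<bar>a\<bar> + 1\<close> instead of \<open>\<bar>a\<bar>\<close>, so
      that \<open>a = 0\<close> causes no division by 0.\<close>
    let ?A = "\<lambda>k. {\<omega> \<in> space Q. \<bar>simple_stable_integral \<mu> M (g k) \<omega> - Y \<omega>\<bar> > \<epsilon> / (\<bar>a\<bar> + 1)}"
    show "\<forall>\<^sub>F k in sequentially. prob {\<omega> \<in> space Q. \<bar>simple_stable_integral \<mu> M (\<lambda>s. a * g k s) \<omega> - a * Y \<omega>\<bar> > \<epsilon>}
      \<le> prob (?A k)"
    proof (rule always_eventually, rule allI, rule finite_measure_mono_AE)
      fix k
      show "AE \<omega> in Q. \<omega> \<in> {\<omega> \<in> space Q. \<bar>simple_stable_integral \<mu> M (\<lambda>s. a * g k s) \<omega> - a * Y \<omega>\<bar> > \<epsilon>}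
        \<longrightarrow> \<omega> \<in> ?A k"
        using simple_stable_integral_scale[OF g(1)[of k], of a]
      proof eventually_elim
        case (elim \<omega>)
        let ?d = "\<bar>simple_stable_integral \<mu> M (g k) \<omega> - Y \<omega>\<bar>"
        have "\<bar>a * simple_stable_integral \<mu> M (g k) \<omega> - a * Y \<omega>\<bar> = \<bar>a\<bar> * ?d"
          by (simp add: abs_mult[symmetric] right_diff_distrib)
        also have "\<dots> \<le> (\<bar>a\<bar> + 1) * ?d" by (intro mult_right_mono) auto
        finally show ?case using elim by (auto simp: divide_less_eq mult.commute)
      qed
    qed measurable
    show "(\<lambda>k. prob (?A k)) \<longlonglongrightarrow> 0" using that by (intro g) (auto intro!: divide_pos_pos)
  qed simp
  show ?thesis
    unfolding is_stable_integral_iff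
    using L P g(1) by (intro conjI exI[of _ "\<lambda>k s. a * g k s"]) (auto intro: step_function_scale)
qed

lemma is_stable_integral_zero: "is_stable_integral \<alpha> \<mu> Q M (\<lambda>s. 0) (\<lambda>\<omega>. 0)"
proof -
  have "simple_stable_integral \<mu> M (\<lambda>s. 0) \<omega> = 0" for \<omega>
    unfolding simple_stable_integral_def by (rule sum.neutral) auto
  then show ?thesis
    unfolding is_stable_integral_iff
    by (intro conjI exI[of _ "\<lambda>k s. 0"]) (auto simp: step_function_def)
qed

lemma is_stable_integral_sum:
  assumes "finite J" "\<And>t. in_L \<alpha> \<mu> (F t)" "\<And>t. is_stable_integral \<alpha> \<mu> Q M (F t) (Y t)"
  shows "is_stable_integral \<alpha> \<mu> Q M (\<lambda>s. \<Sum>t\<in>J. c t * F t s) (\<lambda>\<omega>. \<Sum>t\<in>J. c t * Y t \<omega>)"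
  using assms(1)
  by (induction J rule: finite_induct)
    (auto intro!: is_stable_integral_zero is_stable_integral_add is_stable_integral_scale in_L_scale
      in_L_sum alpha_pos assms)

lemma char_stable_integral:
  assumes "in_L \<alpha> \<mu> f" "is_stable_integral \<alpha> \<mu> Q M f Y"
  shows "char (distr Q borel Y) \<theta> = complex_of_real (exp (- (\<bar>\<theta>\<bar> powr \<alpha> * (\<integral>s. \<bar>f s\<bar> powr \<alpha> \<partial>\<mu>))))"
  using random_measure assms unfolding sas_random_measure_def by blast

end

section \<open>Scales of linear combinations are determined by the law\<close>

lemma same_fdd_sum:
  fixes X :: "'t \<Rightarrow> 'p \<Rightarrow> real" and Y :: "'t \<Rightarrow> 'q \<Rightarrow> real"
  assumes fdd: "same_fdd P X Q Y" and J: "finite J"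
    and [measurable]: "\<And>t. X t \<in> borel_measurable P" "\<And>t. Y t \<in> borel_measurable Q"
  shows "distr P borel (\<lambda>\<omega>. \<Sum>t\<in>J. c t * X t \<omega>) = distr Q borel (\<lambda>\<omega>. \<Sum>t\<in>J. c t * Y t \<omega>)"
proof -
  have [measurable]: "(\<lambda>x. \<Sum>t\<in>J. c t * x t) \<in> borel_measurable (PiM J (\<lambda>_. borel))"
    by (intro borel_measurable_sum borel_measurable_times borel_measurable_const measurable_component_singleton)
  have push: "distr R borel (\<lambda>\<omega>. \<Sum>t\<in>J. c t * Z t \<omega>)
    = distr (distr R (PiM J (\<lambda>_. borel)) (\<lambda>\<omega>. \<lambda>t\<in>J. Z t \<omega>)) borel (\<lambda>x. \<Sum>t\<in>J. c t * x t)"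
    if [measurable]: "\<And>t. Z t \<in> borel_measurable R" for R :: "'r measure" and Z :: "'t \<Rightarrow> 'r \<Rightarrow> real"
    by (subst distr_distr) (auto simp: o_def intro!: measurable_restrict)
  show ?thesis
    using fdd J by (simp add: push same_fdd_def)
qed

text \<open>Equality of finite-dimensional distributions moves the combination to the stable
  integrals, linearity turns it into the integral of one kernel, and the characteristic function of
  a stable integral is part of the definition of the random measure.\<close>

lemma char_integral_representation:
  assumes alpha: "0 < \<alpha>" and rep: "integral_representation \<alpha> P X \<mu> Q M F" and J: "finite J"
    and X: "\<And>t. X t \<in> borel_measurable P"
  shows "char (distr P borel (\<lambda>\<omega>. \<Sum>t\<in>J. c t * X t \<omega>)) \<theta>
    = complex_of_real (exp (- (\<bar>\<theta>\<bar> powr \<alpha> * (\<integral>s. \<bar>\<Sum>t\<in>J. c t * F t s\<bar> powr \<alpha> \<partial>\<mu>))))"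
proof -
  interpret sas_measure \<alpha> \<mu> Q M
    using alpha rep by unfold_locales (auto simp: integral_representation_def)
  obtain Y where Y: "\<And>t. is_stable_integral \<alpha> \<mu> Q M (F t) (Y t)" "same_fdd P X Q Y"
    using rep by (auto simp: integral_representation_def)
  have F: "in_L \<alpha> \<mu> (F t)" for t using rep by (auto simp: integral_representation_def)
  have "distr P borel (\<lambda>\<omega>. \<Sum>t\<in>J. c t * X t \<omega>) = distr Q borel (\<lambda>\<omega>. \<Sum>t\<in>J. c t * Y t \<omega>)"
    using Y X J by (intro same_fdd_sum) (auto simp: is_stable_integral_def)
  then show ?thesis
    using char_stable_integral[OF in_L_sum[OF alpha J F] is_stable_integral_sum[OF J F Y(1)]] by simp
qed

lemma nn_integral_representation_eq:
  assumes alpha: "0 < \<alpha>" and X: "\<And>t. X t \<in> borel_measurable P" and J: "finite J"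
    and rep: "integral_representation \<alpha> P X \<mu> Q M F" and rep': "integral_representation \<alpha> P X \<nu> Q' M' H"
  shows "(\<integral>\<^sup>+s. ennreal (\<bar>\<Sum>t\<in>J. c t * F t s\<bar> powr \<alpha>) \<partial>\<mu>) = (\<integral>\<^sup>+s. ennreal (\<bar>\<Sum>t\<in>J. c t * H t s\<bar> powr \<alpha>) \<partial>\<nu>)"
proof -
  have "in_L \<alpha> \<mu> (\<lambda>s. \<Sum>t\<in>J. c t * F t s)" "in_L \<alpha> \<nu> (\<lambda>s. \<Sum>t\<in>J. c t * H t s)"
    using rep rep' by (auto intro!: in_L_sum alpha J simp: integral_representation_def)
  \<comment> \<open>At \<open>\<theta> = 1\<close> the characteristic function is \<open>exp\<close>
    of minus the integral, and \<open>exp\<close> is injective.\<close>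
  moreover have "(\<integral>s. \<bar>\<Sum>t\<in>J. c t * F t s\<bar> powr \<alpha> \<partial>\<mu>) = (\<integral>s. \<bar>\<Sum>t\<in>J. c t * H t s\<bar> powr \<alpha> \<partial>\<nu>)"
    using char_integral_representation[OF alpha rep J X, of c 1]
      char_integral_representation[OF alpha rep' J X, of c 1] by (simp del: of_real_exp)
  ultimately show ?thesis
    by (simp add: in_L_def nn_integral_eq_integral)
qed

subsection \<open>Representations with the same law\<close>

lemma square_powr_half: "((x :: real)\<^sup>2) powr (a / 2) = \<bar>x\<bar> powr a"
proof -
  have "(x\<^sup>2) powr (a / 2) = ((x\<^sup>2) powr (1 / 2)) powr a" by (simp only: powr_powr times_divide_eq_left mult_1_left)
  also have "\<dots> = \<bar>x\<bar> powr a" by (simp only: powr_half_sqrt zero_le_power2 real_sqrt_abs)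
  finally show ?thesis .
qed

lemma Max_square_powr:
  fixes f :: "'t \<Rightarrow> real"
  assumes J: "finite J" "J \<noteq> {}" and a: "0 < a"
  shows "Max ((\<lambda>j. (f j)\<^sup>2) ` J) powr (a / 2) = Max ((\<lambda>j. \<bar>f j\<bar> powr a) ` J)"
proof -
  have "Max ((\<lambda>j. (f j)\<^sup>2) ` J) \<in> (\<lambda>j. (f j)\<^sup>2) ` J" using J by (intro Max_in) auto
  then obtain i where i: "i \<in> J" "Max ((\<lambda>j. (f j)\<^sup>2) ` J) = (f i)\<^sup>2" by auto
  have "\<bar>f j\<bar> powr a \<le> \<bar>f i\<bar> powr a" if "j \<in> J" for j
  proof -
    have "(f j)\<^sup>2 \<le> (f i)\<^sup>2" using J that by (simp add: i(2)[symmetric])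
    then show ?thesis using a by (intro powr_mono2) (auto simp: abs_le_square_iff)
  qed
  then have "Max ((\<lambda>j. \<bar>f j\<bar> powr a) ` J) = \<bar>f i\<bar> powr a"
    using J i by (intro Max_eqI) auto
  then show ?thesis by (simp add: i(2) square_powr_half)
qed

text \<open>\<open>Max_integral_determined\<close> is applied with \<open>p = \<alpha> / 2\<close>
  to the squares of the kernels. Equality for weighted sums of squares comes from Gaussian
  averaging: each fixed value of the Gaussian coefficients is an instance of
  \<open>nn_integral_representation_eq\<close>.\<close>

theorem nn_integral_Max_representation_eq:
  fixes X :: "'t \<Rightarrow> 'p \<Rightarrow> real" and F :: "'t \<Rightarrow> 'a \<Rightarrow> real" and H :: "'t \<Rightarrow> 'b \<Rightarrow> real"
  assumes alpha: "0 < \<alpha>" "\<alpha> < 2" and X: "\<And>t. X t \<in> borel_measurable P" and J: "finite J" "J \<noteq> {}"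
    and sf: "sigma_finite_measure \<mu>" "sigma_finite_measure \<nu>"
    and rep: "integral_representation \<alpha> P X \<mu> Q M F" and rep': "integral_representation \<alpha> P X \<nu> Q' M' H"
  shows "(\<integral>\<^sup>+s. ennreal (Max ((\<lambda>t. \<bar>F t s\<bar> powr \<alpha>) ` J)) \<partial>\<mu>)
    = (\<integral>\<^sup>+s. ennreal (Max ((\<lambda>t. \<bar>H t s\<bar> powr \<alpha>) ` J)) \<partial>\<nu>)"
proof -
  let ?C = "\<integral>\<^sup>+y. ennreal (\<bar>y\<bar> powr \<alpha>) \<partial>std_normal_distribution"
  have F: "in_L \<alpha> \<mu> (F t)" and H: "in_L \<alpha> \<nu> (H t)" for t
    using rep rep' by (auto simp: integral_representation_def)
  have [measurable]: "F t \<in> borel_measurable \<mu>" "H t \<in> borel_measurable \<nu>" for t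
    using F H by (auto simp: in_L_def)
  have "(\<integral>\<^sup>+s. ennreal (Max ((\<lambda>t. (F t s)\<^sup>2) ` J) powr (\<alpha> / 2)) \<partial>\<mu>)
    = (\<integral>\<^sup>+s. ennreal (Max ((\<lambda>t. (H t s)\<^sup>2) ` J) powr (\<alpha> / 2)) \<partial>\<nu>)"
  proof (rule Max_integral_determined)
    fix l :: "'t \<Rightarrow> real" assume l: "\<And>t. 0 \<le> l t"
    have "(\<integral>\<^sup>+s. ennreal ((\<Sum>t\<in>J. l t * (F t s)\<^sup>2) powr (\<alpha> / 2)) \<partial>\<mu>) * ?C
        = (\<integral>\<^sup>+z. \<integral>\<^sup>+s. ennreal (\<bar>\<Sum>t\<in>J. (sqrt (l t) * z t) * F t s\<bar> powr \<alpha>) \<partial>\<mu> \<partial>gauss_product J)"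
      by (rule gauss_average[symmetric]) (use sf J alpha l in auto)
    also have "\<dots> = (\<integral>\<^sup>+z. \<integral>\<^sup>+s. ennreal (\<bar>\<Sum>t\<in>J. (sqrt (l t) * z t) * H t s\<bar> powr \<alpha>) \<partial>\<nu> \<partial>gauss_product J)"
      by (intro nn_integral_cong nn_integral_representation_eq[OF alpha(1) X J(1) rep rep'])
    also have "\<dots> = (\<integral>\<^sup>+s. ennreal ((\<Sum>t\<in>J. l t * (H t s)\<^sup>2) powr (\<alpha> / 2)) \<partial>\<nu>) * ?C"
      by (rule gauss_average) (use sf J alpha l in auto)
    finally show "(\<integral>\<^sup>+s. ennreal ((\<Sum>t\<in>J. l t * (F t s)\<^sup>2) powr (\<alpha> / 2)) \<partial>\<mu>)
        = (\<integral>\<^sup>+s. ennreal ((\<Sum>t\<in>J. l t * (H t s)\<^sup>2) powr (\<alpha> / 2)) \<partial>\<nu>)"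
      using std_normal_abs_moment[OF alpha] by (auto simp: mult.commute[of _ ?C] ennreal_mult_cancel_left)
    \<comment> \<open>Finiteness: the Euclidean norm of the numbers
      \<open>sqrt (l t) * F t s\<close> is at most the sum of their absolute values, and the
      \<open>\<alpha>\<close>-th power of that sum is integrable.\<close>
    have "(\<Sum>t\<in>J. l t * (F t s)\<^sup>2) powr (\<alpha> / 2) \<le> \<bar>\<Sum>t\<in>J. sqrt (l t) * \<bar>F t s\<bar>\<bar> powr \<alpha>" for s
    proof -
      have "L2_set (\<lambda>t. sqrt (l t) * \<bar>F t s\<bar>) J \<le> (\<Sum>t\<in>J. sqrt (l t) * \<bar>F t s\<bar>)"
        using l by (intro L2_set_le_sum) auto
      then have "sqrt (\<Sum>t\<in>J. l t * (F t s)\<^sup>2) \<le> \<bar>\<Sum>t\<in>J. sqrt (l t) * \<bar>F t s\<bar>\<bar>"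
        using l by (simp add: L2_set_def power_mult_distrib)
      then have "sqrt (\<Sum>t\<in>J. l t * (F t s)\<^sup>2) powr \<alpha> \<le> \<bar>\<Sum>t\<in>J. sqrt (l t) * \<bar>F t s\<bar>\<bar> powr \<alpha>"
        using alpha l by (intro powr_mono2) (auto intro!: sum_nonneg)
      moreover have "0 \<le> (\<Sum>t\<in>J. l t * (F t s)\<^sup>2)" using l by (intro sum_nonneg) auto
      ultimately show ?thesis by (simp add: powr_half_sqrt[symmetric] powr_powr)
    qed
    then have "(\<integral>\<^sup>+s. ennreal ((\<Sum>t\<in>J. l t * (F t s)\<^sup>2) powr (\<alpha> / 2)) \<partial>\<mu>)
        \<le> (\<integral>\<^sup>+s. ennreal (\<bar>\<Sum>t\<in>J. sqrt (l t) * \<bar>F t s\<bar>\<bar> powr \<alpha>) \<partial>\<mu>)"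
      by (intro nn_integral_mono ennreal_leI)
    also have "\<dots> < \<infinity>"
    proof -
      have "in_L \<alpha> \<mu> (\<lambda>s. \<bar>F t s\<bar>)" for t using F[of t] by (simp add: in_L_def)
      then have "in_L \<alpha> \<mu> (\<lambda>s. \<Sum>t\<in>J. sqrt (l t) * \<bar>F t s\<bar>)"
        using alpha J by (intro in_L_sum)
      then show ?thesis by (simp add: in_L_def nn_integral_eq_integral)
    qed
    finally show "(\<integral>\<^sup>+s. ennreal ((\<Sum>t\<in>J. l t * (F t s)\<^sup>2) powr (\<alpha> / 2)) \<partial>\<mu>) < \<infinity>" .
  qed (use alpha J in auto)
  then show ?thesis by (simp only: Max_square_powr[OF J alpha(1)])
qed

subsection \<open>Moving averages\<close>

lemma nn_integral_shift_count:
  fixes a :: "int ^ 'd \<Rightarrow> ennreal"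
  shows "(\<integral>\<^sup>+s. a (t + s) \<partial>count_space UNIV) = (\<integral>\<^sup>+s. a s \<partial>count_space UNIV)"
proof -
  have "bij (\<lambda>s :: int ^ 'd. t + s)"
    by (rule bij_betw_byWitness[where f' = "\<lambda>s. s - t"]) auto
  then show ?thesis by (rule nn_integral_bij_count_space)
qed

definition window_max :: "(int ^ 'd \<Rightarrow> real) \<Rightarrow> nat \<Rightarrow> int ^ 'd \<Rightarrow> real" where
  "window_max a n s = Max ((\<lambda>t. a (t + s)) ` window n)"

lemma window_max_le_sum:
  assumes "n \<ge> 1" "\<And>s. 0 \<le> a s"
  shows "ennreal (window_max a n s) \<le> (\<Sum>t\<in>window n. ennreal (a (t + s)))"
proof -
  have "window_max a n s \<in> (\<lambda>t. a (t + s)) ` window n"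
    unfolding window_max_def using assms(1) by (intro Max_in) (auto simp: finite_window window_nonempty)
  then obtain t where t: "t \<in> window n" "window_max a n s = a (t + s)" by auto
  have "ennreal (a (t + s)) \<le> (\<Sum>t\<in>window n. ennreal (a (t + s)))"
    using t by (intro member_le_sum) (auto simp: finite_window)
  then show ?thesis by (simp add: t)
qed

text \<open>After division by \<open>n ^ CARD('d)\<close> the bound no longer depends on
  \<open>n\<close>; it supplies the dominating function when the fibres are integrated.\<close>

lemma nn_integral_window_max_le:
  fixes a :: "int ^ 'd \<Rightarrow> real"
  assumes "n \<ge> 1" "\<And>s. 0 \<le> a s"
  shows "(\<integral>\<^sup>+s. ennreal (window_max a n s) \<partial>count_space UNIV)
    \<le> of_nat (n ^ CARD('d)) * (\<integral>\<^sup>+s. ennreal (a s) \<partial>count_space UNIV)"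
proof -
  have "(\<integral>\<^sup>+s. ennreal (window_max a n s) \<partial>count_space UNIV)
      \<le> (\<integral>\<^sup>+s. (\<Sum>t\<in>window n. ennreal (a (t + s))) \<partial>count_space UNIV)"
    by (intro nn_integral_mono window_max_le_sum assms)
  also have "\<dots> = (\<Sum>t\<in>(window n :: (int ^ 'd) set). \<integral>\<^sup>+s. ennreal (a (t + s)) \<partial>count_space UNIV)"
    by (rule nn_integral_sum) simp
  also have "\<dots> = of_nat (n ^ CARD('d)) * (\<integral>\<^sup>+s. ennreal (a s) \<partial>count_space UNIV)"
    by (simp add: nn_integral_shift_count[of "\<lambda>s. ennreal (a s)"] card_window)
  finally show ?thesis .
qed

text \<open>The value at \<open>s\<^sub>0\<close> is seen from the \<open>n ^ CARD('d)\<close>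
  shifts \<open>s = s\<^sub>0 - t\<close> with \<open>t\<close> in the window, and for each of them
  the maximum is at least that value.\<close>

lemma nn_integral_window_max_ge:
  fixes a :: "int ^ 'd \<Rightarrow> real"
  shows "of_nat (n ^ CARD('d)) * ennreal (a s\<^sub>0) \<le> (\<integral>\<^sup>+s. ennreal (window_max a n s) \<partial>count_space UNIV)"
proof -
  let ?D = "(\<lambda>t. s\<^sub>0 - t) ` window n"
  have D: "finite ?D" "card ?D = n ^ CARD('d)"
    by (simp_all add: finite_window card_image inj_on_def card_window)
  have "of_nat (n ^ CARD('d)) * ennreal (a s\<^sub>0) = (\<integral>\<^sup>+s. ennreal (a s\<^sub>0) * indicator ?D s \<partial>count_space UNIV)"
    by (subst nn_integral_cmult_indicator) (use D in \<open>auto simp: emeasure_count_space mult.commute\<close>)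
  also have "\<dots> \<le> (\<integral>\<^sup>+s. ennreal (window_max a n s) \<partial>count_space UNIV)"
  proof (rule nn_integral_mono)
    fix s
    show "ennreal (a s\<^sub>0) * indicator ?D s \<le> ennreal (window_max a n s)"
    proof (cases "s \<in> ?D")
      case True
      then obtain t where t: "t \<in> window n" "s\<^sub>0 = t + s" by auto
      then have "a s\<^sub>0 \<le> window_max a n s"
        unfolding window_max_def by (intro Max_ge) (auto simp: finite_window)
      then show ?thesis using True by (simp add: ennreal_leI)
    qed simp
  qed
  finally show ?thesis .
qed

text \<open>These are the shifts from which the window meets the cube: each coordinate lies between
  \<open>1 - K - n\<close> and \<open>K\<close>, which leaves \<open>n + 2 * K\<close>
  values.\<close>

lemma card_window_cube:
  "finite {s :: int ^ 'd. \<exists>t\<in>window n. t + s \<in> cube K}"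
  "card {s :: int ^ 'd. \<exists>t\<in>window n. t + s \<in> cube K} \<le> (n + 2 * K) ^ CARD('d)"
proof -
  let ?B = "{s :: int ^ 'd. (\<chi> i. - int K - int n + 1) \<le> s \<and> s \<le> (\<chi> i. int K)}"
  have "s \<in> ?B" if "t \<in> window n" "t + s \<in> cube K" for s t :: "int ^ 'd"
  proof -
    have "- int K - int n + 1 \<le> s $ i \<and> s $ i \<le> int K" for i
    proof -
      have "0 \<le> t $ i" "t $ i < int n" "\<bar>t $ i + s $ i\<bar> \<le> int K"
        using that by (simp_all add: window_iff cube_iff)
      then show ?thesis by linarith
    qed
    then show ?thesis by (simp add: less_eq_vec_def)
  qed
  then have sub: "{s :: int ^ 'd. \<exists>t\<in>window n. t + s \<in> cube K} \<subseteq> ?B" by blast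
  then show "finite {s :: int ^ 'd. \<exists>t\<in>window n. t + s \<in> cube K}"
    by (rule finite_subset) (rule finite_box)
  have "nat (int K - (- int K - int n + 1) + 1) = n + 2 * K" by linarith
  then have "card ?B = (n + 2 * K) ^ CARD('d)" by (simp add: card_box)
  then show "card {s :: int ^ 'd. \<exists>t\<in>window n. t + s \<in> cube K} \<le> (n + 2 * K) ^ CARD('d)"
    using card_mono[OF finite_box sub] by simp
qed

text \<open>The maximum is attained inside the cube or outside. Inside, it is at most
  \<open>G\<close>, and this can happen for at most \<open>(n + 2 * K) ^ CARD('d)\<close> shifts;
  outside, it is dominated by the sum over the window of the values off the cube.\<close>

lemma nn_integral_window_max_le_split:
  fixes a :: "int ^ 'd \<Rightarrow> real"
  assumes n: "n \<ge> 1" and a: "\<And>s. 0 \<le> a s" "\<And>s. a s \<le> G"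
  shows "(\<integral>\<^sup>+s. ennreal (window_max a n s) \<partial>count_space UNIV)
    \<le> of_nat ((n + 2 * K) ^ CARD('d)) * ennreal G
      + of_nat (n ^ CARD('d)) * (\<integral>\<^sup>+s. ennreal (a s * indicator (- cube K) s) \<partial>count_space UNIV)"
proof -
  let ?D = "{s :: int ^ 'd. \<exists>t\<in>window n. t + s \<in> cube K}"
  let ?b = "\<lambda>s. a s * indicator (- cube K) s"
  have finD: "finite ?D" and cardD: "card ?D \<le> (n + 2 * K) ^ CARD('d)"
    by (rule card_window_cube)+
  have "ennreal (window_max a n s) \<le> ennreal G * indicator ?D s + (\<Sum>t\<in>window n. ennreal (?b (t + s)))" for s
  proof -
    have "window_max a n s \<in> (\<lambda>t. a (t + s)) ` window n"
      unfolding window_max_def using n by (intro Max_in) (auto simp: finite_window window_nonempty)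
    then obtain t where t: "t \<in> window n" "window_max a n s = a (t + s)" by auto
    show ?thesis
    proof (cases "t + s \<in> cube K")
      case True
      then have "s \<in> ?D" using t by blast
      then show ?thesis using t a(2) by (auto intro!: add_increasing2 ennreal_leI)
    next
      case False
      then have "ennreal (window_max a n s) = ennreal (?b (t + s))" using t by simp
      also have "\<dots> \<le> (\<Sum>t\<in>window n. ennreal (?b (t + s)))"
        using t by (intro member_le_sum) (auto simp: finite_window)
      finally show ?thesis by (rule order_trans) simp
    qed
  qed
  then have "(\<integral>\<^sup>+s. ennreal (window_max a n s) \<partial>count_space UNIV)
      \<le> (\<integral>\<^sup>+s. ennreal G * indicator ?D s + (\<Sum>t\<in>window n. ennreal (?b (t + s))) \<partial>count_space UNIV)"
    by (intro nn_integral_mono)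
  also have "\<dots> = ennreal G * of_nat (card ?D)
      + (\<Sum>t\<in>(window n :: (int ^ 'd) set). \<integral>\<^sup>+s. ennreal (?b (t + s)) \<partial>count_space UNIV)"
    using finD
    by (simp add: nn_integral_add nn_integral_sum nn_integral_cmult emeasure_count_space)
  also have "\<dots> = ennreal G * of_nat (card ?D)
      + of_nat (n ^ CARD('d)) * (\<integral>\<^sup>+s. ennreal (?b s) \<partial>count_space UNIV)"
    by (simp only: nn_integral_shift_count[of "\<lambda>s. ennreal (?b s)"] sum_constant card_window)
  also have "\<dots> \<le> of_nat ((n + 2 * K) ^ CARD('d)) * ennreal G
      + of_nat (n ^ CARD('d)) * (\<integral>\<^sup>+s. ennreal (?b s) \<partial>count_space UNIV)"
    unfolding mult.commute[of "ennreal G"]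
    by (intro add_mono mult_right_mono order_refl) (use cardD in \<open>simp_all only: of_nat_le_iff zero_le\<close>)
  finally show ?thesis .
qed

lemma bdd_above_summable:
  fixes a :: "int ^ 'd \<Rightarrow> real"
  assumes a: "\<And>s. 0 \<le> a s" and fin: "(\<integral>\<^sup>+s. ennreal (a s) \<partial>count_space UNIV) < \<infinity>"
  shows "bdd_above (range a)" "ennreal (SUP s. a s) \<le> (\<integral>\<^sup>+s. ennreal (a s) \<partial>count_space UNIV)"
proof -
  define S where "S = enn2real (\<integral>\<^sup>+s. ennreal (a s) \<partial>count_space UNIV)"
  have S: "(\<integral>\<^sup>+s. ennreal (a s) \<partial>count_space UNIV) = ennreal S" "0 \<le> S"
    using fin by (auto simp: S_def)
  have "ennreal (a s) \<le> ennreal S" for s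
    unfolding S(1)[symmetric] by (rule nn_integral_ge_point) simp
  then have le: "a s \<le> S" for s using S(2) by simp
  then show "bdd_above (range a)" by (auto intro!: bdd_aboveI[of _ S])
  have "(SUP s. a s) \<le> S" using le by (intro cSUP_least) auto
  then show "ennreal (SUP s. a s) \<le> (\<integral>\<^sup>+s. ennreal (a s) \<partial>count_space UNIV)"
    unfolding S(1) by (rule ennreal_leI)
qed

text \<open>The supremum is a lower bound at every \<open>n \<ge> 1\<close>. For the upper bound
  \<open>K\<close> is chosen to make the sum off the cube small, and then \<open>n\<close> tends to
  infinity, so that the ratio of \<open>(n + 2 * K) ^ CARD('d)\<close> to
  \<open>n ^ CARD('d)\<close> tends to 1.\<close>

theorem window_max_average_tendsto:
  fixes a :: "int ^ 'd \<Rightarrow> real"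
  assumes a: "\<And>s. 0 \<le> a s" and fin: "(\<integral>\<^sup>+s. ennreal (a s) \<partial>count_space UNIV) < \<infinity>"
  shows "(\<lambda>n. ennreal (1 / real n ^ CARD('d)) * (\<integral>\<^sup>+s. ennreal (window_max a n s) \<partial>count_space UNIV))
    \<longlonglongrightarrow> ennreal (SUP s. a s)"
proof -
  define G where "G = (SUP s. a s)"
  define I where "I n = (\<integral>\<^sup>+s. ennreal (window_max a n s) \<partial>count_space UNIV)" for n
  define T where "T K = (\<integral>\<^sup>+s. ennreal (a s * indicator (- cube K) s) \<partial>count_space UNIV)" for K
  define r where "r n = enn2real (I n) / real n ^ CARD('d)" for n
  have aG: "a s \<le> G" for s
    unfolding G_def by (rule cSUP_upper[OF UNIV_I bdd_above_summable(1)[OF a fin]])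
  have G0: "0 \<le> G" using a aG order_trans by blast
  have Ifin: "I n < \<infinity>" if "n \<ge> 1" for n
  proof -
    have "I n \<le> of_nat (n ^ CARD('d)) * (\<integral>\<^sup>+s. ennreal (a s) \<partial>count_space UNIV)"
      unfolding I_def by (rule nn_integral_window_max_le[OF that a])
    also have "\<dots> < \<infinity>"
      using fin unfolding infinity_ennreal_def by (intro ennreal_mult_less_top[THEN iffD2] disjI2 conjI of_nat_less_top)
    finally show ?thesis .
  qed
  have T_le: "T K \<le> (\<integral>\<^sup>+s. ennreal (a s) \<partial>count_space UNIV)" for K
    unfolding T_def using a by (intro nn_integral_mono ennreal_leI) (auto simp: indicator_def)
  have Tfin: "T K < \<infinity>" for K using T_le[of K] fin by (rule le_less_trans)
  have "T \<longlonglongrightarrow> (\<integral>\<^sup>+s. 0 \<partial>(count_space UNIV :: (int ^ 'd) measure))"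
    unfolding T_def
  proof (rule nn_integral_dominated_convergence[where w = "\<lambda>s. ennreal (a s)"])
    show "AE s in count_space UNIV. (\<lambda>K. ennreal (a s * indicator (- cube K) s)) \<longlonglongrightarrow> 0"
    proof (rule AE_I2)
      fix s :: "int ^ 'd"
      obtain K where K: "s \<in> cube K" using UN_cube by blast
      have "\<forall>\<^sub>F L in sequentially. ennreal (a s * indicator (- cube L) s) = 0"
        unfolding eventually_sequentially
      proof (intro exI[of _ K] allI impI)
        fix L assume "K \<le> L"
        then have "s \<in> cube L" using K cube_mono by blast
        then show "ennreal (a s * indicator (- cube L) s) = 0" by simp
      qed
      then show "(\<lambda>K. ennreal (a s * indicator (- cube K) s)) \<longlonglongrightarrow> 0" by (rule tendsto_eventually)
    qed
  qed (use fin a in \<open>auto simp: indicator_def intro!: ennreal_leI\<close>)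
  then have "(\<lambda>K. enn2real (T K)) \<longlonglongrightarrow> enn2real 0"
    by (intro tendsto_enn2real) auto
  then have T_lim: "(\<lambda>K. enn2real (T K)) \<longlonglongrightarrow> 0" by simp
  have r_ge: "G \<le> r n" if n: "n \<ge> 1" for n
    unfolding G_def
  proof (rule cSUP_least)
    fix s :: "int ^ 'd"
    have "ennreal (real n ^ CARD('d) * a s) \<le> ennreal (enn2real (I n))"
      using nn_integral_window_max_ge[of n a s] a[of s] Ifin[OF n]
      by (simp add: I_def[symmetric] ennreal_mult ennreal_of_nat_eq_real_of_nat ennreal_power)
    then have "real n ^ CARD('d) * a s \<le> enn2real (I n)" by (simp add: enn2real_nonneg)
    then show "a s \<le> r n" using n by (simp add: r_def field_simps)
  qed simp
  have r_le: "r n \<le> G * (1 + 2 * real K / real n) ^ CARD('d) + enn2real (T K)" if n: "n \<ge> 1" for n K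
  proof -
    have "I n \<le> of_nat ((n + 2 * K) ^ CARD('d)) * ennreal G + of_nat (n ^ CARD('d)) * T K"
      unfolding I_def T_def by (rule nn_integral_window_max_le_split[OF n a aG])
    also have "\<dots> = ennreal (real ((n + 2 * K) ^ CARD('d)) * G + real (n ^ CARD('d)) * enn2real (T K))"
    proof -
      have T_eq: "ennreal (enn2real (T K)) = T K" using Tfin[of K] by simp
      have c: "ennreal (real m * x) = of_nat m * ennreal x" for m x
        by (simp only: ennreal_mult'[OF of_nat_0_le_iff] ennreal_of_nat_eq_real_of_nat)
      show ?thesis
        using G0 by (simp only: ennreal_plus c T_eq of_nat_0_le_iff mult_nonneg_nonneg enn2real_nonneg)
    qed
    finally have "enn2real (I n) \<le> real ((n + 2 * K) ^ CARD('d)) * G + real (n ^ CARD('d)) * enn2real (T K)"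
      using G0 by (intro enn2real_leI) auto
    then have le: "r n \<le> (real ((n + 2 * K) ^ CARD('d)) * G + real (n ^ CARD('d)) * enn2real (T K)) / real n ^ CARD('d)"
      unfolding r_def by (rule divide_right_mono) simp
    have "1 + 2 * real K / real n = real (n + 2 * K) / real n"
      using n by (simp add: add_divide_distrib)
    then have eq: "(1 + 2 * real K / real n) ^ CARD('d) = real (n + 2 * K) ^ CARD('d) / real n ^ CARD('d)"
      by (simp only: power_divide)
    show ?thesis
      using le n unfolding eq by (simp add: add_divide_distrib mult.commute)
  qed
  have "r \<longlonglongrightarrow> G"
  proof (rule LIMSEQ_I)
    fix e :: real assume e: "0 < e"
    obtain K where K: "enn2real (T K) < e / 2"
      using order_tendstoD(2)[OF T_lim, of "e / 2"] e by (auto simp: eventually_sequentially)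
    have "(\<lambda>n. G * (1 + 2 * real K / real n) ^ CARD('d)) \<longlonglongrightarrow> G * (1 + 0) ^ CARD('d)"
      by (intro tendsto_intros lim_const_over_n)
    then have "eventually (\<lambda>n. G * (1 + 2 * real K / real n) ^ CARD('d) < G + e / 2) sequentially"
      using e by (intro order_tendstoD(2)) auto
    then have "eventually (\<lambda>n. norm (r n - G) < e) sequentially"
      using eventually_ge_at_top[of 1]
    proof eventually_elim
      case (elim n)
      then show ?case using r_le[of n K] r_ge[of n] K by auto
    qed
    then show "\<exists>no. \<forall>n\<ge>no. norm (r n - G) < e" by (simp add: eventually_sequentially)
  qed
  then have "(\<lambda>n. ennreal (r n)) \<longlonglongrightarrow> ennreal G" by simp
  moreover have "\<forall>\<^sub>F n in sequentially. ennreal (r n) = ennreal (1 / real n ^ CARD('d)) * I n"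
    using eventually_ge_at_top[of 1]
  proof eventually_elim
    case (elim n)
    have "ennreal (r n) = ennreal (1 / real n ^ CARD('d) * enn2real (I n))" by (simp add: r_def)
    also have "\<dots> = ennreal (1 / real n ^ CARD('d)) * I n"
      using Ifin[OF elim] by (subst ennreal_mult) auto
    finally show ?case .
  qed
  ultimately show ?thesis
    unfolding G_def I_def by (rule Lim_transform_eventually)
qed

text \<open>The supremum of an unbounded set of reals is an unspecified constant.\<close>

lemma Sup_real_not_bdd:
  fixes A B :: "real set"
  assumes "\<not> bdd_above A" "\<not> bdd_above B"
  shows "Sup A = Sup B"
proof -
  have no_bound: "(\<lambda>z. \<forall>x\<in>C. x \<le> z) = (\<lambda>z. False)" if "\<not> bdd_above C" for C :: "real set"
    using that unfolding bdd_above_def by (intro ext) blast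
  show ?thesis
    unfolding Sup_real_def no_bound[OF assms(1)] no_bound[OF assms(2)] ..
qed

text \<open>The function \<open>g\<close> of the moving average is a supremum in the reals, with an
  unspecified value on fibres where the family is unbounded. That value is the same on all of them,
  and they form a measurable set, so \<open>g\<close> is measurable without discarding a null
  set.\<close>

lemma borel_measurable_SUP_countable:
  fixes f :: "'i::countable \<Rightarrow> 'a \<Rightarrow> real"
  assumes [measurable]: "\<And>i. f i \<in> borel_measurable M"
  shows "(\<lambda>x. SUP i. f i x) \<in> borel_measurable M"
proof -
  define B where "B = {x \<in> space M. \<exists>n::nat. \<forall>i. f i x \<le> real n}"
  have [measurable]: "B \<in> sets M" unfolding B_def by measurable
  have bdd: "bdd_above (range (\<lambda>i. f i x)) \<longleftrightarrow> x \<in> B" if "x \<in> space M" for x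
  proof
    assume "bdd_above (range (\<lambda>i. f i x))"
    then obtain K where K: "\<And>i. f i x \<le> K" by (auto simp: bdd_above_def)
    obtain n :: nat where "K \<le> real n" using real_arch_simple by blast
    then have "\<forall>i. f i x \<le> real n" using K order_trans by blast
    then show "x \<in> B" using that unfolding B_def by blast
  next
    assume "x \<in> B"
    then obtain n :: nat where "\<And>i. f i x \<le> real n" by (auto simp: B_def)
    then show "bdd_above (range (\<lambda>i. f i x))" by (auto intro!: bdd_aboveI[of _ "real n"])
  qed
  have unb: "\<not> bdd_above (UNIV :: real set)"
    by (metis UNIV_I bdd_above_def gt_ex not_le)
  have eq: "(SUP i. f i x) = (if x \<in> B then SUP i. f i x * indicator B x else Sup UNIV)"
    if "x \<in> space M" for x
  proof (cases "x \<in> B")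
    case False
    then have "\<not> bdd_above (range (\<lambda>i. f i x))" using bdd[OF that] by simp
    then show ?thesis using Sup_real_not_bdd[OF _ unb] False by simp
  qed simp
  \<comment> \<open>Multiplying by the indicator makes the family bounded at every point, as
    \<open>borel_measurable_cSUP\<close> demands, and changes nothing on \<open>B\<close>.\<close>
  have "(\<lambda>x. SUP i. f i x * indicator B x) \<in> borel_measurable M"
  proof (rule borel_measurable_cSUP)
    fix x assume x: "x \<in> space M"
    show "bdd_above (range (\<lambda>i. f i x * indicator B x))"
    proof (cases "x \<in> B")
      case True
      then show ?thesis using bdd[OF x] by simp
    qed (auto intro!: bdd_aboveI[of _ 0])
  qed auto
  then have "(\<lambda>x. if x \<in> B then SUP i. f i x * indicator B x else Sup UNIV) \<in> borel_measurable M"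
    by measurable
  then show ?thesis by (subst measurable_cong[OF eq]) auto
qed

lemma SUP_abs_powr:
  fixes x :: "'i \<Rightarrow> real"
  assumes a: "0 < a" and bdd: "bdd_above (range (\<lambda>i. \<bar>x i\<bar> powr a))"
  shows "bdd_above (range (\<lambda>i. \<bar>x i\<bar>))" "(SUP i. \<bar>x i\<bar> powr a) = (SUP i. \<bar>x i\<bar>) powr a"
proof -
  let ?S = "SUP i. \<bar>x i\<bar> powr a"
  have le: "\<bar>x i\<bar> powr a \<le> ?S" for i by (rule cSUP_upper[OF UNIV_I bdd])
  have S0: "0 \<le> ?S" using le order_trans powr_ge_zero by blast
  have root: "\<bar>x i\<bar> \<le> ?S powr (1 / a)" for i
  proof -
    have "(\<bar>x i\<bar> powr a) powr (1 / a) \<le> ?S powr (1 / a)" using a le by (intro powr_mono2) auto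
    then show ?thesis using a by (simp add: powr_powr)
  qed
  then show bdd': "bdd_above (range (\<lambda>i. \<bar>x i\<bar>))" by (auto intro!: bdd_aboveI[of _ "?S powr (1 / a)"])
  have le': "\<bar>x i\<bar> \<le> (SUP i. \<bar>x i\<bar>)" for i by (rule cSUP_upper[OF UNIV_I bdd'])
  show "?S = (SUP i. \<bar>x i\<bar>) powr a"
  proof (rule antisym)
    show "?S \<le> (SUP i. \<bar>x i\<bar>) powr a"
      using a le' by (intro cSUP_least powr_mono2) auto
    have "(SUP i. \<bar>x i\<bar>) \<le> ?S powr (1 / a)" using root by (intro cSUP_least) auto
    then have "(SUP i. \<bar>x i\<bar>) powr a \<le> (?S powr (1 / a)) powr a"
      using a order_trans[OF abs_ge_zero le'] by (intro powr_mono2) auto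
    then show "(SUP i. \<bar>x i\<bar>) powr a \<le> ?S" using a S0 by (simp add: powr_powr)
  qed
qed

text \<open>By Tonelli almost every fibre of \<open>\<bar>h\<bar> powr \<alpha>\<close> is summable,
  so the fibrewise limit applies there. The fibre sum \<open>S\<close> is integrable and bounds the
  normalised averages for all \<open>n \<ge> 1\<close>, which gives dominated convergence; it also
  bounds \<open>g v powr \<alpha>\<close> almost everywhere.\<close>

theorem moving_average_Max_tendsto:
  fixes h :: "'w \<times> (int ^ 'd) \<Rightarrow> real"
  assumes alpha: "0 < \<alpha>" and sf: "sigma_finite_measure \<nu>"
    and h: "in_L \<alpha> (\<nu> \<Otimes>\<^sub>M count_space UNIV) h"
    and g: "\<And>v. g v = (SUP s. \<bar>h (v, s)\<bar>)"
  shows "AE v in \<nu>. bdd_above (range (\<lambda>s. \<bar>h (v, s)\<bar>))"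
    and "integrable \<nu> (\<lambda>v. g v powr \<alpha>)"
    and "(\<lambda>n. ennreal (1 / real n ^ CARD('d)) *
        (\<integral>\<^sup>+(v, s). ennreal (Max ((\<lambda>t. \<bar>h (v, t + s)\<bar> powr \<alpha>) ` window n)) \<partial>(\<nu> \<Otimes>\<^sub>M count_space UNIV)))
      \<longlonglongrightarrow> ennreal (\<integral>v. g v powr \<alpha> \<partial>\<nu>)"
proof -
  interpret C: sigma_finite_measure "count_space UNIV :: (int ^ 'd) measure"
    by (rule sigma_finite_measure_count_space)
  have [measurable]: "h \<in> borel_measurable (\<nu> \<Otimes>\<^sub>M count_space UNIV)" using h by (simp add: in_L_def)
  have [measurable]: "(\<lambda>v. h (v, s)) \<in> borel_measurable \<nu>" for s by measurable
  define a where "a v s = \<bar>h (v, s)\<bar> powr \<alpha>" for v s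
  define S where "S v = (\<integral>\<^sup>+s. ennreal (a v s) \<partial>count_space UNIV)" for v
  have a0: "0 \<le> a v s" for v s by (simp add: a_def)
  have [measurable]: "(\<lambda>(v, s). ennreal (a v s)) \<in> borel_measurable (\<nu> \<Otimes>\<^sub>M count_space UNIV)"
    unfolding a_def by measurable
  have [measurable]: "S \<in> borel_measurable \<nu>" unfolding S_def by measurable
  have "(\<integral>\<^sup>+v. S v \<partial>\<nu>) = (\<integral>\<^sup>+x. ennreal (\<bar>h x\<bar> powr \<alpha>) \<partial>(\<nu> \<Otimes>\<^sub>M count_space UNIV))"
  proof -
    have "(\<integral>\<^sup>+v. \<integral>\<^sup>+s. (case (v, s) of (v, s) \<Rightarrow> ennreal (a v s)) \<partial>count_space UNIV \<partial>\<nu>)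
        = (\<integral>\<^sup>+(v, s). ennreal (a v s) \<partial>(\<nu> \<Otimes>\<^sub>M count_space UNIV))"
      by (rule C.nn_integral_fst) measurable
    then show ?thesis by (simp add: S_def a_def split_beta')
  qed
  also have "\<dots> < \<infinity>" using h by (simp add: in_L_def nn_integral_eq_integral)
  finally have S_fin: "(\<integral>\<^sup>+v. S v \<partial>\<nu>) < \<infinity>" .
  then have AE_S: "AE v in \<nu>. S v < \<infinity>"
    using nn_integral_PInf_AE[of S \<nu>] by (auto simp: less_top elim!: eventually_mono)
  have point: "bdd_above (range (\<lambda>s. \<bar>h (v, s)\<bar>)) \<and> ennreal (g v powr \<alpha>) \<le> S v \<and>
      (\<lambda>n. ennreal (1 / real n ^ CARD('d)) * (\<integral>\<^sup>+s. ennreal (window_max (a v) n s) \<partial>count_space UNIV))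
        \<longlonglongrightarrow> ennreal (g v powr \<alpha>)" if "S v < \<infinity>" for v
  proof -
    have fin: "(\<integral>\<^sup>+s. ennreal (a v s) \<partial>count_space UNIV) < \<infinity>" using that by (simp add: S_def)
    have bdd: "bdd_above (range (\<lambda>s. \<bar>h (v, s)\<bar> powr \<alpha>))"
      using bdd_above_summable(1)[of "a v", OF a0 fin] by (simp add: a_def)
    have "(SUP s. a v s) = g v powr \<alpha>"
      using SUP_abs_powr(2)[OF alpha bdd] by (simp add: a_def g)
    then show ?thesis
      using SUP_abs_powr(1)[OF alpha bdd] bdd_above_summable(2)[of "a v", OF a0 fin]
        window_max_average_tendsto[of "a v", OF a0 fin]
      by (simp add: S_def)
  qed
  show "AE v in \<nu>. bdd_above (range (\<lambda>s. \<bar>h (v, s)\<bar>))"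
    using AE_S by eventually_elim (rule point[THEN conjunct1])
  have "(\<lambda>v. SUP s. \<bar>h (v, s)\<bar>) \<in> borel_measurable \<nu>"
    by (rule borel_measurable_SUP_countable) measurable
  then have [measurable]: "g \<in> borel_measurable \<nu>" by (simp add: g[abs_def])
  have "(\<integral>\<^sup>+v. ennreal (g v powr \<alpha>) \<partial>\<nu>) \<le> (\<integral>\<^sup>+v. S v \<partial>\<nu>)"
    using AE_S by (intro nn_integral_mono_AE, eventually_elim) (rule point[THEN conjunct2, THEN conjunct1])
  then have g_fin: "(\<integral>\<^sup>+v. ennreal (g v powr \<alpha>) \<partial>\<nu>) < \<infinity>" using S_fin by (rule le_less_trans)
  then show int: "integrable \<nu> (\<lambda>v. g v powr \<alpha>)"
    by (intro integrableI_nonneg) auto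
  define I where "I n v = (\<integral>\<^sup>+s. ennreal (window_max (a v) n s) \<partial>count_space UNIV)" for n v
  have wm [measurable]: "(\<lambda>(v, s). ennreal (window_max (a v) n s)) \<in> borel_measurable (\<nu> \<Otimes>\<^sub>M count_space UNIV)" for n
  proof -
    have [measurable]: "(\<lambda>(v, s). a v (t + s)) \<in> borel_measurable (\<nu> \<Otimes>\<^sub>M count_space UNIV)" for t
      unfolding a_def by measurable
    have "(\<lambda>x. Max ((\<lambda>t. case x of (v, s) \<Rightarrow> a v (t + s)) ` window n)) \<in> borel_measurable (\<nu> \<Otimes>\<^sub>M count_space UNIV)"
      by (intro borel_measurable_Max finite_window) measurable
    then show ?thesis by (simp add: window_max_def split_beta')
  qed
  have [measurable]: "I n \<in> borel_measurable \<nu>" for n unfolding I_def by measurable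
  \<comment> \<open>The shift to \<open>Suc n\<close> provides the condition
    \<open>n \<ge> 1\<close> of the dominating bound; it is undone at the end.\<close>
  have "(\<lambda>n. \<integral>\<^sup>+v. ennreal (1 / real (Suc n) ^ CARD('d)) * I (Suc n) v \<partial>\<nu>) \<longlonglongrightarrow> (\<integral>\<^sup>+v. ennreal (g v powr \<alpha>) \<partial>\<nu>)"
  proof (rule nn_integral_dominated_convergence[where w = S])
    show "AE v in \<nu>. ennreal (1 / real (Suc n) ^ CARD('d)) * I (Suc n) v \<le> S v" for n
    proof (rule AE_I2)
      fix v
      have "I (Suc n) v \<le> of_nat (Suc n ^ CARD('d)) * S v"
        unfolding I_def S_def using a0 by (intro nn_integral_window_max_le) auto
      then have "ennreal (1 / real (Suc n) ^ CARD('d)) * I (Suc n) v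
          \<le> ennreal (1 / real (Suc n) ^ CARD('d)) * (of_nat (Suc n ^ CARD('d)) * S v)"
        by (rule mult_left_mono) simp
      also have "\<dots> = ennreal (1 / real (Suc n) ^ CARD('d) * real (Suc n ^ CARD('d))) * S v"
        by (subst ennreal_mult) (auto simp: ennreal_of_nat_eq_real_of_nat mult.assoc simp del: of_nat_Suc of_nat_power)
      also have "\<dots> = S v" by simp
      finally show "ennreal (1 / real (Suc n) ^ CARD('d)) * I (Suc n) v \<le> S v" .
    qed
    show "AE v in \<nu>. (\<lambda>n. ennreal (1 / real (Suc n) ^ CARD('d)) * I (Suc n) v) \<longlonglongrightarrow> ennreal (g v powr \<alpha>)"
      using AE_S
    proof eventually_elim
      case (elim v)
      then have "(\<lambda>n. ennreal (1 / real n ^ CARD('d)) * I n v) \<longlonglongrightarrow> ennreal (g v powr \<alpha>)"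
        using point[of v] by (simp add: I_def)
      then show ?case by (rule LIMSEQ_Suc)
    qed
  qed (use S_fin in \<open>auto\<close>)
  moreover have "(\<integral>\<^sup>+v. ennreal (1 / real n ^ CARD('d)) * I n v \<partial>\<nu>) = ennreal (1 / real n ^ CARD('d)) *
        (\<integral>\<^sup>+(v, s). ennreal (Max ((\<lambda>t. \<bar>h (v, t + s)\<bar> powr \<alpha>) ` window n)) \<partial>(\<nu> \<Otimes>\<^sub>M count_space UNIV))" for n
  proof -
    have "(\<integral>\<^sup>+v. I n v \<partial>\<nu>) = (\<integral>\<^sup>+(v, s). ennreal (window_max (a v) n s) \<partial>(\<nu> \<Otimes>\<^sub>M count_space UNIV))"
      unfolding I_def using C.nn_integral_fst[OF wm[of n]] by simp
    then show ?thesis by (simp add: nn_integral_cmult window_max_def a_def)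
  qed
  ultimately have lim: "(\<lambda>n. ennreal (1 / real (Suc n) ^ CARD('d)) *
        (\<integral>\<^sup>+(v, s). ennreal (Max ((\<lambda>t. \<bar>h (v, t + s)\<bar> powr \<alpha>) ` window (Suc n))) \<partial>(\<nu> \<Otimes>\<^sub>M count_space UNIV)))
      \<longlonglongrightarrow> ennreal (\<integral>v. g v powr \<alpha> \<partial>\<nu>)"
    using int by (simp only: nn_integral_eq_integral powr_ge_zero AE_I2)
  show "(\<lambda>n. ennreal (1 / real n ^ CARD('d)) *
        (\<integral>\<^sup>+(v, s). ennreal (Max ((\<lambda>t. \<bar>h (v, t + s)\<bar> powr \<alpha>) ` window n)) \<partial>(\<nu> \<Otimes>\<^sub>M count_space UNIV)))
      \<longlonglongrightarrow> ennreal (\<integral>v. g v powr \<alpha> \<partial>\<nu>)"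
    using LIMSEQ_imp_Suc[OF lim] .
qed

section \<open>Normalisation of the scales and the zero field\<close>

lemma scaled_root_tendsto:
  assumes a: "0 < a" and I: "\<And>n. n \<ge> 1 \<Longrightarrow> 0 \<le> I n" and lim: "(\<lambda>n. I n / real n ^ d) \<longlonglongrightarrow> L"
  shows "(\<lambda>n. real n powr (- (real d / a)) * I n powr (1 / a)) \<longlonglongrightarrow> L powr (1 / a)"
proof -
  have "(\<lambda>n. (I n / real n ^ d) powr (1 / a)) \<longlonglongrightarrow> L powr (1 / a)"
  \<comment> \<open>The limit may be 0, as it is in the conservative case; there continuity of
    \<open>powr\<close> requires a positive exponent and an eventually nonnegative base.\<close>
  proof (rule tendsto_powr'[OF lim tendsto_const], rule disjI2, rule conjI)
    show "\<forall>\<^sub>F n in sequentially. 0 \<le> I n / real n ^ d"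
      using eventually_ge_at_top[of 1] by eventually_elim (use I in simp)
  qed (use a in simp)
  moreover have "\<forall>\<^sub>F n in sequentially. (I n / real n ^ d) powr (1 / a)
      = real n powr (- (real d / a)) * I n powr (1 / a)"
    using eventually_ge_at_top[of 1]
  proof eventually_elim
    case (elim n)
    have "real n powr (- (real d / a)) = inverse ((real n powr real d) powr (1 / a))"
      by (simp add: powr_powr powr_minus)
    also have "real n powr real d = real n ^ d" using elim by (simp add: powr_realpow)
    finally have root: "real n powr (- (real d / a)) = inverse ((real n ^ d) powr (1 / a))" .
    have "(I n / real n ^ d) powr (1 / a) = I n powr (1 / a) / (real n ^ d) powr (1 / a)"
      by (rule powr_divide)
    then show ?case unfolding root by (simp add: divide_inverse mult.commute)
  qed
  ultimately show ?thesis by (rule Lim_transform_eventually)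
qed

text \<open>The constant 1 is the characteristic function of the point mass at 0. This serves to
  recognise the zero field.\<close>

lemma AE_zero_if_char_one:
  assumes "prob_space P" and [measurable]: "Z \<in> borel_measurable P" and char: "\<And>\<theta>. char (distr P borel Z) \<theta> = 1"
  shows "AE \<omega> in P. Z \<omega> = 0"
proof -
  interpret prob_space P by fact
  interpret R: real_distribution "return borel (0 :: real)"
    by (intro real_distribution.intro prob_space_return real_distribution_axioms.intro) auto
  have "distr P borel Z = return borel 0"
  proof (rule Levy_uniqueness)
    show "char (distr P borel Z) = char (return borel 0)"
    proof
      fix \<theta>
      have "char (return borel (0 :: real)) \<theta> = 1" by (simp add: char_def integral_return)
      then show "char (distr P borel Z) \<theta> = char (return borel 0) \<theta>" by (simp only: char)
    qed
  qed (auto intro: R.real_distribution_axioms)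
  then have "AE x in distr P borel Z. x = 0" by (simp only:) (subst AE_return, auto)
  then show ?thesis by (rule AE_distrD[rotated]) measurable
qed

theorem proposition4p1:
  fixes \<alpha> :: real
    and P :: "'p measure" and X :: "int ^ 'd \<Rightarrow> 'p \<Rightarrow> real"
    and \<mu> :: "'a measure" and Q :: "'q measure" and M :: "'a set \<Rightarrow> 'q \<Rightarrow> real"
    and \<phi> :: "int ^ 'd \<Rightarrow> 'a \<Rightarrow> 'a" and c :: "int ^ 'd \<Rightarrow> 'a \<Rightarrow> real" and f :: "'a \<Rightarrow> real"
    and \<nu> :: "'w measure" and Q' :: "'r measure" and M' :: "('w \<times> (int ^ 'd)) set \<Rightarrow> 'r \<Rightarrow> real"
    and h :: "'w \<times> (int ^ 'd) \<Rightarrow> real"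
    and F :: "int ^ 'd \<Rightarrow> 'a \<Rightarrow> real" and b :: "nat \<Rightarrow> real" and g :: "'w \<Rightarrow> real"
  assumes "0 < \<alpha>" "\<alpha> < 2"
    and "prob_space P" "sas_field \<alpha> P X" "stationary_field P X" "\<not> gaussian_field P X"
    and "standard_borel \<mu>" "sigma_finite_measure \<mu>"
    and "nonsingular_action \<mu> \<phi>" "sign_cocycle \<mu> \<phi> c" "in_L \<alpha> \<mu> f"
    and "integral_representation \<alpha> P X \<mu> Q M F" "full_support \<mu> F"
    and F_eq: "\<And>t s. F t s = action_kernel \<alpha> \<mu> \<phi> c f t s"
    and b_eq: "\<And>n. b n = max_scale \<alpha> \<mu> F n"
    and g_eq: "\<And>v. g v = (SUP s. \<bar>h (v, s)\<bar>)"
  shows "(conservative \<mu> \<phi> \<longrightarrow>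
            (\<lambda>n. real n powr (- (real CARD('d) / \<alpha>)) * b n) \<longlonglongrightarrow> 0) \<and>
         (dissipative \<mu> \<phi> \<and> standard_borel \<nu> \<and> sigma_finite_measure \<nu> \<and>
          mixed_moving_average \<alpha> P X \<nu> Q' M' h \<longrightarrow>
            (AE v in \<nu>. bdd_above (range (\<lambda>s. \<bar>h (v, s)\<bar>))) \<and>
            integrable \<nu> (\<lambda>v. g v powr \<alpha>) \<and>
            0 < (\<integral>v. g v powr \<alpha> \<partial>\<nu>) powr (1 / \<alpha>) \<and>
            (\<lambda>n. real n powr (- (real CARD('d) / \<alpha>)) * b n)
              \<longlonglongrightarrow> (\<integral>v. g v powr \<alpha> \<partial>\<nu>) powr (1 / \<alpha>))"
proof -
  note alpha = assms(1,2) and F_rep = assms(12)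
  interpret nonsingular \<mu> \<phi>
    using assms by (intro nonsingular.intro nonsingular_axioms.intro) auto
  have X: "X t \<in> borel_measurable P" for t using assms(4) by (simp add: sas_field_def)
  have F_L: "in_L \<alpha> \<mu> (F t)" for t using F_rep by (simp add: integral_representation_def)
  have [measurable]: "F t \<in> borel_measurable \<mu>" for t using F_L by (simp add: in_L_def)
  define I where "I n = (\<integral>s. Max ((\<lambda>t. \<bar>F t s\<bar> powr \<alpha>) ` window n) \<partial>\<mu>)" for n
  have b_I: "b n = I n powr (1 / \<alpha>)" for n
    by (simp add: b_eq max_scale_def I_def window_def)
  have Max_nonneg: "0 \<le> Max ((\<lambda>t. \<bar>F t s\<bar> powr \<alpha>) ` window n)" if "n \<ge> 1" for n s
    using finite_window[of n] window_nonempty[OF that]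
    by (meson Max_ge ex_in_conv finite_imageI imageI order_trans powr_ge_zero)
  have I_nonneg: "0 \<le> I n" if "n \<ge> 1" for n
    unfolding I_def by (intro integral_nonneg_AE AE_I2 Max_nonneg that)
  have b_tendsto: "(\<lambda>n. real n powr (- (real CARD('d) / \<alpha>)) * b n) \<longlonglongrightarrow> L powr (1 / \<alpha>)"
    if "(\<lambda>n. I n / real n ^ CARD('d)) \<longlonglongrightarrow> L" for L
    unfolding b_I using alpha(1) I_nonneg that by (rule scaled_root_tendsto)
  show ?thesis
  proof (intro conjI impI)
    assume cons: "conservative \<mu> \<phi>"
    define U where "U s = \<bar>f s\<bar> powr \<alpha>" for s
    have F_transport: "\<bar>F t s\<bar> powr \<alpha> = transport U t s" if "s \<in> space \<mu>" for t s
    proof -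
      have "c t s \<in> {-1, 1}" using assms(10) that by (simp add: sign_cocycle_def)
      then have "\<bar>c t s\<bar> = 1" by auto
      then have "\<bar>F t s\<bar> = rjac t s powr (1 / \<alpha>) * \<bar>f (\<phi> t s)\<bar>"
        by (simp add: F_eq action_kernel_def rjac_def jac_def abs_mult)
      moreover have "(rjac t s powr (1 / \<alpha>)) powr \<alpha> = rjac t s"
        using alpha by (simp add: powr_powr rjac_def)
      ultimately show ?thesis by (simp add: powr_mult transport_def U_def)
    qed
    have "I n = (\<integral>s. Max ((\<lambda>t. transport U t s) ` window n) \<partial>\<mu>)" for n
      unfolding I_def by (intro Bochner_Integration.integral_cong) (auto simp: F_transport)
    moreover have "(\<lambda>n. (\<integral>s. Max ((\<lambda>t. transport U t s) ` window n) \<partial>\<mu>) / real n ^ CARD('d)) \<longlonglongrightarrow> 0"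
      using assms(11) cons by (intro conservative_Max_transport) (auto simp: U_def[abs_def] in_L_def)
    ultimately have "(\<lambda>n. I n / real n ^ CARD('d)) \<longlonglongrightarrow> 0" by simp
    then show "(\<lambda>n. real n powr (- (real CARD('d) / \<alpha>)) * b n) \<longlonglongrightarrow> 0"
      using b_tendsto by fastforce
  next
    assume "dissipative \<mu> \<phi> \<and> standard_borel \<nu> \<and> sigma_finite_measure \<nu> \<and> mixed_moving_average \<alpha> P X \<nu> Q' M' h"
    then have sf: "sigma_finite_measure \<nu>" and mma: "mixed_moving_average \<alpha> P X \<nu> Q' M' h" by auto
    let ?N = "\<nu> \<Otimes>\<^sub>M (count_space UNIV :: (int ^ 'd) measure)"
    let ?H = "\<lambda>t (v, s). h (v, t + s)"
    have h: "in_L \<alpha> ?N h" and H_rep: "integral_representation \<alpha> P X ?N Q' M' ?H"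
      using mma by (auto simp: mixed_moving_average_def)
    have [measurable]: "h \<in> borel_measurable ?N" using h by (simp add: in_L_def)
    interpret N: sigma_finite_measure \<nu> by (rule sf)
    interpret C: sigma_finite_measure "count_space UNIV :: (int ^ 'd) measure"
      by (rule sigma_finite_measure_count_space)
    interpret NC: pair_sigma_finite \<nu> "count_space UNIV :: (int ^ 'd) measure" ..
    have sf_N: "sigma_finite_measure ?N" by unfold_locales
    note lims = moving_average_Max_tendsto[OF alpha(1) sf h g_eq]
    define L where "L = (\<integral>v. g v powr \<alpha> \<partial>\<nu>)"
    show "AE v in \<nu>. bdd_above (range (\<lambda>s. \<bar>h (v, s)\<bar>))" "integrable \<nu> (\<lambda>v. g v powr \<alpha>)"
      by (fact lims)+
    have L0: "0 \<le> L" by (simp add: L_def)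
    define R where "R n = (\<integral>\<^sup>+(v, s). ennreal (Max ((\<lambda>t. \<bar>h (v, t + s)\<bar> powr \<alpha>) ` window n)) \<partial>?N)" for n
    have I_R: "I n = enn2real (R n)" if "n \<ge> 1" for n
    proof -
      have "(\<lambda>s. Max ((\<lambda>t. \<bar>F t s\<bar> powr \<alpha>) ` window n)) \<in> borel_measurable \<mu>"
        by (intro borel_measurable_Max finite_window) measurable
      then have "I n = enn2real (\<integral>\<^sup>+s. ennreal (Max ((\<lambda>t. \<bar>F t s\<bar> powr \<alpha>) ` window n)) \<partial>\<mu>)"
        unfolding I_def by (intro integral_eq_nn_integral AE_I2 Max_nonneg that)
      \<comment> \<open>The link between the two representations: from here on the integral is taken
        over the space of the moving average.\<close>
      also have "(\<integral>\<^sup>+s. ennreal (Max ((\<lambda>t. \<bar>F t s\<bar> powr \<alpha>) ` window n)) \<partial>\<mu>)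
          = (\<integral>\<^sup>+x. ennreal (Max ((\<lambda>t. \<bar>?H t x\<bar> powr \<alpha>) ` window n)) \<partial>?N)"
        by (rule nn_integral_Max_representation_eq[OF alpha X finite_window window_nonempty[OF that]
              sigma_finite_measure_axioms sf_N F_rep H_rep])
      finally show ?thesis by (simp add: R_def split_beta')
    qed
    have "(\<lambda>n. enn2real (ennreal (1 / real n ^ CARD('d)) * R n)) \<longlonglongrightarrow> enn2real (ennreal L)"
      using lims(3) unfolding R_def L_def by (intro tendsto_enn2real) auto
    then have "(\<lambda>n. 1 / real n ^ CARD('d) * enn2real (R n)) \<longlonglongrightarrow> L"
      using L0 by (simp add: enn2real_mult)
    moreover have "\<forall>\<^sub>F n in sequentially. 1 / real n ^ CARD('d) * enn2real (R n) = I n / real n ^ CARD('d)"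
      using eventually_ge_at_top[of 1] by eventually_elim (simp add: I_R)
    ultimately have "(\<lambda>n. I n / real n ^ CARD('d)) \<longlonglongrightarrow> L" by (rule Lim_transform_eventually)
    then show "(\<lambda>n. real n powr (- (real CARD('d) / \<alpha>)) * b n) \<longlonglongrightarrow> (\<integral>v. g v powr \<alpha> \<partial>\<nu>) powr (1 / \<alpha>)"
      unfolding L_def[symmetric] by (rule b_tendsto)
    \<comment> \<open>If \<open>L = 0\<close>, the kernel \<open>h\<close> vanishes on almost every
      fibre, every linear combination of the field has characteristic function 1 and is almost
      surely 0, and the field would be Gaussian in the degenerate sense.\<close>
    have "L \<noteq> 0"
    proof
      assume "L = 0"
      then have "AE v in \<nu>. g v powr \<alpha> = 0"
        using integral_nonneg_eq_0_iff_AE[OF lims(2)] by (simp add: L_def)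
      \<comment> \<open>The variable \<open>s\<close> is a dummy: it gives the claim the iterated
        form from which a statement about almost every point of the product follows.\<close>
      with lims(1) have "AE v in \<nu>. AE s in count_space UNIV. \<forall>t. h (fst (v, s :: int ^ 'd), t) = 0"
      proof eventually_elim
        case (elim v)
        have "h (v, t) = 0" for t
        proof -
          have "\<bar>h (v, t)\<bar> \<le> g v" unfolding g_eq by (rule cSUP_upper[OF UNIV_I elim(1)])
          then show ?thesis using elim(2) by simp
        qed
        then show ?case by simp
      qed
      then have "AE x in ?N. \<forall>t. h (fst x, t) = 0"
        by (intro NC.AE_pair_measure) measurable
      then have "(\<integral>x. \<bar>\<Sum>t\<in>J. k t * ?H t x\<bar> powr \<alpha> \<partial>?N) = 0" for J k
        by (intro integral_eq_zero_AE, eventually_elim) (simp add: split_beta')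
      then have char: "char (distr P borel (\<lambda>\<omega>. \<Sum>t\<in>J. k t * X t \<omega>)) \<theta> = 1" if "finite J" for J k \<theta>
        using char_integral_representation[OF alpha(1) H_rep that X, of k \<theta>] by simp
      have "AE \<omega> in P. (\<Sum>t\<in>J. k t * X t \<omega>) = 0" if "finite J" for J k
        using X by (intro AE_zero_if_char_one assms(3) char that borel_measurable_sum borel_measurable_times) auto
      then have "gaussian_field P X" unfolding gaussian_field_def by blast
      then show False using assms(6) by blast
    qed
    then show "0 < (\<integral>v. g v powr \<alpha> \<partial>\<nu>) powr (1 / \<alpha>)"
      unfolding L_def[symmetric] using L0 by simp
  qed
qed

end
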